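(* Let $q$ be a Strebel differential on a compact connected Riemann surface $X$. Then $q$ has real periods; that is, if $\pi:\hat X\to X$ is the spectral cover of $(X,q)$ and $\omega$ is the meromorphic $1$-form on $\hat X$ with $\pi^*q=\omega\otimes\omega$, then $\int_\gamma\omega\in\mathbb{R}$ for every piecewise smooth loop $\gamma$ in $\hat X\setminus\{\text{simple poles of }\omega\}$.
   Context: Let $X$ be a compact connected Riemann surface. A quadratic differential $q$ on $X$ is a meromorphic section of $K_X^{\otimes 2}$; its zeros and poles are its critical points. Only quadratic differentials whose critical points have order at least $-2$ are considered. Writing $q=f_U(z)\,dz^2$ locally, the $q$-metric is $|f_U|\,|dz|^2$ away from critical points. A horizontal geodesic is a curve $\gamma(t)$ with $f_U(\gamma(t))\gamma'(t)^2>0$ for all $t$; a (horizontal) trajectory is a maximal horizontal geodesic. A trajectory is closed if it is a closed curve, critical if it connects two critical points, and recurrent otherwise. A JS differential is a quadratic differential with no recurrent trajectories which, in a local coordinate $z$ centered at any double pole, has the form $-\left(\frac{b_{-2}}{z^2}+\frac{b_{-1}}{z}+b_0+\cdots\right)dz^2$ with $b_{-2}>0$. Its critical graph is the graph formed by its critical trajectories. A Strebel differential is a JS differential that has $n\ge 1$ double poles and no simple pole, whose trajectories have finite lengths in the $q$-metric, and whose critical graph is connected and decomposes $X$ into $n$ open topological discs, each containing exactly one of the $n$ double poles. Spectral cover: for a quadratic differential $q$ with critical points of order at least $-2$, the spectral cover $\pi:\hat X\to X$ is the canonical double cover determined by the two branches of $\sqrt q$, branched exactly over the critical points of $q$ of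 odd order; on $\hat X$ there is a globally defined meromorphic $1$-form $\omega$ with at most simple poles such that $\pi^*q=\omega\otimes\omega$ and $\tau^*\omega=-\omega$, where $\tau$ is the covering involution. $\hat X$ is connected if and only if $q$ is not globally the square of an Abelian differential (meromorphic 1-form) on $X$; otherwise $\hat X$ is two copies of $X$, with $\omega$ equal to the two square roots of $q$. *)

theory Defs
  imports "HOL-Complex_Analysis.Complex_Analysis"
begin

section \<open>Riemann surfaces\<close>

text \<open>
  A chart is a pair of its open domain and a coordinate map; only the values of the
  coordinate map on the domain matter.  The surface is the whole type, with the topology
  given by its type class, and is not required to be connected.
\<close>

type_synonym 'a chart = "'a set \<times> ('a \<Rightarrow> complex)"

definition chart_inv :: "'a chart \<Rightarrow> complex \<Rightarrow> 'a" where
  "chart_inv c = inv_into (fst c) (snd c)"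

definition riemann_surface :: "'a::t2_space chart set \<Rightarrow> bool" where
  "riemann_surface A \<longleftrightarrow>
     (\<forall>c\<in>A. open (fst c) \<and> open (snd c ` fst c)
           \<and> homeomorphism (fst c) (snd c ` fst c) (snd c) (chart_inv c)) \<and>
     (\<Union>c\<in>A. fst c) = UNIV \<and>
     (\<forall>c\<in>A. \<forall>d\<in>A. (snd d \<circ> chart_inv c) holomorphic_on (snd c ` (fst c \<inter> fst d)))"

definition holomorphic_map ::
  "'b::t2_space chart set \<Rightarrow> 'a::t2_space chart set \<Rightarrow> ('b \<Rightarrow> 'a) \<Rightarrow> bool" where
  "holomorphic_map B A f \<longleftrightarrow> continuous_on UNIV f \<and>
     (\<forall>d\<in>B. \<forall>c\<in>A. (snd c \<circ> f \<circ> chart_inv d) holomorphic_on (snd d ` (fst d \<inter> f -` fst c)))"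

text \<open>Only used for quantities that do not depend on the choice of the chart.\<close>

definition chart_at :: "'a chart set \<Rightarrow> 'a \<Rightarrow> 'a chart" where
  "chart_at A p = (SOME c. c \<in> A \<and> p \<in> fst c)"


section \<open>Meromorphic differentials\<close>

text \<open>
  A meromorphic section of the \<open>k\<close>-th power of the canonical bundle is given by its local
  functions: \<open>q c z\<close> is the coefficient of \<open>dz^k\<close> in the chart \<open>c\<close>, as a function of the
  coordinate \<open>z\<close>.  The local functions are normalised to have no removable singularities
  and the value 0 at poles, so the transformation law can be required at every point.
\<close>

type_synonym 'a differential = "'a chart \<Rightarrow> complex \<Rightarrow> complex"

definition meromorphic_differential ::
  "nat \<Rightarrow> 'a::t2_space chart set \<Rightarrow> 'a differential \<Rightarrow> bool" where
  "meromorphic_differential k A q \<longleftrightarrow>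
     (\<forall>c\<in>A. q c nicely_meromorphic_on (snd c ` fst c)) \<and>
     (\<forall>c\<in>A. \<forall>d\<in>A. \<forall>z \<in> snd c ` (fst c \<inter> fst d).
        q c z = q d ((snd d \<circ> chart_inv c) z) * deriv (snd d \<circ> chart_inv c) z ^ k)"

text \<open>
  \<open>r\<close> is the pullback \<open>f\<^sup>*q\<close>.  The two sides are compared as meromorphic functions, i.e. on
  punctured neighbourhoods: at a ramification point lying over a pole the right-hand side
  below may have a removable singularity.
\<close>

definition is_pullback ::
  "nat \<Rightarrow> 'b chart set \<Rightarrow> 'a chart set \<Rightarrow> ('b \<Rightarrow> 'a) \<Rightarrow> 'a differential \<Rightarrow> 'b differential \<Rightarrow> bool"
  where
  "is_pullback k B A f q r \<longleftrightarrow>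
     (\<forall>d\<in>B. \<forall>c\<in>A. \<forall>y \<in> fst d \<inter> f -` fst c.
        \<forall>\<^sub>F z in at (snd d y).
          r d z = q c ((snd c \<circ> f \<circ> chart_inv d) z) * deriv (snd c \<circ> f \<circ> chart_inv d) z ^ k)"

text \<open>Positive at zeros, negative at poles, 0 elsewhere.\<close>

definition order_at :: "'a chart set \<Rightarrow> 'a differential \<Rightarrow> 'a \<Rightarrow> int" where
  "order_at A q p = zorder (q (chart_at A p)) (snd (chart_at A p) p)"

definition critical_point :: "'a chart set \<Rightarrow> 'a differential \<Rightarrow> 'a \<Rightarrow> bool" where
  "critical_point A q p \<longleftrightarrow> order_at A q p \<noteq> 0"

definition double_poles :: "'a chart set \<Rightarrow> 'a differential \<Rightarrow> 'a set" where
  "double_poles A q = {p. order_at A q p = -2}"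

definition simple_poles :: "'a chart set \<Rightarrow> 'a differential \<Rightarrow> 'a set" where
  "simple_poles A q = {p. order_at A q p = -1}"


section \<open>Horizontal trajectories\<close>

text \<open>
  The parameter interval \<open>I\<close> may be unbounded.  The positivity condition keeps the curve away
  from zeros and poles of \<open>q\<close>, where \<open>q c\<close> has the value 0.
\<close>

definition horizontal_geodesic ::
  "'a::t2_space chart set \<Rightarrow> 'a differential \<Rightarrow> real set \<Rightarrow> (real \<Rightarrow> 'a) \<Rightarrow> bool" where
  "horizontal_geodesic A q I \<gamma> \<longleftrightarrow>
     open I \<and> is_interval I \<and> I \<noteq> {} \<and> continuous_on I \<gamma> \<and>
     (\<forall>c\<in>A. (snd c \<circ> \<gamma>) C1_differentiable_on (I \<inter> \<gamma> -` fst c) \<and>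
        (\<forall>t \<in> I \<inter> \<gamma> -` fst c.
           let v = q c (snd c (\<gamma> t)) * (vector_derivative (snd c \<circ> \<gamma>) (at t))\<^sup>2
           in v \<in> \<real> \<and> Re v > 0))"

text \<open>
  Horizontal geodesics come without a distinguished parametrisation, so a trajectory is
  represented by its set of points, and maximality refers to inclusion of these sets.
\<close>

definition trajectory :: "'a::t2_space chart set \<Rightarrow> 'a differential \<Rightarrow> 'a set \<Rightarrow> bool" where
  "trajectory A q T \<longleftrightarrow>
     (\<exists>I \<gamma>. horizontal_geodesic A q I \<gamma> \<and> T = \<gamma> ` I) \<and>
     (\<forall>J \<delta>. horizontal_geodesic A q J \<delta> \<and> T \<subseteq> \<delta> ` J \<longrightarrow> \<delta> ` J = T)"

definition closed_trajectory :: "'a::t2_space chart set \<Rightarrow> 'a differential \<Rightarrow> 'a set \<Rightarrow> bool" where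
  "closed_trajectory A q T \<longleftrightarrow> trajectory A q T \<and>
     (\<exists>I \<gamma> a b. horizontal_geodesic A q I \<gamma> \<and> {a..b} \<subseteq> I \<and> a < b
                \<and> \<gamma> a = \<gamma> b \<and> T = \<gamma> ` {a..b})"

definition trajectory_connects ::
  "'a::t2_space chart set \<Rightarrow> 'a differential \<Rightarrow> 'a set \<Rightarrow> 'a \<Rightarrow> 'a \<Rightarrow> bool" where
  "trajectory_connects A q T p p' \<longleftrightarrow> trajectory A q T \<and>
     (\<exists>a b \<gamma>. a < b \<and> horizontal_geodesic A q {a<..<b} \<gamma> \<and> T = \<gamma> ` {a<..<b}
              \<and> (\<gamma> \<longlongrightarrow> p) (at_right a) \<and> (\<gamma> \<longlongrightarrow> p') (at_left b))"

definition critical_trajectory :: "'a::t2_space chart set \<Rightarrow> 'a differential \<Rightarrow> 'a set \<Rightarrow> bool" where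
  "critical_trajectory A q T \<longleftrightarrow>
     (\<exists>p p'. critical_point A q p \<and> critical_point A q p' \<and> trajectory_connects A q T p p')"

definition recurrent_trajectory :: "'a::t2_space chart set \<Rightarrow> 'a differential \<Rightarrow> 'a set \<Rightarrow> bool" where
  "recurrent_trajectory A q T \<longleftrightarrow>
     trajectory A q T \<and> \<not> closed_trajectory A q T \<and> \<not> critical_trajectory A q T"

text \<open>The union of the edges (critical trajectories) and the vertices (their end points).\<close>

definition critical_graph :: "'a::t2_space chart set \<Rightarrow> 'a differential \<Rightarrow> 'a set" where
  "critical_graph A q =
     \<Union>{T \<union> {p, p'} | T p p'. critical_point A q p \<and> critical_point A q p'
                             \<and> trajectory_connects A q T p p'}"

text \<open>Length of a curve with respect to \<open>|q|\<close>, whose line element is \<open>|f|^(1/2) |dz|\<close>.\<close>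

definition q_length ::
  "'a::t2_space chart set \<Rightarrow> 'a differential \<Rightarrow> real set \<Rightarrow> (real \<Rightarrow> 'a) \<Rightarrow> ennreal" where
  "q_length A q I \<gamma> =
     (\<integral>\<^sup>+ t \<in> I. ennreal (let c = chart_at A (\<gamma> t) in
         sqrt (cmod (q c (snd c (\<gamma> t)))) * cmod (vector_derivative (snd c \<circ> \<gamma>) (at t))) \<partial>lborel)"

text \<open>
  Any parametrisation may serve as a witness: a horizontal geodesic runs along its trajectory
  in one direction, so it is injective unless the trajectory is closed, and a closed
  trajectory always has a parametrisation of finite length.
\<close>

definition finite_length :: "'a::t2_space chart set \<Rightarrow> 'a differential \<Rightarrow> 'a set \<Rightarrow> bool" where
  "finite_length A q T \<longleftrightarrow>
     (\<exists>I \<gamma>. horizontal_geodesic A q I \<gamma> \<and> \<gamma> ` I = T \<and> q_length A q I \<gamma> < \<infinity>)"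


section \<open>JS and Strebel differentials\<close>

text \<open>
  The Laurent expansion at \<open>snd c p\<close> is the one in the local coordinate \<open>snd c - snd c p\<close>,
  which is centered at \<open>p\<close>.
\<close>

definition JS_differential :: "'a::t2_space chart set \<Rightarrow> 'a differential \<Rightarrow> bool" where
  "JS_differential A q \<longleftrightarrow>
     meromorphic_differential 2 A q \<and>
     (\<exists>c\<in>A. \<exists>z \<in> snd c ` fst c. q c z \<noteq> 0) \<and>
     (\<forall>p. order_at A q p \<ge> -2) \<and>
     (\<forall>p \<in> double_poles A q. \<forall>c\<in>A. p \<in> fst c \<longrightarrow>
        (\<exists>b::real. b > 0 \<and> fls_nth (laurent_expansion (q c) (snd c p)) (-2) = - of_real b)) \<and>
     (\<nexists>T. recurrent_trajectory A q T)"

definition strebel_differential :: "'a::t2_space chart set \<Rightarrow> 'a differential \<Rightarrow> bool" where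
  "strebel_differential A q \<longleftrightarrow>
     JS_differential A q \<and>
     finite (double_poles A q) \<and> card (double_poles A q) \<ge> 1 \<and>
     simple_poles A q = {} \<and>
     (\<forall>T. trajectory A q T \<longrightarrow> finite_length A q T) \<and>
     connected (critical_graph A q) \<and>
     card (components (- critical_graph A q)) = card (double_poles A q) \<and>
     (\<forall>D \<in> components (- critical_graph A q).
        open D \<and> D homeomorphic ball (0::complex) 1 \<and> (\<exists>!p. p \<in> D \<inter> double_poles A q))"


section \<open>The spectral cover\<close>

text \<open>
  A double cover \<open>\<pi>\<close> by a compact surface, branched exactly over the points of odd order,
  with covering involution \<open>\<tau>\<close>.  Over a point that is not critical, the values of \<open>\<omega>\<close> at the
  two points of the fibre are the two branches of the square root of \<open>q\<close>; this determines
  \<open>(\<pi>, \<omega>)\<close> up to isomorphism.  The cover need not be connected.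
\<close>

definition spectral_cover ::
  "'a::t2_space chart set \<Rightarrow> 'a differential \<Rightarrow>
   'b::t2_space chart set \<Rightarrow> ('b \<Rightarrow> 'a) \<Rightarrow> 'b differential \<Rightarrow> bool" where
  "spectral_cover A q B \<pi> \<omega> \<longleftrightarrow>
     riemann_surface B \<and> compact (UNIV :: 'b set) \<and>
     holomorphic_map B A \<pi> \<and>
     (let R = {x. odd (order_at A q x)} in
        covering_space (\<pi> -` (- R)) \<pi> (- R) \<and>
        (\<forall>x. card (\<pi> -` {x}) = (if x \<in> R then 1 else 2))) \<and>
     meromorphic_differential 1 B \<omega> \<and>
     (\<forall>y. order_at B \<omega> y \<ge> -1) \<and>
     is_pullback 2 B A \<pi> q (\<lambda>d z. \<omega> d z * \<omega> d z) \<and>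
     (\<exists>\<tau>. holomorphic_map B B \<tau> \<and> (\<forall>y. \<pi> -` {\<pi> y} = {y, \<tau> y}) \<and>
          is_pullback 1 B B \<tau> \<omega> (\<lambda>d z. - \<omega> d z))"


section \<open>Line integrals of 1-forms\<close>

definition piecewise_smooth_path :: "'b::t2_space chart set \<Rightarrow> (real \<Rightarrow> 'b) \<Rightarrow> bool" where
  "piecewise_smooth_path B \<gamma> \<longleftrightarrow> path \<gamma> \<and>
     (\<forall>d\<in>B. \<forall>a b. {a..b} \<subseteq> {0..1} \<and> \<gamma> ` {a..b} \<subseteq> fst d \<longrightarrow>
        (snd d \<circ> \<gamma>) piecewise_C1_differentiable_on {a..b})"

text \<open>
  The analogue of \<open>has_contour_integral\<close>.  By the transformation law the integrand depends
  on the choice of the charts only at the finitely many break points of \<open>\<gamma>\<close>.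
\<close>

definition form_has_integral ::
  "'b::t2_space chart set \<Rightarrow> 'b differential \<Rightarrow> (real \<Rightarrow> 'b) \<Rightarrow> complex \<Rightarrow> bool" where
  "form_has_integral B \<omega> \<gamma> i \<longleftrightarrow>
     ((\<lambda>t. let d = chart_at B (\<gamma> t) in
         \<omega> d (snd d (\<gamma> t)) * vector_derivative (snd d \<circ> \<gamma>) (at t within {0..1}))
       has_integral i) {0..1}"

end

theory Submission
  imports Defs
begin

text \<open>
  A loop in the spectral cover is cut into pieces by the preimage of the critical graph.  The claim is that
  the imaginary part of the integral of \<open>\<omega>\<close> vanishes along every piece.  Let \<open>D\<close> be a component of
  the complement of the graph and \<open>p\<close> its double pole.  Every trajectory through a point of \<open>D - {p}\<close>
  is closed and stays in \<open>D\<close>, and \<open>D\<close> contains no zero, as a trajectory that ends at the zero would be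
  critical.  Gluing flat annuli around closed trajectories gives a periodic map \<open>\<Phi>\<close> from
  a strip \<open>Im \<zeta> \<in> J\<close> onto \<open>D - {p}\<close> that pulls \<open>q\<close> back to \<open>d\<zeta>\<^sup>2\<close>.  The height \<open>Im \<zeta>\<close> is a
  function on \<open>D - {p}\<close>, since \<open>D - {p}\<close> is not a torus; one end of the strip is \<open>p\<close>, so
  the height tends to one and the same value, the other end of \<open>J\<close>, at the whole boundary of \<open>D\<close>.  On each sheet
  over \<open>D - {p}\<close> the integral of \<open>Im \<omega>\<close> is plus or minus the height, so it agrees at the two ends of a piece.

  To sum up infinitely many pieces without measure theory, let \<open>u\<close> be the integral of \<open>Im \<omega>\<close>
  along the loop minus the signed height above the boundary.  It is continuous, and locally constant away from the graph.
  On the graph it takes only countably many values: there are countably many critical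
  trajectories, as only countably many end at a given zero, and \<open>\<integral> Im \<omega>\<close> is locally constant along each.  A
  continuous function on an interval with countable range is constant.
\<close>

subsection \<open>Charts\<close>

text \<open>The obstacle is that \<open>q\<close> has no global square root, so flat coordinates are
  fixed only up to translations and half-turns. Flat maps therefore run from the plane to the
  surface, where one rigidity principle governs continuation: two of them that agree at accumulating
  points agree throughout. Gluing, periods and deck transformations become statements about affine
  maps of slope 1 or -1. A sign is fixed only on the cover, by comparison with
  \<open>\<omega>\<close>. It may change from piece to piece, because heights are measured from the
  boundary end and either sign gives 0 there. The loop may meet the graph in a Cantor set or run
  along it, and it may pass through points over zeros of \<open>q\<close>, where there is no flat
  coordinate; hence local primitives of \<open>\<omega>\<close> on the cover are used along the
  loop. Over a double pole there is no such primitive, so the loop stays away from it. The boundary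
  end of a cylinder is not known in advance to have finite height; if it were infinitely far away,
  the loop could not reach it.\<close>

lemma riemann_surface_chart:
  assumes "riemann_surface A" "c \<in> A"
  shows "open (fst c)" "open (snd c ` fst c)" "homeomorphism (fst c) (snd c ` fst c) (snd c) (chart_inv c)"
  using assms unfolding riemann_surface_def by auto

lemma chart_inv_simps:
  assumes "riemann_surface A" "c \<in> A"
  shows "x \<in> fst c \<Longrightarrow> chart_inv c (snd c x) = x"
    and "z \<in> snd c ` fst c \<Longrightarrow> snd c (chart_inv c z) = z"
    and "z \<in> snd c ` fst c \<Longrightarrow> chart_inv c z \<in> fst c"
  using riemann_surface_chart(3)[OF assms] unfolding homeomorphism_def by auto

lemma chart_isCont:
  assumes "riemann_surface A" "c \<in> A" "x \<in> fst c"
  shows "isCont (snd c) x" "isCont (chart_inv c) (snd c x)"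
  using riemann_surface_chart[OF assms(1,2)] assms(3)
  by (auto simp: homeomorphism_def continuous_on_eq_continuous_at)

lemma chart_inj:
  assumes "riemann_surface A" "c \<in> A" "x \<in> fst c" "y \<in> fst c" "snd c x = snd c y"
  shows "x = y"
  using assms chart_inv_simps(1)[OF assms(1,2)] by metis

lemma chart_open_image:
  assumes "riemann_surface A" "c \<in> A" "open W" "W \<subseteq> fst c"
  shows "open (snd c ` W)"
proof -
  have "openin (top_of_set (snd c ` fst c)) (snd c ` W)"
    using assms(3,4) by (intro homeomorphism_imp_open_map[OF riemann_surface_chart(3)[OF assms(1,2)]])
      (auto simp: openin_open)
  then show ?thesis
    using openin_open_trans riemann_surface_chart(2)[OF assms(1,2)] by blast
qed

lemma chart_inv_open_image:
  assumes "riemann_surface A" "c \<in> A" "open W" "W \<subseteq> snd c ` fst c"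
  shows "open (chart_inv c ` W)"
proof -
  have "openin (top_of_set (fst c)) (chart_inv c ` W)"
    using assms(3,4) homeomorphism_symD[OF riemann_surface_chart(3)[OF assms(1,2)]]
    by (intro homeomorphism_imp_open_map) (auto simp: openin_open)
  then show ?thesis
    using openin_open_trans riemann_surface_chart(1)[OF assms(1,2)] by blast
qed

lemma chart_exists:
  assumes "riemann_surface A"
  obtains c where "c \<in> A" "x \<in> fst c"
  using assms unfolding riemann_surface_def by blast

lemma chart_at_in:
  assumes "riemann_surface A"
  shows "chart_at A x \<in> A" "x \<in> fst (chart_at A x)"
proof -
  obtain c where "c \<in> A \<and> x \<in> fst c"
    using chart_exists[OF assms] by metis
  then have "chart_at A x \<in> A \<and> x \<in> fst (chart_at A x)"
    unfolding chart_at_def by (rule someI)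
  then show "chart_at A x \<in> A" "x \<in> fst (chart_at A x)" by auto
qed

lemma isCont_eventually:
  assumes "isCont f x" "\<forall>\<^sub>F y in nhds (f x). P y"
  shows "\<forall>\<^sub>F y in nhds x. P (f y)"
  using assms unfolding continuous_at by (metis eventually_compose_filterlim continuous_at assms(1) isCont_def tendsto_at_iff_tendsto_nhds)

lemma isCont_eventually_in:
  assumes "isCont f x" "open S" "f x \<in> S"
  shows "\<forall>\<^sub>F y in nhds x. f y \<in> S"
  using isCont_eventually[OF assms(1)] assms(2,3) eventually_nhds_in_open by blast

text \<open>Continuity of the two maps gives one inclusion each; as they are mutually inverse near
  the point, the inclusions are equalities. Facts about germs can thus be moved in both directions
  between the surface and the coordinate plane.\<close>

lemma chart_filtermap:
  assumes "riemann_surface A" "c \<in> A" "x \<in> fst c"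
  shows "filtermap (snd c) (nhds x) = nhds (snd c x)"
  and "filtermap (chart_inv c) (nhds (snd c x)) = nhds x"
proof -
  note S = chart_inv_simps[OF assms(1,2)] and C = chart_isCont[OF assms]
    and O = riemann_surface_chart(1,2)[OF assms(1,2)]
  have 1: "filtermap (snd c) (nhds x) \<le> nhds (snd c x)"
    using isCont_eventually[OF C(1)] by (auto simp: le_filter_def eventually_filtermap)
  have 2: "filtermap (chart_inv c) (nhds (snd c x)) \<le> nhds x"
    using isCont_eventually[OF C(2)] S(1)[OF assms(3)] by (auto simp: le_filter_def eventually_filtermap)
  have ev1: "\<forall>\<^sub>F y in nhds x. y \<in> fst c"
    using O(1) assms(3) eventually_nhds_in_open by blast
  have ev2: "\<forall>\<^sub>F z in nhds (snd c x). z \<in> snd c ` fst c"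
    using O(2) assms(3) by (intro eventually_nhds_in_open) auto
  have 3: "filtermap (chart_inv c) (filtermap (snd c) (nhds x)) = nhds x"
    unfolding filtermap_filtermap filter_eq_iff eventually_filtermap
    by (intro allI eventually_cong[OF ev1]) (simp add: S(1))
  have 4: "filtermap (snd c) (filtermap (chart_inv c) (nhds (snd c x))) = nhds (snd c x)"
    unfolding filtermap_filtermap filter_eq_iff eventually_filtermap
    by (intro allI eventually_cong[OF ev2]) (simp add: S(2))
  show "filtermap (snd c) (nhds x) = nhds (snd c x)"
    using 1 filtermap_mono[OF 2, of "snd c"] 4 by (metis antisym)
  show "filtermap (chart_inv c) (nhds (snd c x)) = nhds x"
    using 2 filtermap_mono[OF 1, of "chart_inv c"] 3 by (metis antisym)
qed

lemma eventually_chart_inv: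
  assumes "riemann_surface A" "c \<in> A" "x \<in> fst c"
  shows "(\<forall>\<^sub>F z in nhds (snd c x). P (chart_inv c z)) \<longleftrightarrow> (\<forall>\<^sub>F y in nhds x. P y)"
  using chart_filtermap(2)[OF assms] by (metis eventually_filtermap)

lemmas chart_inv_eventually = eventually_chart_inv[THEN iffD2]

lemma eventually_chart:
  assumes "riemann_surface A" "c \<in> A" "x \<in> fst c"
  shows "(\<forall>\<^sub>F y in nhds x. P (snd c y)) \<longleftrightarrow> (\<forall>\<^sub>F z in nhds (snd c x). P z)"
  using chart_filtermap(1)[OF assms] by (metis eventually_filtermap)

lemma eventually_chart_at:
  assumes "riemann_surface A" "c \<in> A" "x \<in> fst c"
  shows "(\<forall>\<^sub>F y in at x. P (snd c y)) \<longleftrightarrow> (\<forall>\<^sub>F z in at (snd c x). P z)"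
proof -
  have "(\<forall>\<^sub>F y in nhds x. y \<noteq> x \<longrightarrow> P (snd c y)) \<longleftrightarrow> (\<forall>\<^sub>F y in nhds x. snd c y \<noteq> snd c x \<longrightarrow> P (snd c y))"
    by (rule eventually_cong[OF eventually_nhds_in_open[OF riemann_surface_chart(1)[OF assms(1,2)] assms(3)]])
       (use chart_inj[OF assms(1,2)] assms(3) in blast)
  then show ?thesis
    unfolding eventually_at_filter
    using eventually_chart[OF assms, of "\<lambda>z. z \<noteq> snd c x \<longrightarrow> P z"] by simp
qed

lemma chart_transition:
  assumes "riemann_surface A" "c \<in> A" "d \<in> A" "x \<in> fst c" "x \<in> fst d"
  shows "((snd d \<circ> chart_inv c) has_field_derivative deriv (snd d \<circ> chart_inv c) (snd c x)) (at (snd c x))"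
    and "deriv (snd d \<circ> chart_inv c) (snd c x) * deriv (snd c \<circ> chart_inv d) (snd d x) = 1"
proof -
  have der: "((snd d \<circ> chart_inv c) has_field_derivative deriv (snd d \<circ> chart_inv c) (snd c x)) (at (snd c x))"
    if "c \<in> A" "d \<in> A" "x \<in> fst c" "x \<in> fst d" for c d
  proof -
    have "open (snd c ` (fst c \<inter> fst d))"
      using riemann_surface_chart(1)[OF assms(1)] that
      by (intro chart_open_image[OF assms(1)] open_Int) auto
    then show ?thesis
      using assms(1) that unfolding riemann_surface_def
      by (metis (no_types, lifting) IntI holomorphic_derivI imageI)
  qed
  show "((snd d \<circ> chart_inv c) has_field_derivative deriv (snd d \<circ> chart_inv c) (snd c x)) (at (snd c x))"
    using der assms by blast
  have d1: "((snd d \<circ> chart_inv c) has_field_derivative deriv (snd d \<circ> chart_inv c) (snd c x)) (at ((snd c \<circ> chart_inv d) (snd d x)))"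
    using der[OF assms(2,3,4,5)] chart_inv_simps(1)[OF assms(1,3,5)] by simp
  have "((snd d \<circ> chart_inv c) \<circ> (snd c \<circ> chart_inv d) has_field_derivative
      deriv (snd d \<circ> chart_inv c) (snd c x) * deriv (snd c \<circ> chart_inv d) (snd d x)) (at (snd d x))"
    by (rule DERIV_chain[OF d1 der[OF assms(3,2,5,4)]])
  moreover have "\<forall>\<^sub>F z in nhds (snd d x). ((snd d \<circ> chart_inv c) \<circ> (snd c \<circ> chart_inv d)) z = z"
  proof -
    have "\<forall>\<^sub>F y in nhds x. y \<in> fst d \<and> y \<in> fst c"
      using riemann_surface_chart(1)[OF assms(1)] assms
      by (intro eventually_conj eventually_nhds_in_open) auto
    then have "\<forall>\<^sub>F z in nhds (snd d x). chart_inv d z \<in> fst d \<and> chart_inv d z \<in> fst c"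
      by (rule chart_inv_eventually[OF assms(1,3,5)])
    moreover have "\<forall>\<^sub>F z in nhds (snd d x). z \<in> snd d ` fst d"
      using riemann_surface_chart(2)[OF assms(1,3)] assms by (intro eventually_nhds_in_open) auto
    ultimately show ?thesis
      by eventually_elim (use chart_inv_simps[OF assms(1)] assms in auto)
  qed
  ultimately have "((\<lambda>z. z) has_field_derivative
      deriv (snd d \<circ> chart_inv c) (snd c x) * deriv (snd c \<circ> chart_inv d) (snd d x)) (at (snd d x))"
    by (subst (asm) DERIV_cong_ev[OF refl _ refl])
  then show "deriv (snd d \<circ> chart_inv c) (snd c x) * deriv (snd c \<circ> chart_inv d) (snd d x) = 1"
    using DERIV_unique DERIV_ident by blast
qed

text \<open>Chain rule for functions on the surface; the two companions below treat maps into the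
  surface, with a complex and with a real parameter.\<close>

lemma chart_change_from:
  assumes "riemann_surface A" "c \<in> A" "d \<in> A" "x \<in> fst c" "x \<in> fst d"
    and "((F \<circ> chart_inv c) has_field_derivative D) (at (snd c x))"
  shows "((F \<circ> chart_inv d) has_field_derivative D * deriv (snd c \<circ> chart_inv d) (snd d x)) (at (snd d x))"
proof -
  have 1: "((F \<circ> chart_inv c) \<circ> (snd c \<circ> chart_inv d) has_field_derivative
      D * deriv (snd c \<circ> chart_inv d) (snd d x)) (at (snd d x))"
    using assms(6) chart_inv_simps(1)[OF assms(1,3,5)]
    by (intro DERIV_chain[OF _ chart_transition(1)[OF assms(1,3,2,5,4)]]) auto
  have "\<forall>\<^sub>F y in nhds x. y \<in> fst c"
    using riemann_surface_chart(1)[OF assms(1)] assms by (intro eventually_nhds_in_open) auto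
  then have "\<forall>\<^sub>F z in nhds (snd d x). chart_inv d z \<in> fst c"
    by (rule chart_inv_eventually[OF assms(1,3,5)])
  then have "\<forall>\<^sub>F z in nhds (snd d x). ((F \<circ> chart_inv c) \<circ> (snd c \<circ> chart_inv d)) z = (F \<circ> chart_inv d) z"
    by eventually_elim (use chart_inv_simps[OF assms(1)] assms in auto)
  with 1 show ?thesis
    by (subst (asm) DERIV_cong_ev[OF refl _ refl])
qed

lemma chart_change_to:
  assumes "riemann_surface A" "c \<in> A" "d \<in> A" "f t \<in> fst c" "f t \<in> fst d" "isCont f t"
    and "((snd c \<circ> f) has_field_derivative D) (at t)"
  shows "((snd d \<circ> f) has_field_derivative deriv (snd d \<circ> chart_inv c) (snd c (f t)) * D) (at t)"
proof -
  have 1: "((snd d \<circ> chart_inv c) \<circ> (snd c \<circ> f) has_field_derivative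
      deriv (snd d \<circ> chart_inv c) (snd c (f t)) * D) (at t)"
    using chart_transition(1)[OF assms(1-5)] by (intro DERIV_chain[OF _ assms(7)]) auto
  have "\<forall>\<^sub>F s in nhds t. f s \<in> fst c"
    using isCont_eventually_in[OF assms(6)] riemann_surface_chart(1)[OF assms(1,2)] assms(4) by blast
  then have "\<forall>\<^sub>F z in nhds t. ((snd d \<circ> chart_inv c) \<circ> (snd c \<circ> f)) z = (snd d \<circ> f) z"
    by eventually_elim (use chart_inv_simps[OF assms(1)] assms in auto)
  with 1 show ?thesis
    by (subst (asm) DERIV_cong_ev[OF refl _ refl])
qed

lemma chart_change_to_vector:
  assumes "riemann_surface A" "c \<in> A" "d \<in> A" "f t \<in> fst c" "f t \<in> fst d" "isCont f t"
    and "((snd c \<circ> f) has_vector_derivative D) (at t)"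
  shows "((snd d \<circ> f) has_vector_derivative deriv (snd d \<circ> chart_inv c) (snd c (f t)) * D) (at t)"
proof -
  have 1: "((snd d \<circ> chart_inv c) \<circ> (snd c \<circ> f) has_vector_derivative
      D * deriv (snd d \<circ> chart_inv c) (snd c (f t))) (at t)"
    using chart_transition(1)[OF assms(1-5)] by (intro field_vector_diff_chain_at assms(7)) auto
  have "\<forall>\<^sub>F s in nhds t. f s \<in> fst c"
    using isCont_eventually_in[OF assms(6)] riemann_surface_chart(1)[OF assms(1,2)] assms(4) by blast
  then have "\<forall>\<^sub>F z in nhds t. ((snd d \<circ> chart_inv c) \<circ> (snd c \<circ> f)) z = (snd d \<circ> f) z"
    by eventually_elim (use chart_inv_simps[OF assms(1)] assms in auto)
  moreover from this have "((snd d \<circ> chart_inv c) \<circ> (snd c \<circ> f)) t = (snd d \<circ> f) t"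
    by (rule eventually_nhds_x_imp_x)
  ultimately have "((snd d \<circ> chart_inv c) \<circ> (snd c \<circ> f) has_vector_derivative
      D * deriv (snd d \<circ> chart_inv c) (snd c (f t))) (at t) =
      ((snd d \<circ> f) has_vector_derivative D * deriv (snd d \<circ> chart_inv c) (snd c (f t))) (at t)"
    by (intro has_vector_derivative_cong_ev) (auto elim!: eventually_mono)
  with 1 show ?thesis
    by (simp add: mult.commute)
qed

lemma differential_change:
  assumes "riemann_surface A" "meromorphic_differential k A q" "c \<in> A" "d \<in> A" "x \<in> fst c" "x \<in> fst d"
  shows "q c (snd c x) = q d (snd d x) * deriv (snd d \<circ> chart_inv c) (snd c x) ^ k"
proof -
  have "q c (snd c x) = q d ((snd d \<circ> chart_inv c) (snd c x)) * deriv (snd d \<circ> chart_inv c) (snd c x) ^ k"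
    using assms unfolding meromorphic_differential_def by blast
  then show ?thesis
    using chart_inv_simps(1)[OF assms(1,3,5)] by simp
qed

subsection \<open>Flat coordinates\<close>

locale quadratic_differential =
  fixes A :: "'a::t2_space chart set" and q :: "'a differential"
  assumes surface: "riemann_surface A"
    and quadratic: "meromorphic_differential 2 A q"
begin

text \<open>Local functions have the value 0 at poles by normalisation, so a non-zero value excludes
  zeros and poles alike; \<open>critical_point_iff\<close> relates this to the order.\<close>

definition regular :: "'a \<Rightarrow> bool" where
  "regular x \<longleftrightarrow> (\<exists>c\<in>A. x \<in> fst c \<and> q c (snd c x) \<noteq> 0)"

text \<open>The map pulls \<open>q\<close> back to \<open>dz\<^sup>2\<close>, so that it is locally the inverse of a branch of \<open>\<integral> sqrt q\<close>.\<close>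

definition flat_at :: "(complex \<Rightarrow> 'a) \<Rightarrow> complex \<Rightarrow> bool" where
  "flat_at \<Psi> \<zeta> \<longleftrightarrow> isCont \<Psi> \<zeta> \<and> (\<forall>c\<in>A. \<Psi> \<zeta> \<in> fst c \<longrightarrow>
     (\<exists>D. ((snd c \<circ> \<Psi>) has_field_derivative D) (at \<zeta>) \<and> q c (snd c (\<Psi> \<zeta>)) * D\<^sup>2 = 1))"

text \<open>One chart suffices: a change of charts multiplies \<open>D\<close> by the derivative of
  the transition map, and the local function of \<open>q\<close> by the inverse square of this
  factor.\<close>

lemma flat_atI:
  assumes "isCont \<Psi> \<zeta>" "c \<in> A" "\<Psi> \<zeta> \<in> fst c"
    and "((snd c \<circ> \<Psi>) has_field_derivative D) (at \<zeta>)" "q c (snd c (\<Psi> \<zeta>)) * D\<^sup>2 = 1"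
  shows "flat_at \<Psi> \<zeta>"
  unfolding flat_at_def
proof (intro conjI ballI impI)
  fix d assume d: "d \<in> A" "\<Psi> \<zeta> \<in> fst d"
  let ?\<tau> = "deriv (snd d \<circ> chart_inv c) (snd c (\<Psi> \<zeta>))"
  have "((snd d \<circ> \<Psi>) has_field_derivative ?\<tau> * D) (at \<zeta>)"
    by (rule chart_change_to[OF surface assms(2) d(1) assms(3) d(2) assms(1,4)])
  moreover have "q d (snd d (\<Psi> \<zeta>)) * (?\<tau> * D)\<^sup>2 = 1"
    using differential_change[OF surface quadratic assms(2) d(1) assms(3) d(2)] assms(5)
    by (simp add: power_mult_distrib mult.assoc)
  ultimately show "\<exists>D. ((snd d \<circ> \<Psi>) has_field_derivative D) (at \<zeta>) \<and> q d (snd d (\<Psi> \<zeta>)) * D\<^sup>2 = 1"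
    by blast
qed (use assms in auto)

lemma flat_at_regular:
  assumes "flat_at \<Psi> \<zeta>"
  shows "regular (\<Psi> \<zeta>)"
proof -
  obtain c where "c \<in> A" "\<Psi> \<zeta> \<in> fst c" using chart_exists[OF surface] .
  then show ?thesis using assms unfolding flat_at_def regular_def by fastforce
qed

lemma regular_iff:
  assumes "c \<in> A" "x \<in> fst c"
  shows "regular x \<longleftrightarrow> q c (snd c x) \<noteq> 0"
  using differential_change[OF surface quadratic _ assms(1) _ assms(2)] assms unfolding regular_def
  by (metis mult_zero_left)

lemma flat_at_cong:
  assumes "\<forall>\<^sub>F z in nhds \<zeta>. \<Psi> z = \<Psi>' z"
  shows "flat_at \<Psi> \<zeta> \<longleftrightarrow> flat_at \<Psi>' \<zeta>"
proof -
  have eq: "\<Psi> \<zeta> = \<Psi>' \<zeta>" using assms by (rule eventually_nhds_x_imp_x)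
  have "(snd c \<circ> \<Psi> has_field_derivative D) (at \<zeta>) \<longleftrightarrow> (snd c \<circ> \<Psi>' has_field_derivative D) (at \<zeta>)" for c :: "'a chart" and D
    using assms by (intro DERIV_cong_ev) (auto elim!: eventually_mono)
  moreover have "isCont \<Psi> \<zeta> \<longleftrightarrow> isCont \<Psi>' \<zeta>"
    using assms by (rule isCont_cong)
  ultimately show ?thesis
    unfolding flat_at_def using eq by simp
qed

text \<open>The normalisation of \<open>D\<close> keeps the derivative from vanishing, so the
  inverse function theorem applies in one chart. The last clause says that the local inverse
  \<open>g\<close> is a primitive of a branch of the square root of \<open>q\<close>.\<close>

lemma flat_inverse:
  assumes "open U" "\<And>\<zeta>. \<zeta> \<in> U \<Longrightarrow> flat_at \<Psi> \<zeta>" "\<zeta>0 \<in> U"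
  obtains r g where "0 < r" "ball \<zeta>0 r \<subseteq> U" "open (\<Psi> ` ball \<zeta>0 r)"
    "\<And>\<zeta>. \<zeta> \<in> ball \<zeta>0 r \<Longrightarrow> g (\<Psi> \<zeta>) = \<zeta>" "continuous_on (\<Psi> ` ball \<zeta>0 r) g"
    "\<And>c x. c \<in> A \<Longrightarrow> x \<in> fst c \<Longrightarrow> x \<in> \<Psi> ` ball \<zeta>0 r \<Longrightarrow>
       \<exists>D. ((g \<circ> chart_inv c) has_field_derivative D) (at (snd c x)) \<and> D\<^sup>2 = q c (snd c x)"
proof -
  obtain c where c: "c \<in> A" "\<Psi> \<zeta>0 \<in> fst c" using chart_exists[OF surface] .
  define U' where "U' = U \<inter> \<Psi> -` fst c"
  define a where "a = snd c \<circ> \<Psi>"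
  have "continuous_on U \<Psi>"
    using assms(2) unfolding flat_at_def by (auto intro: continuous_at_imp_continuous_on)
  then have U': "open U'" "\<zeta>0 \<in> U'"
    unfolding U'_def using assms(1,3) c riemann_surface_chart(1)[OF surface c(1)]
    by (auto intro: continuous_open_preimage)
  have der: "(a has_field_derivative deriv a \<zeta>) (at \<zeta>)" "q c (a \<zeta>) * (deriv a \<zeta>)\<^sup>2 = 1" if "\<zeta> \<in> U'" for \<zeta>
  proof -
    have "flat_at \<Psi> \<zeta>" "\<Psi> \<zeta> \<in> fst c" using assms(2) that unfolding U'_def by auto
    then obtain D where "(a has_field_derivative D) (at \<zeta>)" "q c (a \<zeta>) * D\<^sup>2 = 1"
      using c(1) unfolding flat_at_def a_def by auto
    then show "(a has_field_derivative deriv a \<zeta>) (at \<zeta>)" "q c (a \<zeta>) * (deriv a \<zeta>)\<^sup>2 = 1"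
      using DERIV_imp_deriv by auto
  qed
  have hol: "a holomorphic_on U'"
    using der(1) U'(1) by (auto simp: holomorphic_on_open)
  have nz: "deriv a \<zeta>0 \<noteq> 0" using der(2)[OF U'(2)] by auto
  obtain r where r: "0 < r" "ball \<zeta>0 r \<subseteq> U'" "open (a ` ball \<zeta>0 r)" "inj_on a (ball \<zeta>0 r)"
    using has_complex_derivative_locally_invertible[OF hol U'(2,1) nz] by metis
  obtain h where h: "h holomorphic_on (a ` ball \<zeta>0 r)"
      "\<And>z. z \<in> ball \<zeta>0 r \<Longrightarrow> deriv a z * deriv h (a z) = 1"
      "\<And>z. z \<in> ball \<zeta>0 r \<Longrightarrow> h (a z) = z"
    using holomorphic_has_inverse[OF holomorphic_on_subset[OF hol r(2)] open_ball r(4)] by metis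
  define g where "g = h \<circ> snd c"
  have sub: "a ` ball \<zeta>0 r \<subseteq> snd c ` fst c"
    using r(2) unfolding a_def U'_def by auto
  have im: "\<Psi> ` ball \<zeta>0 r = chart_inv c ` a ` ball \<zeta>0 r"
  proof -
    have "chart_inv c (a \<zeta>) = \<Psi> \<zeta>" if "\<zeta> \<in> ball \<zeta>0 r" for \<zeta>
      using that r(2) chart_inv_simps(1)[OF surface c(1)] unfolding a_def U'_def by auto
    then show ?thesis by (force simp: image_iff)
  qed
  show ?thesis
  proof
    show "0 < r" "ball \<zeta>0 r \<subseteq> U" using r unfolding U'_def by auto
    show "open (\<Psi> ` ball \<zeta>0 r)"
      unfolding im by (rule chart_inv_open_image[OF surface c(1) r(3) sub])
    show "g (\<Psi> \<zeta>) = \<zeta>" if "\<zeta> \<in> ball \<zeta>0 r" for \<zeta>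
      using h(3)[OF that] unfolding g_def a_def by simp
    show "continuous_on (\<Psi> ` ball \<zeta>0 r) g"
      unfolding g_def
    proof (rule continuous_on_compose)
      show "continuous_on (\<Psi> ` ball \<zeta>0 r) (snd c)"
        using riemann_surface_chart(3)[OF surface c(1)] r(2) unfolding homeomorphism_def U'_def
        by (auto intro: continuous_on_subset)
      show "continuous_on (snd c ` \<Psi> ` ball \<zeta>0 r) h"
        using holomorphic_on_imp_continuous_on[OF h(1)] unfolding a_def by (simp add: image_comp)
    qed
    fix d x assume d: "d \<in> A" "x \<in> fst d" "x \<in> \<Psi> ` ball \<zeta>0 r"
    then obtain \<zeta> where \<zeta>: "\<zeta> \<in> ball \<zeta>0 r" "x = \<Psi> \<zeta>" by auto
    then have xc: "x \<in> fst c" "snd c x = a \<zeta>" using r(2) unfolding U'_def a_def by auto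
    let ?\<tau> = "deriv (snd c \<circ> chart_inv d) (snd d x)"
    have "(h has_field_derivative deriv h (a \<zeta>)) (at (a \<zeta>))"
      using h(1) r(3) \<zeta>(1) by (intro holomorphic_derivI) auto
    moreover have "\<forall>\<^sub>F z in nhds (a \<zeta>). z \<in> a ` ball \<zeta>0 r"
      using r(3) \<zeta>(1) by (intro eventually_nhds_in_open) auto
    then have "\<forall>\<^sub>F z in nhds (a \<zeta>). h z = (g \<circ> chart_inv c) z"
    proof eventually_elim
      case (elim z)
      then show ?case
        using sub chart_inv_simps(2)[OF surface c(1)] unfolding g_def by auto
    qed
    ultimately have "(g \<circ> chart_inv c has_field_derivative deriv h (a \<zeta>)) (at (snd c x))"
      unfolding xc(2) by (subst (asm) DERIV_cong_ev[OF refl _ refl])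
    then have "(g \<circ> chart_inv d has_field_derivative deriv h (a \<zeta>) * ?\<tau>) (at (snd d x))"
      by (rule chart_change_from[OF surface c(1) d(1) xc(1) d(2)])
    moreover have "(deriv h (a \<zeta>) * ?\<tau>)\<^sup>2 = q d (snd d x)"
    proof -
      have "(deriv h (a \<zeta>))\<^sup>2 = q c (a \<zeta>) * (deriv a \<zeta> * deriv h (a \<zeta>))\<^sup>2"
        using der(2)[of \<zeta>] \<zeta>(1) r(2) by (auto simp: power_mult_distrib)
      also have "\<dots> = q c (a \<zeta>)" using h(2)[OF \<zeta>(1)] by simp
      finally show ?thesis
        using differential_change[OF surface quadratic d(1) c(1) d(2) xc(1)] xc(2)
        by (simp add: power_mult_distrib)
    qed
    ultimately show "\<exists>D. (g \<circ> chart_inv d has_field_derivative D) (at (snd d x)) \<and> D\<^sup>2 = q d (snd d x)"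
      by blast
  qed
qed

text \<open>\<open>\<Psi>\<close> is \<open>P\<close> composed with the local inverse of
  \<open>H\<close>, recentred at 0. The parameter \<open>w\<close> need not be a chart coordinate:
  at regular points \<open>P\<close> is the inverse of a chart, near a zero it is the branched map
  \<open>z0 + w\<^sup>2\<close> followed by such an inverse.\<close>

lemma flat_of_primitive:
  assumes "open S" "w0 \<in> S" "H holomorphic_on S" "c \<in> A" "deriv H w0 \<noteq> 0"
    and P: "\<And>w. w \<in> S \<Longrightarrow> isCont P w" "\<And>w. w \<in> S \<Longrightarrow> P w \<in> fst c"
      "\<And>w. w \<in> S \<Longrightarrow> ((snd c \<circ> P) has_field_derivative D w) (at w)"
      "\<And>w. w \<in> S \<Longrightarrow> (deriv H w)\<^sup>2 = q c (snd c (P w)) * (D w)\<^sup>2"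
  obtains r \<Psi> where "0 < r" "\<And>\<zeta>. \<zeta> \<in> ball 0 r \<Longrightarrow> flat_at \<Psi> \<zeta>"
    "\<forall>\<^sub>F w in nhds w0. H w - H w0 \<in> ball 0 r \<and> \<Psi> (H w - H w0) = P w"
proof -
  obtain e where e: "0 < e" "ball w0 e \<subseteq> S" "open (H ` ball w0 e)" "inj_on H (ball w0 e)"
    using has_complex_derivative_locally_invertible[OF assms(3,2,1,5)] by metis
  obtain k where k: "k holomorphic_on (H ` ball w0 e)"
      "\<And>z. z \<in> ball w0 e \<Longrightarrow> deriv H z * deriv k (H z) = 1"
      "\<And>z. z \<in> ball w0 e \<Longrightarrow> k (H z) = z"
    using holomorphic_has_inverse[OF holomorphic_on_subset[OF assms(3) e(2)] open_ball e(4)] by metis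
  obtain r where r: "0 < r" "ball (H w0) r \<subseteq> H ` ball w0 e"
    using e(1,3) by (metis centre_in_ball imageI open_contains_ball)
  define \<Psi> where "\<Psi> \<zeta> = P (k (\<zeta> + H w0))" for \<zeta>
  show ?thesis
  proof
    show "0 < r" by fact
    show "flat_at \<Psi> \<zeta>" if "\<zeta> \<in> ball 0 r" for \<zeta>
    proof -
      have "\<zeta> + H w0 \<in> H ` ball w0 e" using that r(2) by (auto simp: dist_norm subset_iff)
      then obtain w where w: "w \<in> ball w0 e" "\<zeta> + H w0 = H w" by auto
      have "(k has_field_derivative deriv k (H w)) (at (H w))"
        using k(1) e(3) w by (intro holomorphic_derivI) auto
      then have dk: "((\<lambda>\<zeta>. k (\<zeta> + H w0)) has_field_derivative deriv k (H w)) (at \<zeta>)"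
        unfolding w(2)[symmetric] by (simp add: DERIV_shift)
      have kw: "k (\<zeta> + H w0) = w" using k(3) w by simp
      have wS: "w \<in> S" using w(1) e(2) by auto
      show ?thesis
      proof (rule flat_atI)
        show "c \<in> A" "\<Psi> \<zeta> \<in> fst c" using assms(4) P(2)[OF wS] kw by (auto simp: \<Psi>_def)
        show "isCont \<Psi> \<zeta>"
          using isCont_o2[OF DERIV_isCont[OF dk], of P] P(1)[OF wS] kw unfolding \<Psi>_def by simp
        show "(snd c \<circ> \<Psi> has_field_derivative D w * deriv k (H w)) (at \<zeta>)"
          using DERIV_chain2[OF _ dk, of "snd c \<circ> P"] P(3)[OF wS] kw by (simp add: \<Psi>_def o_def)
        have "(deriv H w * deriv k (H w))\<^sup>2 = q c (snd c (P w)) * (D w)\<^sup>2 * (deriv k (H w))\<^sup>2"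
          using P(4)[OF wS] by (simp add: power_mult_distrib)
        then show "q c (snd c (\<Psi> \<zeta>)) * (D w * deriv k (H w))\<^sup>2 = 1"
          using k(2)[OF w(1)] kw by (simp add: \<Psi>_def power_mult_distrib mult.assoc)
      qed
    qed
    have "isCont H w0"
      using assms(1-3) by (meson DERIV_isCont holomorphic_derivI)
    then have "\<forall>\<^sub>F w in nhds w0. H w \<in> ball (H w0) r"
      using r(1) by (intro isCont_eventually_in) auto
    moreover have "\<forall>\<^sub>F w in nhds w0. w \<in> ball w0 e"
      using e(1) by (intro eventually_nhds_in_open) auto
    ultimately show "\<forall>\<^sub>F w in nhds w0. H w - H w0 \<in> ball 0 r \<and> \<Psi> (H w - H w0) = P w"
      by eventually_elim (use k(3) in \<open>auto simp: \<Psi>_def dist_norm norm_minus_commute\<close>)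
  qed
qed

lemma quadratic_analytic:
  assumes "c \<in> A" "x \<in> fst c" "\<not> is_pole (q c) (snd c x)"
  shows "q c analytic_on {snd c x}"
  using assms quadratic nicely_meromorphic_on_imp_analytic_at unfolding meromorphic_differential_def by blast

text \<open>A nicely meromorphic function takes the value 0 at its poles, so a non-zero value
  excludes a pole.\<close>

lemma regular_analytic:
  assumes "c \<in> A" "x \<in> fst c" "regular x"
  shows "q c analytic_on {snd c x}"
proof (rule quadratic_analytic[OF assms(1,2)])
  have nz: "q c (snd c x) \<noteq> 0" using regular_iff assms by blast
  have "q c nicely_meromorphic_on (snd c ` fst c)"
    using quadratic assms(1) unfolding meromorphic_differential_def by blast
  then have "(is_pole (q c) (snd c x) \<and> q c (snd c x) = 0) \<or> q c \<midarrow>snd c x\<rightarrow> q c (snd c x)"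
    using assms(2) unfolding nicely_meromorphic_on_def by blast
  then show "\<not> is_pole (q c) (snd c x)"
    using nz unfolding is_pole_def
    by (metis at_neq_bot not_tendsto_and_filterlim_at_infinity)
qed

lemma open_regular: "open {x. regular x}"
proof (subst open_subopen, intro ballI)
  fix x assume "x \<in> {x. regular x}"
  then have x: "regular x" by simp
  obtain c where c: "c \<in> A" "x \<in> fst c" using chart_exists[OF surface] .
  have "isCont (q c) (snd c x)"
    using regular_analytic[OF c x] analytic_at_imp_isCont by blast
  then have "\<forall>\<^sub>F z in nhds (snd c x). q c z \<in> - {0}"
    using regular_iff[OF c] x by (intro isCont_eventually_in) auto
  then have "\<forall>\<^sub>F y in nhds x. q c (snd c y) \<in> - {0}"
    using eventually_chart[OF surface c, of "\<lambda>z. q c z \<in> - {0}"] by simp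
  moreover have "\<forall>\<^sub>F y in nhds x. y \<in> fst c"
    using c riemann_surface_chart(1)[OF surface c(1)] by (intro eventually_nhds_in_open) auto
  ultimately have "\<forall>\<^sub>F y in nhds x. regular y"
    by eventually_elim (use regular_iff c in auto)
  then show "\<exists>T. open T \<and> x \<in> T \<and> T \<subseteq> {x. regular x}"
    unfolding eventually_nhds by auto
qed

text \<open>The classical natural parameter: on a small disc without zeros \<open>q\<close> has a
  holomorphic square root \<open>s\<close>, and the local inverse of a primitive \<open>H\<close> of
  \<open>s\<close> is flat.\<close>

lemma flat_exists:
  assumes "regular x"
  obtains r \<Psi> where "0 < r" "\<And>\<zeta>. \<zeta> \<in> ball 0 r \<Longrightarrow> flat_at \<Psi> \<zeta>" "\<Psi> 0 = x"
proof -
  obtain c where c: "c \<in> A" "x \<in> fst c" using chart_exists[OF surface] .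
  have nz: "q c (snd c x) \<noteq> 0" using regular_iff assms c by blast
  have cont: "isCont (q c) (snd c x)"
    using regular_analytic[OF c assms] analytic_at_imp_isCont by blast
  obtain e1 where e1: "0 < e1" "q c holomorphic_on ball (snd c x) e1"
    using regular_analytic[OF c assms] by (metis analytic_at_ball)
  have "\<forall>\<^sub>F z in nhds (snd c x). q c z \<in> - {0}"
    using nz cont by (intro isCont_eventually_in) auto
  moreover have "\<forall>\<^sub>F z in nhds (snd c x). z \<in> snd c ` fst c"
    using c riemann_surface_chart(2)[OF surface c(1)] by (intro eventually_nhds_in_open) auto
  ultimately have "\<forall>\<^sub>F z in nhds (snd c x). q c z \<noteq> 0 \<and> z \<in> snd c ` fst c"
    by eventually_elim auto
  then obtain e2 where e2: "0 < e2" "\<And>z. z \<in> ball (snd c x) e2 \<Longrightarrow> q c z \<noteq> 0 \<and> z \<in> snd c ` fst c"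
    unfolding eventually_nhds_metric by (auto simp: dist_commute)
  define S where "S = ball (snd c x) (min e1 e2)"
  have S: "open S" "snd c x \<in> S" "convex S" "contractible S" "q c holomorphic_on S"
    "\<And>z. z \<in> S \<Longrightarrow> q c z \<noteq> 0" "\<And>z. z \<in> S \<Longrightarrow> z \<in> snd c ` fst c"
    using e1 e2 unfolding S_def by (auto intro: convex_imp_contractible holomorphic_on_subset)
  obtain s where s: "s holomorphic_on S" "\<And>z. z \<in> S \<Longrightarrow> q c z = (s z)\<^sup>2"
    using contractible_imp_holomorphic_sqrt[OF S(5,4,6)] by metis
  obtain H where H: "\<And>z. z \<in> S \<Longrightarrow> (H has_field_derivative s z) (at z)"
    using holomorphic_convex_primitive'[OF S(3,1) s(1)] S(1) at_within_open by metis
  have inv: "snd c (chart_inv c z) = z" "chart_inv c z \<in> fst c" if "z \<in> S" for z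
    using S(7)[OF that] chart_inv_simps[OF surface c(1)] by auto
  have "\<exists>r \<Psi>. 0 < r \<and> (\<forall>\<zeta>\<in>ball 0 r. flat_at \<Psi> \<zeta>) \<and>
      (\<forall>\<^sub>F w in nhds (snd c x). H w - H (snd c x) \<in> ball 0 r \<and> \<Psi> (H w - H (snd c x)) = chart_inv c w)"
  proof (rule flat_of_primitive[OF S(1,2) _ c(1), of H "chart_inv c" "\<lambda>_. 1"])
    show "H holomorphic_on S" using H S(1) by (auto simp: holomorphic_on_open)
    show "deriv H (snd c x) \<noteq> 0" using DERIV_imp_deriv[OF H[OF S(2)]] nz s(2)[OF S(2)] by auto
    show "isCont (chart_inv c) w" if "w \<in> S" for w
      using chart_isCont(2)[OF surface c(1) inv(2)[OF that]] inv(1)[OF that] by simp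
    show "chart_inv c w \<in> fst c" if "w \<in> S" for w using inv that by auto
    show "(snd c \<circ> chart_inv c has_field_derivative 1) (at w)" if "w \<in> S" for w
    proof -
      have "\<forall>\<^sub>F z in nhds w. (snd c \<circ> chart_inv c) z = z"
        using eventually_nhds_in_open[OF S(1) that] by eventually_elim (use inv in auto)
      then show ?thesis
        by (subst DERIV_cong_ev[OF refl _ refl]) (auto)
    qed
    show "(deriv H w)\<^sup>2 = q c (snd c (chart_inv c w)) * 1\<^sup>2" if "w \<in> S" for w
      using DERIV_imp_deriv[OF H[OF that]] inv[OF that] s(2)[OF that] by simp
  qed blast
  then obtain r \<Psi> where r: "0 < r" "\<And>\<zeta>. \<zeta> \<in> ball 0 r \<Longrightarrow> flat_at \<Psi> \<zeta>"
    "\<forall>\<^sub>F w in nhds (snd c x). H w - H (snd c x) \<in> ball 0 r \<and> \<Psi> (H w - H (snd c x)) = chart_inv c w"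
    by blast
  then show ?thesis
    using that[OF r(1,2)] eventually_nhds_x_imp_x[OF r(3)] chart_inv_simps(1)[OF surface c] by auto
qed

end

text \<open>Zorn's lemma for partial maps. As \<open>P\<close> is a local property it passes to the
  union of a chain, and closure of \<open>\<U>\<close> under unions supplies the domain. It is
  applied to curves, with intervals as domains, and to flat maps, with full horizontal strips as
  domains.\<close>

lemma maximal_extension:
  fixes P :: "('c::topological_space \<Rightarrow> 'd) \<Rightarrow> 'c \<Rightarrow> bool"
  assumes loc: "\<And>f g t. \<lbrakk>\<forall>\<^sub>F s in nhds t. f s = g s; P f t\<rbrakk> \<Longrightarrow> P g t"
    and op: "\<And>U. U \<in> \<U> \<Longrightarrow> open U"
    and un: "\<And>\<C>. \<lbrakk>\<C> \<noteq> {}; \<C> \<subseteq> \<U>\<rbrakk> \<Longrightarrow> \<Union>\<C> \<in> \<U>"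
    and U0: "U0 \<in> \<U>" and f0: "\<And>t. t \<in> U0 \<Longrightarrow> P f0 t"
  obtains U f where "U \<in> \<U>" "U0 \<subseteq> U" "\<And>t. t \<in> U \<Longrightarrow> P f t" "\<And>t. t \<in> U0 \<Longrightarrow> f t = f0 t"
    "\<And>V g. \<lbrakk>V \<in> \<U>; U \<subseteq> V; \<And>t. t \<in> V \<Longrightarrow> P g t; \<And>t. t \<in> U \<Longrightarrow> g t = f t\<rbrakk> \<Longrightarrow> V = U"
proof -
  \<comment> \<open>Ordering graphs by inclusion compares the maps on their domains only, whatever
    values the total functions take elsewhere.\<close>
  define G where "G = (\<lambda>(U::'c set, f::'c \<Rightarrow> 'd). (\<lambda>t. (t, f t)) ` U)"
  define E where "E = {(U, f). U \<in> \<U> \<and> U0 \<subseteq> U \<and> (\<forall>t\<in>U. P f t) \<and> (\<forall>t\<in>U0. f t = f0 t)}"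
  have "\<exists>M\<in>G ` E. \<forall>X\<in>G ` E. M \<subseteq> X \<longrightarrow> X = M"
  proof (rule subset_Zorn_nonempty)
    have "(U0, f0) \<in> E" using U0 f0 unfolding E_def by auto
    then show "G ` E \<noteq> {}" by auto
    fix \<C> assume \<C>: "\<C> \<noteq> {}" "subset.chain (G ` E) \<C>"
    define f where "f t = (THE x. (t, x) \<in> \<Union>\<C>)" for t
    have sub: "\<C> \<subseteq> G ` E" and cmp: "\<And>C D. C \<in> \<C> \<Longrightarrow> D \<in> \<C> \<Longrightarrow> C \<subseteq> D \<or> D \<subseteq> C"
      using \<C>(2) unfolding subset.chain_def by auto
    have fun1: "x = y" if "(t, x) \<in> C" "(t, y) \<in> D" "C \<in> \<C>" "D \<in> \<C>" for t x y C D
      using cmp[OF that(3,4)] that sub unfolding G_def by (auto simp: subset_iff image_iff)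
    have f: "f t = x" if "(t, x) \<in> C" "C \<in> \<C>" for t x C
      unfolding f_def using that fun1 by (intro the_equality) auto
    define \<D> where "\<D> = {U. \<exists>g. (U, g) \<in> E \<and> G (U, g) \<in> \<C>}"
    have eq: "f t = g t" if "(U, g) \<in> E" "G (U, g) \<in> \<C>" "t \<in> U" for U g t
      using that by (intro f[of t "g t" "G (U, g)"]) (auto simp: G_def)
    obtain p where "p \<in> E" "G p \<in> \<C>" using \<C>(1) sub by blast
    then have "fst p \<in> \<D>" unfolding \<D>_def by (cases p) auto
    then have "\<D> \<noteq> {}" "\<D> \<subseteq> \<U>" unfolding \<D>_def E_def by auto
    then have "\<Union>\<D> \<in> \<U>" by (rule un)
    moreover have "U0 \<subseteq> \<Union>\<D>" using \<open>\<D> \<noteq> {}\<close> unfolding \<D>_def E_def by auto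
    moreover have "P f t" if "t \<in> \<Union>\<D>" for t
    proof -
      obtain U g where Ug: "(U, g) \<in> E" "G (U, g) \<in> \<C>" "t \<in> U" using \<open>t \<in> \<Union>\<D>\<close> unfolding \<D>_def by auto
      have "\<forall>\<^sub>F s in nhds t. s \<in> U" using Ug op unfolding E_def by (intro eventually_nhds_in_open) auto
      then have "\<forall>\<^sub>F s in nhds t. g s = f s" by eventually_elim (use eq Ug in auto)
      then show ?thesis using loc Ug unfolding E_def by blast
    qed
    moreover have "f t = f0 t" if "t \<in> U0" for t
    proof -
      obtain U g where Ug: "(U, g) \<in> E" "G (U, g) \<in> \<C>" using \<open>\<D> \<noteq> {}\<close> unfolding \<D>_def by auto
      then show ?thesis using eq[OF Ug, of t] that unfolding E_def by auto
    qed
    ultimately have "(\<Union>\<D>, f) \<in> E" unfolding E_def by auto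
    moreover have "\<Union>\<C> = G (\<Union>\<D>, f)"
    proof (intro set_eqI iffI)
      fix p assume "p \<in> \<Union>\<C>"
      then obtain C where C: "C \<in> \<C>" "p \<in> C" by auto
      then obtain U g where "(U, g) \<in> E" "C = G (U, g)" using sub by auto
      then show "p \<in> G (\<Union>\<D>, f)" using C eq unfolding G_def \<D>_def by fastforce
    next
      fix p assume "p \<in> G (\<Union>\<D>, f)"
      then obtain t U g where "p = (t, f t)" "t \<in> U" "(U, g) \<in> E" "G (U, g) \<in> \<C>"
        unfolding G_def \<D>_def by auto
      then show "p \<in> \<Union>\<C>" using eq by (intro UnionI[of "G (U, g)"]) (auto simp: G_def)
    qed
    ultimately show "\<Union>\<C> \<in> G ` E" by auto
  qed
  then obtain U f where Uf: "(U, f) \<in> E" and max: "\<And>V g. (V, g) \<in> E \<Longrightarrow> G (U, f) \<subseteq> G (V, g) \<Longrightarrow> G (V, g) = G (U, f)"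
    by auto
  show ?thesis
  proof (rule that[of U f])
    show "U \<in> \<U>" "U0 \<subseteq> U" "\<And>t. t \<in> U \<Longrightarrow> P f t" "\<And>t. t \<in> U0 \<Longrightarrow> f t = f0 t"
      using Uf unfolding E_def by auto
    fix V g assume V: "V \<in> \<U>" "U \<subseteq> V" "\<And>t. t \<in> V \<Longrightarrow> P g t" "\<And>t. t \<in> U \<Longrightarrow> g t = f t"
    then have "(V, g) \<in> E" using Uf unfolding E_def by auto
    moreover have "G (U, f) \<subseteq> G (V, g)" using V unfolding G_def by force
    ultimately have "G (V, g) = G (U, f)" by (rule max)
    then have "fst ` G (V, g) = fst ` G (U, f)" by simp
    then show "V = U" unfolding G_def by (simp add: image_image)
  qed
qed

text \<open>A common frame for the real line inside the plane and for the plane itself; preservation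
  of the norm matches balls of the parameter with flat discs of the same radius.\<close>

definition linear_isometry :: "('c::real_normed_vector \<Rightarrow> complex) \<Rightarrow> bool" where
  "linear_isometry \<iota> \<longleftrightarrow> linear \<iota> \<and> (\<forall>u. norm (\<iota> u) = norm u)"

lemma linear_isometry_id [simp]: "linear_isometry (\<lambda>z. z)"
  and linear_isometry_of_real [simp]: "linear_isometry complex_of_real"
  unfolding linear_isometry_def by (auto intro!: linearI simp: scaleR_conv_of_real)

section \<open>Rigidity and gluing of flat maps\<close>

context quadratic_differential
begin

text \<open>These changes of parameter preserve \<open>dz\<^sup>2\<close>, as the slope has square
  1.\<close>

lemma flat_at_affine:
  assumes "flat_at \<Psi> (\<sigma> * \<zeta> + k)" "\<sigma>\<^sup>2 = 1"
  shows "flat_at (\<lambda>z. \<Psi> (\<sigma> * z + k)) \<zeta>"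
proof -
  obtain c where c: "c \<in> A" "\<Psi> (\<sigma> * \<zeta> + k) \<in> fst c" using chart_exists[OF surface] .
  then obtain D where D: "(snd c \<circ> \<Psi> has_field_derivative D) (at (\<sigma> * \<zeta> + k))"
    "q c (snd c (\<Psi> (\<sigma> * \<zeta> + k))) * D\<^sup>2 = 1"
    using assms(1) unfolding flat_at_def by blast
  have da: "((\<lambda>z. \<sigma> * z + k) has_field_derivative \<sigma>) (at \<zeta>)"
    by (auto intro!: derivative_eq_intros)
  show ?thesis
  proof (rule flat_atI[where c = c])
    show "isCont (\<lambda>z. \<Psi> (\<sigma> * z + k)) \<zeta>"
      using isCont_o2[OF DERIV_isCont[OF da], of \<Psi>] assms(1) unfolding flat_at_def by simp
    show "(snd c \<circ> (\<lambda>z. \<Psi> (\<sigma> * z + k)) has_field_derivative D * \<sigma>) (at \<zeta>)"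
      using DERIV_chain2[OF D(1) da] by (simp add: o_def)
    show "q c (snd c (\<Psi> (\<sigma> * \<zeta> + k))) * (D * \<sigma>)\<^sup>2 = 1"
      using D(2) assms(2) by (simp add: power_mult_distrib)
  qed (use c in auto)
qed

text \<open>The map \<open>k\<close> from one flat parameter to the other has a derivative of square
  1. This derivative is continuous on a disc with values in a two-point set, hence constant, so the
  parameters differ by a translation or a half-turn.\<close>

lemma flat_transition:
  assumes 1: "open U1" "\<And>\<zeta>. \<zeta> \<in> U1 \<Longrightarrow> flat_at \<Psi>1 \<zeta>" "\<zeta>1 \<in> U1"
    and 2: "open U2" "\<And>\<zeta>. \<zeta> \<in> U2 \<Longrightarrow> flat_at \<Psi>2 \<zeta>" "\<zeta>2 \<in> U2"
    and eq: "\<Psi>1 \<zeta>1 = \<Psi>2 \<zeta>2"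
  obtains r \<sigma> where "0 < r" "\<sigma> \<in> {1, -1::real}" "ball \<zeta>1 r \<subseteq> U1" "ball \<zeta>2 r \<subseteq> U2"
    "\<And>u. norm u < r \<Longrightarrow> \<Psi>2 (\<zeta>2 + u) = \<Psi>1 (\<zeta>1 + of_real \<sigma> * u)"
proof -
  obtain r1 g where g: "0 < r1" "ball \<zeta>1 r1 \<subseteq> U1" "open (\<Psi>1 ` ball \<zeta>1 r1)"
    "\<And>\<zeta>. \<zeta> \<in> ball \<zeta>1 r1 \<Longrightarrow> g (\<Psi>1 \<zeta>) = \<zeta>"
    "\<And>c x. c \<in> A \<Longrightarrow> x \<in> fst c \<Longrightarrow> x \<in> \<Psi>1 ` ball \<zeta>1 r1 \<Longrightarrow>
       \<exists>D. ((g \<circ> chart_inv c) has_field_derivative D) (at (snd c x)) \<and> D\<^sup>2 = q c (snd c x)"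
    using flat_inverse[OF 1] by metis
  define N where "N = \<Psi>1 ` ball \<zeta>1 r1"
  have "continuous_on U2 \<Psi>2"
    using 2(2) unfolding flat_at_def by (auto intro: continuous_at_imp_continuous_on)
  then have "open (U2 \<inter> \<Psi>2 -` N)" "\<zeta>2 \<in> U2 \<inter> \<Psi>2 -` N"
    using 2 g(1,3) eq unfolding N_def by (auto intro: continuous_open_preimage simp: image_iff)
      (metis centre_in_ball)
  then obtain r2 where r2: "0 < r2" "ball \<zeta>2 r2 \<subseteq> U2 \<inter> \<Psi>2 -` N"
    using open_contains_ball by metis
  define k where "k = g \<circ> \<Psi>2"
  have der: "\<exists>\<delta>. (k has_field_derivative \<delta>) (at \<zeta>) \<and> \<delta>\<^sup>2 = 1" if \<zeta>: "\<zeta> \<in> ball \<zeta>2 r2" for \<zeta>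
  proof -
    obtain c where c: "c \<in> A" "\<Psi>2 \<zeta> \<in> fst c" using chart_exists[OF surface] .
    have fl: "flat_at \<Psi>2 \<zeta>" "\<Psi>2 \<zeta> \<in> N" using 2(2) \<zeta> r2 by auto
    obtain D where D: "((g \<circ> chart_inv c) has_field_derivative D) (at (snd c (\<Psi>2 \<zeta>)))" "D\<^sup>2 = q c (snd c (\<Psi>2 \<zeta>))"
      using g(5)[OF c] fl(2) unfolding N_def by blast
    obtain E where E: "((snd c \<circ> \<Psi>2) has_field_derivative E) (at \<zeta>)" "q c (snd c (\<Psi>2 \<zeta>)) * E\<^sup>2 = 1"
      using fl(1) c unfolding flat_at_def by blast
    have "((g \<circ> chart_inv c) \<circ> (snd c \<circ> \<Psi>2) has_field_derivative D * E) (at \<zeta>)"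
      using D(1) by (intro DERIV_chain[OF _ E(1)]) simp
    moreover have "\<forall>\<^sub>F z in nhds \<zeta>. \<Psi>2 z \<in> fst c"
      using fl(1) c riemann_surface_chart(1)[OF surface c(1)] unfolding flat_at_def
      by (intro isCont_eventually_in) auto
    then have "\<forall>\<^sub>F z in nhds \<zeta>. ((g \<circ> chart_inv c) \<circ> (snd c \<circ> \<Psi>2)) z = k z"
      by eventually_elim (use chart_inv_simps(1)[OF surface c(1)] in \<open>auto simp: k_def\<close>)
    ultimately have "(k has_field_derivative D * E) (at \<zeta>)"
      by (subst (asm) DERIV_cong_ev[OF refl _ refl])
    then show ?thesis using D(2) E(2) by (intro exI[of _ "D * E"]) (auto simp: power_mult_distrib)
  qed
  have hol: "k holomorphic_on ball \<zeta>2 r2" using der by (auto simp: holomorphic_on_open) blast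
  have d1: "deriv k \<zeta> \<in> {1, -1}" if "\<zeta> \<in> ball \<zeta>2 r2" for \<zeta>
    using der[OF that] DERIV_imp_deriv by (auto simp: power2_eq_1_iff)
  have "continuous_on (ball \<zeta>2 r2) (deriv k)"
    using hol by (intro holomorphic_on_imp_continuous_on holomorphic_deriv) auto
  moreover have "finite (deriv k ` ball \<zeta>2 r2)"
    by (rule finite_subset[of _ "{1, -1}"]) (use d1 in blast, simp)
  ultimately have "deriv k constant_on ball \<zeta>2 r2"
    by (rule continuous_finite_range_constant[OF connected_ball])
  then obtain \<sigma>c where \<sigma>c: "\<And>\<zeta>. \<zeta> \<in> ball \<zeta>2 r2 \<Longrightarrow> deriv k \<zeta> = \<sigma>c" unfolding constant_on_def by auto
  then have "\<sigma>c \<in> {1, -1}" using d1[of \<zeta>2] r2(1) by auto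
  then obtain \<sigma> :: real where \<sigma>: "\<sigma> \<in> {1, -1}" "\<sigma>c = of_real \<sigma>"
    using that[of 1] that[of "-1"] by auto
  have "(\<lambda>\<zeta>. k \<zeta> - \<sigma>c * \<zeta>) constant_on ball \<zeta>2 r2"
  proof (rule has_field_derivative_0_imp_constant_on)
    fix z assume z: "z \<in> ball \<zeta>2 r2"
    have "(k has_field_derivative \<sigma>c) (at z)"
      using holomorphic_derivI[OF hol open_ball z] \<sigma>c[OF z] by simp
    then show "((\<lambda>\<zeta>. k \<zeta> - \<sigma>c * \<zeta>) has_field_derivative 0) (at z)"
      by (auto intro!: derivative_eq_intros)
  qed auto
  then obtain C where C: "\<And>\<zeta>. \<zeta> \<in> ball \<zeta>2 r2 \<Longrightarrow> k \<zeta> - \<sigma>c * \<zeta> = C" unfolding constant_on_def by auto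
  have k2: "k \<zeta>2 = \<zeta>1" using g(4)[of \<zeta>1] g(1) eq unfolding k_def by auto
  have kk: "k (\<zeta>2 + u) = \<zeta>1 + of_real \<sigma> * u" if "norm u < r2" for u
    using C[of "\<zeta>2 + u"] C[of \<zeta>2] k2 that r2(1) \<sigma>(2) by (auto simp: dist_norm algebra_simps)
  show ?thesis
  proof (rule that[of "min r1 r2" \<sigma>])
    show "\<Psi>2 (\<zeta>2 + u) = \<Psi>1 (\<zeta>1 + of_real \<sigma> * u)" if "norm u < min r1 r2" for u
    proof -
      have "\<Psi>2 (\<zeta>2 + u) \<in> N" using r2(2) that by (auto simp: dist_norm subset_iff)
      then obtain z where z: "z \<in> ball \<zeta>1 r1" "\<Psi>2 (\<zeta>2 + u) = \<Psi>1 z" unfolding N_def by auto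
      then have "k (\<zeta>2 + u) = z" using g(4)[OF z(1)] unfolding k_def by simp
      then show ?thesis using kk[of u] that z by auto
    qed
  qed (use g r2 \<sigma> in auto)
qed

lemma flat_locally_inj:
  assumes "open U" "\<And>\<zeta>. \<zeta> \<in> U \<Longrightarrow> flat_at \<Psi> \<zeta>" "\<zeta>0 \<in> U"
  obtains r where "0 < r" "ball \<zeta>0 r \<subseteq> U" "inj_on \<Psi> (ball \<zeta>0 r)" "open (\<Psi> ` ball \<zeta>0 r)"
  using flat_inverse[OF assms] by (metis inj_onI)

text \<open>
  With \<open>\<iota>\<close> the inclusion of the reals this describes horizontal curves of unit speed, with
  \<open>\<iota>\<close> the identity it is flatness in a neighbourhood.
\<close>

definition flat_along :: "('c::euclidean_space \<Rightarrow> complex) \<Rightarrow> ('c \<Rightarrow> 'a) \<Rightarrow> 'c \<Rightarrow> bool" where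
  "flat_along \<iota> f t \<longleftrightarrow> (\<exists>r>0. \<exists>\<Psi>. (\<forall>\<zeta>\<in>ball 0 r. flat_at \<Psi> \<zeta>) \<and> (\<forall>u. norm u < r \<longrightarrow> f (t + u) = \<Psi> (\<iota> u)))"

lemma flat_along_cong:
  assumes "\<forall>\<^sub>F s in nhds t. f s = g s" "flat_along \<iota> f t"
  shows "flat_along \<iota> g t"
proof -
  obtain r \<Psi> where r: "0 < r" "\<And>\<zeta>. \<zeta> \<in> ball 0 r \<Longrightarrow> flat_at \<Psi> \<zeta>" "\<And>u. norm u < r \<Longrightarrow> f (t + u) = \<Psi> (\<iota> u)"
    using assms(2) unfolding flat_along_def by blast
  obtain e where e: "0 < e" "\<And>s. dist s t < e \<Longrightarrow> f s = g s"
    using assms(1) unfolding eventually_nhds_metric by blast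
  have "\<forall>u. norm u < min r e \<longrightarrow> g (t + u) = \<Psi> (\<iota> u)"
    using r(3) e(2) by (metis add_diff_cancel_left' dist_norm min_less_iff_conj)
  then show ?thesis unfolding flat_along_def
    using r e by (intro exI[of _ "min r e"] conjI exI[of _ \<Psi>]) auto
qed

lemma flat_along_isCont:
  assumes "flat_along \<iota> f t" "linear_isometry \<iota>"
  shows "isCont f t"
proof -
  obtain r \<Psi> where r: "0 < r" "\<And>\<zeta>. \<zeta> \<in> ball 0 r \<Longrightarrow> flat_at \<Psi> \<zeta>" "\<And>u. norm u < r \<Longrightarrow> f (t + u) = \<Psi> (\<iota> u)"
    using assms(1) unfolding flat_along_def by blast
  have lin: "linear \<iota>" using assms(2) unfolding linear_isometry_def by blast
  have "isCont (\<lambda>s. \<iota> (s - t)) t"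
    using isCont_o2[where a = t and f = "\<lambda>s. s - t" and g = \<iota>] linear_continuous_at[of \<iota>] lin by (simp add: linear_conv_bounded_linear)
  moreover have "isCont \<Psi> (\<iota> (t - t))"
    using r(1,2) linear_0[OF lin] unfolding flat_at_def by auto
  ultimately have "isCont (\<lambda>s. \<Psi> (\<iota> (s - t))) t"
    by (rule isCont_o2[where a = t and f = "\<lambda>s. \<iota> (s - t)" and g = \<Psi>])
  moreover have "\<forall>\<^sub>F s in nhds t. \<Psi> (\<iota> (s - t)) = f s"
  proof -
    have "\<forall>\<^sub>F s in nhds t. s \<in> ball t r" using r(1) by (intro eventually_nhds_in_open) auto
    then show ?thesis
      by eventually_elim (metis r(3) add.commute diff_add_cancel dist_norm mem_ball norm_minus_commute)
  qed
  ultimately show ?thesis by (subst (asm) isCont_cong)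
qed

text \<open>Equality at \<open>t\<close> alone leaves two possible germs, related by a half-turn.
  Points of agreement near \<open>t\<close> rule out the half-turn: \<open>\<Psi>1\<close> would
  take equal values at \<open>\<iota> (s - t)\<close> and at its negative, against local
  injectivity.\<close>

lemma flat_along_identity_local:
  assumes f: "flat_along \<iota> f t" and g: "flat_along \<iota> g t" and \<iota>: "linear_isometry \<iota>"
    and lim: "t islimpt {s. f s = g s}"
  shows "\<forall>\<^sub>F s in nhds t. f s = g s"
proof -
  have lin: "linear \<iota>" using \<iota> unfolding linear_isometry_def by blast
  obtain r1 \<Psi>1 where r1: "0 < r1" "\<And>\<zeta>. \<zeta> \<in> ball 0 r1 \<Longrightarrow> flat_at \<Psi>1 \<zeta>" "\<And>u. norm u < r1 \<Longrightarrow> f (t + u) = \<Psi>1 (\<iota> u)"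
    using f unfolding flat_along_def by blast
  obtain r2 \<Psi>2 where r2: "0 < r2" "\<And>\<zeta>. \<zeta> \<in> ball 0 r2 \<Longrightarrow> flat_at \<Psi>2 \<zeta>" "\<And>u. norm u < r2 \<Longrightarrow> g (t + u) = \<Psi>2 (\<iota> u)"
    using g unfolding flat_along_def by blast
  obtain s where s: "\<And>n. s n \<in> {s. f s = g s} - {t}" "s \<longlonglongrightarrow> t"
    using lim unfolding islimpt_sequential by blast
  have "(\<lambda>n. f (s n)) \<longlonglongrightarrow> f t" "(\<lambda>n. g (s n)) \<longlonglongrightarrow> g t"
    using flat_along_isCont[OF f \<iota>] flat_along_isCont[OF g \<iota>] s(2) isCont_tendsto_compose by blast+
  then have "f t = g t" using s(1) by (simp add: LIMSEQ_unique)
  then have eq: "\<Psi>1 0 = \<Psi>2 0" using r1(3)[of 0] r2(3)[of 0] r1(1) r2(1) linear_0[OF lin] by simp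
  obtain r \<sigma> where r: "0 < r" "\<sigma> \<in> {1, -1::real}" "ball 0 r \<subseteq> ball (0::complex) r1" "ball 0 r \<subseteq> ball (0::complex) r2"
    "\<And>u. norm u < r \<Longrightarrow> \<Psi>2 (0 + u) = \<Psi>1 (0 + of_real \<sigma> * u)"
    using flat_transition[OF open_ball r1(2) _ open_ball r2(2) _ eq] r1(1) r2(1) by (metis centre_in_ball)
  have rr: "r \<le> r1" "r \<le> r2" using r(1,3,4) r1(1) by (auto simp: ball_subset_ball_iff)
  obtain r3 where r3: "0 < r3" "inj_on \<Psi>1 (ball 0 r3)"
    using flat_locally_inj[OF open_ball r1(2)] r1(1) by (metis centre_in_ball)
  have "\<sigma> = 1"
  proof (rule ccontr)
    assume "\<sigma> \<noteq> 1"
    then have \<sigma>: "\<sigma> = -1" using r(2) by auto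
    have "\<forall>\<^sub>F n in sequentially. dist (s n) t < min r r3"
      using s(2) r(1) r3(1) by (intro tendstoD) auto
    then obtain n where "dist (s n) t < min r r3" by (auto simp: eventually_sequentially)
    then have n: "norm (s n - t) < r" "norm (s n - t) < r3" by (auto simp: dist_norm)
    let ?u = "\<iota> (s n - t)"
    have nu: "norm ?u = norm (s n - t)" using \<iota> unfolding linear_isometry_def by auto
    have "f (s n) = \<Psi>1 ?u" "g (s n) = \<Psi>2 ?u" using r1(3)[of "s n - t"] r2(3)[of "s n - t"] n(1) rr by auto
    then have "\<Psi>1 ?u = \<Psi>1 (- ?u)" using s(1)[of n] r(5)[of ?u] n nu \<sigma> by auto
    then have "?u = - ?u" by (rule inj_onD[OF r3(2)]) (use n nu in auto)
    then have "?u = 0" by simp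
    then show False using nu s(1)[of n] by auto
  qed
  have "f s = g s" if "dist s t < r" for s
  proof -
    have n: "norm (s - t) < r" using that by (simp add: dist_norm)
    have nu: "norm (\<iota> (s - t)) = norm (s - t)" using \<iota> unfolding linear_isometry_def by auto
    show ?thesis
      using r1(3)[of "s - t"] r2(3)[of "s - t"] n rr r(5)[of "\<iota> (s - t)"] nu \<open>\<sigma> = 1\<close> by auto
  qed
  then show ?thesis unfolding eventually_nhds_metric using r(1) by blast
qed

text \<open>Identity theorem: accumulation points of agreement form a relatively closed set, which
  is open by the local version.\<close>

lemma flat_along_identity:
  assumes S: "open S" "connected S"
    and f: "\<And>t. t \<in> S \<Longrightarrow> flat_along \<iota> f t" and g: "\<And>t. t \<in> S \<Longrightarrow> flat_along \<iota> g t"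
    and \<iota>: "linear_isometry \<iota>" and t0: "t0 \<in> S" "t0 islimpt {s. f s = g s}"
    and t: "t \<in> S"
  shows "f t = g t"
proof -
  define E where "E = S \<inter> {t. t islimpt {s. f s = g s}}"
  have ev: "\<forall>\<^sub>F s in nhds t. f s = g s" if "t \<in> E" for t
    using flat_along_identity_local[OF f g \<iota>, of t] that unfolding E_def by blast
  have "closedin (top_of_set S) E"
    unfolding E_def by (intro closedin_closed_Int closed_limpts)
  moreover have "openin (top_of_set S) E"
  proof (subst openin_subopen, intro ballI)
    fix t assume t: "t \<in> E"
    obtain T where T: "open T" "t \<in> T" "\<And>s. s \<in> T \<Longrightarrow> f s = g s"
      using ev[OF t] unfolding eventually_nhds by blast
    have "s islimpt {s. f s = g s}" if "s \<in> T" for s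
      by (rule islimpt_subset[OF interior_limit_point[of s T]]) (use T that in \<open>auto simp: interior_open\<close>)
    then show "\<exists>T. openin (top_of_set S) T \<and> t \<in> T \<and> T \<subseteq> E"
      using t T unfolding E_def by (intro exI[of _ "S \<inter> T"]) auto
  qed
  moreover have "t0 \<in> E" using t0 unfolding E_def by blast
  ultimately have "E = S" using S(2) unfolding connected_clopen by blast
  then show ?thesis using ev[of t] t eventually_nhds_x_imp_x by blast
qed

lemma flat_along_glue:
  assumes "open U" "open V" "\<And>t. t \<in> U \<Longrightarrow> flat_along \<iota> f t" "\<And>t. t \<in> V \<Longrightarrow> flat_along \<iota> g t"
    and "\<And>t. t \<in> U \<Longrightarrow> t \<in> V \<Longrightarrow> f t = g t" "t \<in> U \<union> V"
  shows "flat_along \<iota> (\<lambda>t. if t \<in> U then f t else g t) t"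
proof (cases "t \<in> U")
  case True
  then have "\<forall>\<^sub>F s in nhds t. s \<in> U" using assms(1) eventually_nhds_in_open by blast
  then have "\<forall>\<^sub>F s in nhds t. f s = (if s \<in> U then f s else g s)" by eventually_elim auto
  then show ?thesis by (rule flat_along_cong) (use assms True in auto)
next
  case False
  then have t: "t \<in> V" using assms by auto
  then have "\<forall>\<^sub>F s in nhds t. s \<in> V" using assms(2) eventually_nhds_in_open by blast
  then have "\<forall>\<^sub>F s in nhds t. g s = (if s \<in> U then f s else g s)" by eventually_elim (use assms(5) in auto)
  then show ?thesis by (rule flat_along_cong) (use assms t in auto)
qed

lemma flat_along_I:
  assumes "open U" "\<And>\<zeta>. \<zeta> \<in> U \<Longrightarrow> flat_at \<Psi> \<zeta>" "linear_isometry \<iota>" "\<iota> s + k \<in> U"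
  shows "flat_along \<iota> (\<lambda>t. \<Psi> (\<iota> t + k)) s"
proof -
  obtain r where r: "0 < r" "ball (\<iota> s + k) r \<subseteq> U" using assms(1,4) open_contains_ball by metis
  have "flat_at (\<lambda>z. \<Psi> (1 * z + (\<iota> s + k))) \<zeta>" if "\<zeta> \<in> ball 0 r" for \<zeta>
    using that r(2) by (intro flat_at_affine assms(2)) (auto simp: dist_norm subset_iff)
  moreover have "\<iota> (s + u) = \<iota> s + \<iota> u" for u
    using assms(3) linear_add unfolding linear_isometry_def by blast
  ultimately show ?thesis
    unfolding flat_along_def using r(1)
    by (intro exI[of _ r] conjI exI[of _ "\<lambda>z. \<Psi> (1 * z + (\<iota> s + k))"]) (auto simp: algebra_simps)
qed

lemma flat_along_at:
  assumes "flat_along (\<lambda>z. z) f \<zeta>"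
  shows "flat_at f \<zeta>"
proof -
  obtain r \<Psi> where r: "0 < r" "\<And>\<zeta>. \<zeta> \<in> ball 0 r \<Longrightarrow> flat_at \<Psi> \<zeta>" "\<And>u. norm u < r \<Longrightarrow> f (\<zeta> + u) = \<Psi> u"
    using assms unfolding flat_along_def by blast
  have "flat_at (\<lambda>z. \<Psi> (1 * z + - \<zeta>)) \<zeta>"
    using r by (intro flat_at_affine) auto
  moreover have "\<forall>\<^sub>F z in nhds \<zeta>. \<Psi> (1 * z + - \<zeta>) = f z"
    unfolding eventually_nhds_metric using r(1,3) by (intro exI[of _ r]) (auto simp: dist_norm, metis add.commute diff_add_cancel)
  ultimately show ?thesis using flat_at_cong[of "\<lambda>z. \<Psi> (1 * z + - \<zeta>)" f \<zeta>] by blast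
qed

lemma flat_along_affine:
  assumes "flat_along \<iota> f (\<sigma> *\<^sub>R t + k)" "\<sigma> \<in> {1, -1}" "linear_isometry \<iota>"
  shows "flat_along \<iota> (\<lambda>t. f (\<sigma> *\<^sub>R t + k)) t"
proof -
  obtain r \<Psi> where r: "0 < r" "\<And>\<zeta>. \<zeta> \<in> ball 0 r \<Longrightarrow> flat_at \<Psi> \<zeta>"
    "\<And>u. norm u < r \<Longrightarrow> f (\<sigma> *\<^sub>R t + k + u) = \<Psi> (\<iota> u)"
    using assms(1) unfolding flat_along_def by blast
  have lin: "linear \<iota>" using assms(3) unfolding linear_isometry_def by blast
  have "flat_at (\<lambda>z. \<Psi> (of_real \<sigma> * z + 0)) \<zeta>" if "\<zeta> \<in> ball 0 r" for \<zeta>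
    using that assms(2) by (intro flat_at_affine r(2)) auto
  moreover have "f (\<sigma> *\<^sub>R (t + u) + k) = \<Psi> (of_real \<sigma> * \<iota> u + 0)" if "norm u < r" for u
    using r(3)[of "\<sigma> *\<^sub>R u"] that assms(2) linear_scale[OF lin, of \<sigma> u]
    by (auto simp: algebra_simps scaleR_conv_of_real)
  ultimately show ?thesis
    unfolding flat_along_def using r(1)
    by (intro exI[of _ r] conjI exI[of _ "\<lambda>z. \<Psi> (of_real \<sigma> * z + 0)"]) auto
qed

end

subsection \<open>Trajectories\<close>

lemma real_square_pos:
  fixes z :: complex
  assumes "z\<^sup>2 \<in> \<real>" "Re (z\<^sup>2) > 0"
  shows "Im z = 0"
proof -
  have "Im (z\<^sup>2) = 0" using assms(1) complex_is_Real_iff by blast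
  then have "Re z = 0 \<or> Im z = 0" by (auto simp: power2_eq_square)
  then show ?thesis using assms(2) by (auto simp: power2_eq_square)
qed

context quadratic_differential
begin

text \<open>Near \<open>t0\<close> the curve is a flat map composed with a real translation, so its
  velocity is the complex derivative of that map; existence, normalisation and continuity follow
  from this.\<close>

lemma flat_along_vector_derivative:
  assumes "flat_along complex_of_real \<gamma> t0" "c \<in> A" "\<gamma> t0 \<in> fst c"
  shows "\<forall>\<^sub>F t in nhds t0. ((snd c \<circ> \<gamma>) has_vector_derivative vector_derivative (snd c \<circ> \<gamma>) (at t)) (at t) \<and>
      q c (snd c (\<gamma> t)) * (vector_derivative (snd c \<circ> \<gamma>) (at t))\<^sup>2 = 1" (is "eventually ?P _")
    and "isCont (\<lambda>t. vector_derivative (snd c \<circ> \<gamma>) (at t)) t0"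
proof -
  obtain r \<Psi> where r: "0 < r" "\<And>\<zeta>. \<zeta> \<in> ball 0 r \<Longrightarrow> flat_at \<Psi> \<zeta>" "\<And>u. norm u < r \<Longrightarrow> \<gamma> (t0 + u) = \<Psi> (of_real u)"
    using assms(1) unfolding flat_along_def by blast
  define W where "W = ball 0 r \<inter> \<Psi> -` fst c"
  define a where "a = snd c \<circ> \<Psi>"
  have "continuous_on (ball 0 r) \<Psi>"
    using r(2) unfolding flat_at_def by (auto intro: continuous_at_imp_continuous_on)
  then have W: "open W" "0 \<in> W"
    unfolding W_def using r(1) r(3)[of 0] assms(2,3) riemann_surface_chart(1)[OF surface assms(2)]
    by (auto intro: continuous_open_preimage)
  have der: "(a has_field_derivative deriv a \<zeta>) (at \<zeta>)" "q c (a \<zeta>) * (deriv a \<zeta>)\<^sup>2 = 1" if "\<zeta> \<in> W" for \<zeta>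
  proof -
    have "flat_at \<Psi> \<zeta>" "\<Psi> \<zeta> \<in> fst c" using r(2) that unfolding W_def by auto
    then obtain D where "(a has_field_derivative D) (at \<zeta>)" "q c (a \<zeta>) * D\<^sup>2 = 1"
      using assms(2) unfolding flat_at_def a_def by auto
    then show "(a has_field_derivative deriv a \<zeta>) (at \<zeta>)" "q c (a \<zeta>) * (deriv a \<zeta>)\<^sup>2 = 1"
      using DERIV_imp_deriv by auto
  qed
  have hol: "a holomorphic_on W" using der(1) W(1) by (auto simp: holomorphic_on_open)
  define \<iota> where "\<iota> t = complex_of_real (t - t0)" for t
  have contI: "isCont \<iota> t" for t unfolding \<iota>_def by (intro continuous_intros)
  have evW: "\<forall>\<^sub>F s in nhds t. \<iota> s \<in> W" if "\<iota> t \<in> W" for t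
    using isCont_eventually_in[OF contI W(1) that] .
  have eq: "\<gamma> t = \<Psi> (\<iota> t)" if "\<iota> t \<in> W" for t
    using r(3)[of "t - t0"] that unfolding W_def \<iota>_def by (auto simp del: of_real_diff)
  have vd: "((snd c \<circ> \<gamma>) has_vector_derivative deriv a (\<iota> t)) (at t)" if "\<iota> t \<in> W" for t
  proof -
    have "(\<iota> has_vector_derivative 1) (at t)"
      unfolding \<iota>_def by (auto intro!: derivative_eq_intros)
    then have "(a \<circ> \<iota> has_vector_derivative 1 * deriv a (\<iota> t)) (at t)"
      using der(1)[OF that] by (rule field_vector_diff_chain_at)
    moreover have ev: "\<forall>\<^sub>F s in nhds t. (a \<circ> \<iota>) s = (snd c \<circ> \<gamma>) s"
      using evW[OF that] by eventually_elim (use eq in \<open>auto simp: a_def\<close>)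
    ultimately show ?thesis
      using has_vector_derivative_cong_ev[where f = "a \<circ> \<iota>" and g = "snd c \<circ> \<gamma>" and x = t and S = UNIV] eventually_nhds_x_imp_x[OF ev]
      by (auto elim!: eventually_mono)
  qed
  have t0: "\<iota> t0 \<in> W" using W(2) unfolding \<iota>_def by simp
  show "eventually ?P (nhds t0)"
    using evW[OF t0]
  proof eventually_elim
    case (elim t)
    then show ?case
      using vd[OF elim] vector_derivative_at[OF vd[OF elim]] der(2)[OF elim] eq[OF elim] by (simp add: a_def)
  qed
  have "isCont (\<lambda>t. deriv a (\<iota> t)) t0"
  proof (rule isCont_o2[OF contI])
    show "isCont (deriv a) (\<iota> t0)"
      using holomorphic_deriv[OF hol W(1)] W(1) t0 DERIV_isCont holomorphic_derivI by blast
  qed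
  moreover have "\<forall>\<^sub>F t in nhds t0. deriv a (\<iota> t) = vector_derivative (snd c \<circ> \<gamma>) (at t)"
    using evW[OF t0] by eventually_elim (use vector_derivative_at[OF vd] in auto)
  ultimately show "isCont (\<lambda>t. vector_derivative (snd c \<circ> \<gamma>) (at t)) t0"
    by (subst (asm) isCont_cong)
qed

text \<open>For a curve of unit speed, \<open>q\<close> times the squared velocity is 1, in
  particular real and positive. Conversely a horizontal geodesic is of this kind up to its speed,
  see \<open>horizontal_geodesic_flat\<close>.\<close>

lemma horizontal_geodesicI:
  assumes "open I" "is_interval I" "I \<noteq> {}" "\<And>t. t \<in> I \<Longrightarrow> flat_along complex_of_real \<gamma> t"
  shows "horizontal_geodesic A q I \<gamma>"
  unfolding horizontal_geodesic_def
proof (intro conjI ballI)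
  show "continuous_on I \<gamma>"
    using assms(4) flat_along_isCont linear_isometry_of_real continuous_at_imp_continuous_on by blast
  fix c assume c: "c \<in> A"
  have der: "((snd c \<circ> \<gamma>) has_vector_derivative vector_derivative (snd c \<circ> \<gamma>) (at t)) (at t) \<and>
      q c (snd c (\<gamma> t)) * (vector_derivative (snd c \<circ> \<gamma>) (at t))\<^sup>2 = 1" if "t \<in> I \<inter> \<gamma> -` fst c" for t
    using flat_along_vector_derivative(1)[OF assms(4) c, of t] that eventually_nhds_x_imp_x by blast
  show "(snd c \<circ> \<gamma>) C1_differentiable_on I \<inter> \<gamma> -` fst c"
    unfolding C1_differentiable_on_def
    using der flat_along_vector_derivative(2)[OF assms(4) c]
    by (intro exI[of _ "\<lambda>t. vector_derivative (snd c \<circ> \<gamma>) (at t)"] conjI continuous_at_imp_continuous_on) auto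
  show "let v = q c (snd c (\<gamma> t)) * (vector_derivative (snd c \<circ> \<gamma>) (at t))\<^sup>2 in v \<in> \<real> \<and> Re v > 0"
    if "t \<in> I \<inter> \<gamma> -` fst c" for t
    using der[OF that] by (simp add: Let_def)
qed (use assms in auto)

lemma horizontal_geodesic_regular:
  assumes "horizontal_geodesic A q J \<delta>" "t \<in> J"
  shows "regular (\<delta> t)"
proof -
  obtain c where c: "c \<in> A" "\<delta> t \<in> fst c" using chart_exists[OF surface] .
  then have "Re (q c (snd c (\<delta> t)) * (vector_derivative (snd c \<circ> \<delta>) (at t))\<^sup>2) > 0"
    using assms unfolding horizontal_geodesic_def Let_def by blast
  then have "q c (snd c (\<delta> t)) \<noteq> 0" by auto
  then show ?thesis unfolding regular_def using c by blast
qed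

text \<open>In the flat coordinate \<open>g\<close> the velocity has a positive real square, so it
  is real and the imaginary part of the coordinate is constant. The speed of a geodesic is
  arbitrary, hence the position \<open>x\<close> along the horizontal is merely some continuous
  function.\<close>

lemma horizontal_geodesic_flat:
  assumes geo: "horizontal_geodesic A q J \<delta>" "t0 \<in> J"
    and flat: "open U" "\<And>\<zeta>. \<zeta> \<in> U \<Longrightarrow> flat_at \<Psi> \<zeta>" "\<zeta>0 \<in> U" "\<Psi> \<zeta>0 = \<delta> t0"
  obtains x :: "real \<Rightarrow> real" where "isCont x t0" "x t0 = 0"
    "\<forall>\<^sub>F t in nhds t0. t \<in> J \<and> \<zeta>0 + of_real (x t) \<in> U \<and> \<delta> t = \<Psi> (\<zeta>0 + of_real (x t))"
proof -
  obtain r g where g: "0 < r" "ball \<zeta>0 r \<subseteq> U" "open (\<Psi> ` ball \<zeta>0 r)"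
    "\<And>\<zeta>. \<zeta> \<in> ball \<zeta>0 r \<Longrightarrow> g (\<Psi> \<zeta>) = \<zeta>"
    "\<And>c x. c \<in> A \<Longrightarrow> x \<in> fst c \<Longrightarrow> x \<in> \<Psi> ` ball \<zeta>0 r \<Longrightarrow>
       \<exists>D. ((g \<circ> chart_inv c) has_field_derivative D) (at (snd c x)) \<and> D\<^sup>2 = q c (snd c x)"
    using flat_inverse[OF flat(1-3)] by metis
  define V where "V = J \<inter> \<delta> -` (\<Psi> ` ball \<zeta>0 r)"
  have J: "open J" "continuous_on J \<delta>" using geo unfolding horizontal_geodesic_def by auto
  have "open V" "t0 \<in> V" unfolding V_def using J g(1,3) geo(2) flat(4)
    by (auto intro: continuous_open_preimage simp: image_iff) (metis centre_in_ball)
  then obtain e where e: "0 < e" "ball t0 e \<subseteq> V" using open_contains_ball by blast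
  define k where "k = g \<circ> \<delta>"
  have der: "\<exists>D. (k has_vector_derivative D) (at t) \<and> Im D = 0" if t: "t \<in> V" for t
  proof -
    obtain c where c: "c \<in> A" "\<delta> t \<in> fst c" using chart_exists[OF surface] .
    define v where "v = vector_derivative (snd c \<circ> \<delta>) (at t)"
    have tJ: "t \<in> J \<inter> \<delta> -` fst c" using t c unfolding V_def by auto
    have "(snd c \<circ> \<delta>) C1_differentiable_on (J \<inter> \<delta> -` fst c)"
      using geo c unfolding horizontal_geodesic_def by blast
    then have v: "(snd c \<circ> \<delta> has_vector_derivative v) (at t)"
      using tJ unfolding C1_differentiable_on_def v_def by (metis vector_derivative_at)
    have pos: "q c (snd c (\<delta> t)) * v\<^sup>2 \<in> \<real>" "Re (q c (snd c (\<delta> t)) * v\<^sup>2) > 0"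
      using geo(1) tJ c(1) unfolding horizontal_geodesic_def v_def Let_def by blast+
    obtain D where D: "((g \<circ> chart_inv c) has_field_derivative D) (at (snd c (\<delta> t)))" "D\<^sup>2 = q c (snd c (\<delta> t))"
      using g(5)[OF c] t unfolding V_def by blast
    have "((g \<circ> chart_inv c) \<circ> (snd c \<circ> \<delta>) has_vector_derivative v * D) (at t)"
      using D(1) by (intro field_vector_diff_chain_at v) simp
    moreover have "isCont \<delta> t" using J tJ by (simp add: continuous_on_eq_continuous_at)
    then have "\<forall>\<^sub>F s in nhds t. \<delta> s \<in> fst c"
      using c riemann_surface_chart(1)[OF surface c(1)] by (intro isCont_eventually_in) auto
    then have ev: "\<forall>\<^sub>F s in nhds t. ((g \<circ> chart_inv c) \<circ> (snd c \<circ> \<delta>)) s = k s"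
      by eventually_elim (use chart_inv_simps(1)[OF surface c(1)] in \<open>auto simp: k_def\<close>)
    ultimately have "(k has_vector_derivative v * D) (at t)"
      using has_vector_derivative_cong_ev[where f = "(g \<circ> chart_inv c) \<circ> (snd c \<circ> \<delta>)" and g = k and x = t and S = UNIV] eventually_nhds_x_imp_x[OF ev]
      by (auto elim!: eventually_mono)
    moreover have "Im (v * D) = 0"
      using pos D(2) by (intro real_square_pos) (auto simp: power_mult_distrib mult.commute)
    ultimately show ?thesis by blast
  qed
  have "\<exists>C. \<forall>t\<in>ball t0 e. Im (k t) = C"
  proof (rule has_derivative_zero_constant[OF convex_ball])
    fix t assume "t \<in> ball t0 e"
    then obtain D where D: "(k has_vector_derivative D) (at t)" "Im D = 0" using der e(2) by blast
    have "((\<lambda>t. Im (k t)) has_derivative (\<lambda>h. Im (h *\<^sub>R D))) (at t within ball t0 e)"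
      using has_derivative_at_withinI[OF D(1)[unfolded has_vector_derivative_def]]
      by (rule bounded_linear.has_derivative[OF bounded_linear_Im])
    then show "((\<lambda>t. Im (k t)) has_derivative (\<lambda>h. 0)) (at t within ball t0 e)"
      using D(2) by simp
  qed
  then have Imk: "Im (k t) = Im (k t0)" if "t \<in> ball t0 e" for t using that e(1) by force
  have k0: "k t0 = \<zeta>0" using g(4)[of \<zeta>0] g(1) flat(4) unfolding k_def by auto
  define x where "x t = Re (k t - \<zeta>0)" for t
  have kx: "k t = \<zeta>0 + of_real (x t)" if "t \<in> ball t0 e" for t
    using Imk[OF that] k0 by (auto simp: x_def complex_eq_iff)
  have k\<Psi>: "k t \<in> U" "\<delta> t = \<Psi> (k t)" "t \<in> J" if "t \<in> ball t0 e" for t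
  proof -
    obtain \<zeta> where "\<zeta> \<in> ball \<zeta>0 r" "\<delta> t = \<Psi> \<zeta>" "t \<in> J"
      using \<open>t \<in> ball t0 e\<close> e(2) unfolding V_def by blast
    then show "k t \<in> U" "\<delta> t = \<Psi> (k t)" "t \<in> J"
      using g(2) g(4)[of \<zeta>] unfolding k_def by auto
  qed
  show ?thesis
  proof
    obtain D where "(k has_vector_derivative D) (at t0)" using der \<open>t0 \<in> V\<close> by blast
    then have "isCont k t0" using has_vector_derivative_continuous by blast
    then show "isCont x t0" unfolding x_def isCont_def by (intro tendsto_intros)
    show "x t0 = 0" using k0 unfolding x_def by simp
    have "\<forall>\<^sub>F t in nhds t0. t \<in> ball t0 e" using e(1) by (intro eventually_nhds_in_open) auto
    then show "\<forall>\<^sub>F t in nhds t0. t \<in> J \<and> \<zeta>0 + of_real (x t) \<in> U \<and> \<delta> t = \<Psi> (\<zeta>0 + of_real (x t))"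
      by eventually_elim (use kx k\<Psi> in metis)
  qed
qed

text \<open>Maximality concerns the parametrised curve of unit speed, not its image: on a closed
  trajectory the curve goes round infinitely often and its domain is the whole line.\<close>

definition maximal_curve :: "real set \<Rightarrow> (real \<Rightarrow> 'a) \<Rightarrow> bool" where
  "maximal_curve I \<gamma> \<longleftrightarrow> open I \<and> connected I \<and> I \<noteq> {} \<and> (\<forall>t\<in>I. flat_along complex_of_real \<gamma> t) \<and>
     (\<forall>V g. open V \<longrightarrow> connected V \<longrightarrow> I \<subseteq> V \<longrightarrow> (\<forall>t\<in>V. flat_along complex_of_real g t) \<longrightarrow>
        (\<forall>t\<in>I. g t = \<gamma> t) \<longrightarrow> V = I)"

lemma maximal_curve_exists:
  assumes "open U0" "connected U0" "a \<in> U0" "\<And>t. t \<in> U0 \<Longrightarrow> flat_along complex_of_real f0 t"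
  obtains I \<gamma> where "maximal_curve I \<gamma>" "U0 \<subseteq> I" "\<And>t. t \<in> U0 \<Longrightarrow> \<gamma> t = f0 t"
proof -
  \<comment> \<open>The common point \<open>a\<close> keeps unions of these intervals
    connected.\<close>
  define \<U> where "\<U> = {U::real set. open U \<and> connected U \<and> a \<in> U}"
  have loc: "flat_along complex_of_real g t"
    if "\<forall>\<^sub>F s in nhds t. f s = g s" "flat_along complex_of_real f t" for f g t
    using flat_along_cong that by blast
  have op: "open U" if "U \<in> \<U>" for U using that unfolding \<U>_def by blast
  have un: "\<Union>\<C> \<in> \<U>" if "\<C> \<noteq> {}" "\<C> \<subseteq> \<U>" for \<C>
    using that unfolding \<U>_def by (auto intro!: connected_Union)
  have U0: "U0 \<in> \<U>" using assms unfolding \<U>_def by blast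
  show thesis
  proof (rule maximal_extension[of "flat_along complex_of_real" \<U> U0 f0])
    fix I \<gamma>
    assume I: "I \<in> \<U>" "U0 \<subseteq> I" "\<And>t. t \<in> I \<Longrightarrow> flat_along complex_of_real \<gamma> t" "\<And>t. t \<in> U0 \<Longrightarrow> \<gamma> t = f0 t"
      and max: "\<And>V g. \<lbrakk>V \<in> \<U>; I \<subseteq> V; \<And>t. t \<in> V \<Longrightarrow> flat_along complex_of_real g t; \<And>t. t \<in> I \<Longrightarrow> g t = \<gamma> t\<rbrakk> \<Longrightarrow> V = I"
    have "maximal_curve I \<gamma>"
      unfolding maximal_curve_def
    proof (intro conjI allI impI)
      show "open I" "connected I" "I \<noteq> {}" using I(1) unfolding \<U>_def by auto
      show "\<forall>t\<in>I. flat_along complex_of_real \<gamma> t" using I(3) by blast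
      fix V g
      assume V: "open V" "connected V" "I \<subseteq> V" "\<forall>t\<in>V. flat_along complex_of_real g t" "\<forall>t\<in>I. g t = \<gamma> t"
      then have "V \<in> \<U>" using I(1) unfolding \<U>_def by auto
      then show "V = I" by (rule max[of V g]) (use V in \<open>simp_all add: Ball_def\<close>)
    qed
    then show thesis using that I(2,4) by blast
  qed (fact loc op un U0 assms(4))+
qed

text \<open>The whole horizontal diameter of a flat disc centred on the curve belongs to the curve,
  since otherwise it could be glued on. The radius is not reduced, so a uniform lower bound for flat
  radii bounds the possible extension from below.\<close>

lemma maximal_curve_extend:
  assumes max: "maximal_curve I \<gamma>" and u: "u \<in> I"
    and \<Psi>: "0 < r" "\<And>\<zeta>. \<zeta> \<in> ball 0 r \<Longrightarrow> flat_at \<Psi> \<zeta>" "\<Psi> 0 = \<gamma> u"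
  obtains \<sigma> where "\<sigma> \<in> {1, -1::real}" "\<And>s. \<bar>s\<bar> < r \<Longrightarrow> u + s \<in> I \<and> \<gamma> (u + s) = \<Psi> (of_real (\<sigma> * s))"
proof -
  have I: "open I" "connected I" "\<And>t. t \<in> I \<Longrightarrow> flat_along complex_of_real \<gamma> t"
    using max unfolding maximal_curve_def by auto
  obtain r' \<Psi>' where r': "0 < r'" "\<And>\<zeta>. \<zeta> \<in> ball 0 r' \<Longrightarrow> flat_at \<Psi>' \<zeta>" "\<And>s. norm s < r' \<Longrightarrow> \<gamma> (u + s) = \<Psi>' (of_real s)"
    using I(3)[OF u] unfolding flat_along_def by blast
  have eq: "\<Psi> 0 = \<Psi>' 0" using \<Psi>(3) r'(1) r'(3)[of 0] by simp
  obtain r2 \<sigma> where r2: "0 < r2" "\<sigma> \<in> {1, -1::real}" "ball 0 r2 \<subseteq> ball (0::complex) r'"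
    "\<And>w. norm w < r2 \<Longrightarrow> \<Psi>' (0 + w) = \<Psi> (0 + of_real \<sigma> * w)"
    using flat_transition[OF open_ball \<Psi>(2) _ open_ball r'(2) _ eq] r'(1) \<Psi>(1) by (metis centre_in_ball)
  define V where "V = ball u r"
  define \<Phi> where "\<Phi> z = \<Psi> (of_real \<sigma> * z + 0)" for z
  define g where "g t = \<Phi> (of_real t + - of_real u)" for t
  have \<Phi>: "flat_at \<Phi> \<zeta>" if "\<zeta> \<in> ball 0 r" for \<zeta>
    unfolding \<Phi>_def using that r2(2) by (intro flat_at_affine \<Psi>(2)) auto
  have fg: "flat_along complex_of_real g t" if "t \<in> V" for t
    unfolding g_def
  proof (rule flat_along_I[OF open_ball \<Phi> linear_isometry_of_real])
    show "complex_of_real t + - complex_of_real u \<in> ball 0 r"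
      using that unfolding V_def by (auto simp: dist_norm norm_minus_commute simp flip: of_real_diff)
  qed
  have agree: "\<gamma> t = g t" if "t \<in> I" "t \<in> V" for t
  proof (rule flat_along_identity[of "I \<inter> V" complex_of_real \<gamma> g u])
    show "connected (I \<inter> V)"
      using I(2) is_interval_connected_1 is_interval_Int connected_ball unfolding V_def by metis
    show "open (I \<inter> V)" unfolding V_def using I(1) by blast
    show "u \<in> I \<inter> V" using u \<Psi>(1) unfolding V_def by simp
    show "t \<in> I \<inter> V" using that by simp
    have "ball u r2 \<subseteq> {s. \<gamma> s = g s}"
    proof
      fix s assume "s \<in> ball u r2"
      then have "\<bar>s - u\<bar> < r2" by (simp add: dist_real_def)
      moreover have "r2 \<le> r'" using r2(1,3) by (auto simp: ball_subset_ball_iff)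
      ultimately show "s \<in> {s. \<gamma> s = g s}"
        using r'(3)[of "s - u"] r2(4)[of "of_real (s - u)"]
        by (simp add: g_def \<Phi>_def del: of_real_diff) (simp add: algebra_simps)
    qed
    then show "u islimpt {s. \<gamma> s = g s}"
      by (rule islimpt_subset[OF interior_limit_point, rotated]) (use r2(1) in auto)
  qed (use I(3) fg in auto)
  have "I \<union> V = I"
  proof -
    have "open (I \<union> V)" "connected (I \<union> V)"
      using I(1,2) u \<Psi>(1) unfolding V_def by (auto intro!: connected_Un)
    moreover have "flat_along complex_of_real (\<lambda>t. if t \<in> I then \<gamma> t else g t) t" if "t \<in> I \<union> V" for t
      using I(1,3) fg agree that by (intro flat_along_glue[of I V]) (auto simp: V_def)
    moreover have "\<forall>t\<in>I. (if t \<in> I then \<gamma> t else g t) = \<gamma> t" by simp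
    ultimately show ?thesis
      using max unfolding maximal_curve_def by blast
  qed
  show ?thesis
  proof (rule that[OF r2(2)])
    fix s :: real assume "\<bar>s\<bar> < r"
    then have "u + s \<in> V" unfolding V_def by (simp add: dist_real_def)
    then show "u + s \<in> I \<and> \<gamma> (u + s) = \<Psi> (of_real (\<sigma> * s))"
      using \<open>I \<union> V = I\<close> agree[of "u + s"] by (auto simp: g_def \<Phi>_def)
  qed
qed

text \<open>Lying on the maximal curve is a locally constant property along \<open>\<delta>\<close>:
  a short piece of \<open>\<delta>\<close> lies on a horizontal diameter of a flat disc, and a
  maximal curve that meets this piece anywhere contains all of it.\<close>

lemma maximal_curve_contains:
  assumes max: "maximal_curve I \<gamma>" and geo: "horizontal_geodesic A q J \<delta>"
    and t0: "t0 \<in> J" "\<delta> t0 \<in> \<gamma> ` I"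
  shows "\<delta> ` J \<subseteq> \<gamma> ` I"
proof
  fix y assume "y \<in> \<delta> ` J"
  then obtain t1 where t1: "t1 \<in> J" "y = \<delta> t1" by auto
  have J: "connected J" using geo unfolding horizontal_geodesic_def by (simp add: is_interval_connected_1)
  have "\<delta> t1 \<in> \<gamma> ` I"
  proof (rule connected_induction_simple[of J t0 t1 "\<lambda>t. \<delta> t \<in> \<gamma> ` I"])
    fix t assume t: "t \<in> J"
    obtain r \<Psi> where r: "0 < r" "\<And>\<zeta>. \<zeta> \<in> ball 0 r \<Longrightarrow> flat_at \<Psi> \<zeta>" "\<Psi> 0 = \<delta> t"
      using flat_exists[OF horizontal_geodesic_regular[OF geo t]] by metis
    have "0 \<in> ball (0::complex) r" using r(1) by simp
    then obtain x where x: "isCont x t" "x t = 0"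
      "\<forall>\<^sub>F s in nhds t. s \<in> J \<and> 0 + complex_of_real (x s) \<in> ball 0 r \<and> \<delta> s = \<Psi> (0 + of_real (x s))"
      using horizontal_geodesic_flat[OF geo t open_ball r(2) _ r(3)] by blast
    have "\<forall>\<^sub>F s in nhds t. x s \<in> {- r/4<..<r/4}"
      using x(1,2) r(1) by (intro isCont_eventually_in) auto
    with x(3) have "\<forall>\<^sub>F s in nhds t. s \<in> J \<and> \<bar>x s\<bar> < r/4 \<and> \<delta> s = \<Psi> (of_real (x s))"
      by eventually_elim auto
    then obtain T where T: "open T" "t \<in> T" "\<And>s. s \<in> T \<Longrightarrow> s \<in> J \<and> \<bar>x s\<bar> < r/4 \<and> \<delta> s = \<Psi> (of_real (x s))"
      unfolding eventually_nhds by blast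
 have step: "\<delta> s' \<in> \<gamma> ` I" if s: "s \<in> T" "s' \<in> T" "\<delta> s \<in> \<gamma> ` I" for s s'
    proof -
      obtain u where u: "u \<in> I" "\<delta> s = \<gamma> u" using s by auto
      \<comment> \<open>Recentring at a point less than \<open>r/4\<close> from the centre leaves
        the flat radius \<open>r/2\<close>, and any two points of the piece are less than
        \<open>r/2\<close> apart.\<close>
      define \<Phi> where "\<Phi> z = \<Psi> (1 * z + of_real (x s))" for z
      have "flat_at \<Phi> \<zeta>" if "\<zeta> \<in> ball 0 (r/2)" for \<zeta>
        unfolding \<Phi>_def
      proof (intro flat_at_affine r(2))
        have "norm (\<zeta> + of_real (x s)) \<le> norm \<zeta> + norm (complex_of_real (x s))" by (rule norm_triangle_ineq)
        then show "1 * \<zeta> + of_real (x s) \<in> ball 0 r" using that T(3)[OF s(1)] by auto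
      qed auto
      moreover have "\<Phi> 0 = \<gamma> u" using u T(3)[OF s(1)] unfolding \<Phi>_def by simp
      ultimately obtain \<sigma> where \<sigma>: "\<sigma> \<in> {1, -1::real}"
        "\<And>w. \<bar>w\<bar> < r/2 \<Longrightarrow> u + w \<in> I \<and> \<gamma> (u + w) = \<Phi> (of_real (\<sigma> * w))"
        using maximal_curve_extend[OF max u(1), of "r/2" \<Phi>] r(1) by auto
      let ?w = "\<sigma> * (x s' - x s)"
      have "\<bar>?w\<bar> < r/2" using \<sigma>(1) T(3)[OF s(1)] T(3)[OF s(2)] by (auto simp: abs_if split: if_splits)
      then have "u + ?w \<in> I" "\<gamma> (u + ?w) = \<Phi> (of_real (\<sigma> * ?w))" using \<sigma>(2) by blast+
      moreover have "\<sigma> * ?w = x s' - x s" using \<sigma>(1) by auto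
      ultimately show ?thesis
        using T(3)[OF s(2)] by (intro image_eqI[of _ _ "u + ?w"]) (auto simp: \<Phi>_def)
    qed
    show "\<exists>T. openin (top_of_set J) T \<and> t \<in> T \<and> (\<forall>x\<in>T. \<forall>y\<in>T. \<delta> x \<in> \<gamma> ` I \<longrightarrow> \<delta> y \<in> \<gamma> ` I)"
    proof (intro exI[of _ "J \<inter> T"] conjI)
      show "openin (top_of_set J) (J \<inter> T)" using T(1) by (rule openin_open_Int)
      show "t \<in> J \<inter> T" using T(2) t by blast
      show "\<forall>x\<in>J \<inter> T. \<forall>y\<in>J \<inter> T. \<delta> x \<in> \<gamma> ` I \<longrightarrow> \<delta> y \<in> \<gamma> ` I" using step by blast
    qed
  qed (use J t0 t1 in auto)
  then show "y \<in> \<gamma> ` I" using t1 by simp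
qed

lemma maximal_curve_geodesic:
  assumes "maximal_curve I \<gamma>"
  shows "horizontal_geodesic A q I \<gamma>"
proof (rule horizontal_geodesicI)
  show "open I" "is_interval I" "I \<noteq> {}"
    using assms unfolding maximal_curve_def is_interval_connected_1 by blast+
  show "flat_along complex_of_real \<gamma> t" if "t \<in> I" for t
    using assms that unfolding maximal_curve_def by blast
qed

text \<open>A geodesic whose image contains that of the curve meets it, and is therefore contained
  in it.\<close>

lemma maximal_curve_trajectory:
  assumes "maximal_curve I \<gamma>"
  shows "trajectory A q (\<gamma> ` I)"
  unfolding trajectory_def
proof (intro conjI allI impI)
  show "\<exists>J \<delta>. horizontal_geodesic A q J \<delta> \<and> \<gamma> ` I = \<delta> ` J"
    using maximal_curve_geodesic[OF assms] by blast
  fix J \<delta> assume J: "horizontal_geodesic A q J \<delta> \<and> \<gamma> ` I \<subseteq> \<delta> ` J"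
  obtain s where "s \<in> I" using assms unfolding maximal_curve_def by auto
  with J obtain t where "t \<in> J" "\<delta> t = \<gamma> s" by (metis imageE imageI subsetD)
  with J \<open>s \<in> I\<close> show "\<delta> ` J = \<gamma> ` I" using maximal_curve_contains[OF assms] by blast
qed

lemma trajectory_eq_maximal_curve:
  assumes "maximal_curve I \<gamma>" "trajectory A q T" "T \<inter> \<gamma> ` I \<noteq> {}"
  shows "T = \<gamma> ` I"
proof -
  obtain J \<delta> where J: "horizontal_geodesic A q J \<delta>" "T = \<delta> ` J"
    using assms(2) unfolding trajectory_def by blast
  then have "T \<subseteq> \<gamma> ` I" using maximal_curve_contains[OF assms(1)] assms(3) by blast
  then show ?thesis using assms(2) maximal_curve_geodesic[OF assms(1)] unfolding trajectory_def by blast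
qed

lemma maximal_curve_at:
  assumes "regular x"
  obtains I \<gamma> where "maximal_curve I \<gamma>" "0 \<in> I" "\<gamma> 0 = x"
proof -
  obtain r \<Psi> where r: "0 < r" "\<And>\<zeta>. \<zeta> \<in> ball 0 r \<Longrightarrow> flat_at \<Psi> \<zeta>" "\<Psi> 0 = x"
    using flat_exists[OF assms] by metis
  have "flat_along complex_of_real (\<lambda>t. \<Psi> (of_real t + 0)) t" if "t \<in> ball 0 r" for t
    using that by (intro flat_along_I[of "ball 0 r"] r(2)) auto
  moreover have "0 \<in> ball (0::real) r" using r(1) by simp
  ultimately obtain I \<gamma> where I: "maximal_curve I \<gamma>" "ball 0 r \<subseteq> I" "\<And>t. t \<in> ball 0 r \<Longrightarrow> \<gamma> t = \<Psi> (of_real t + 0)"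
    using maximal_curve_exists[OF open_ball connected_ball, of 0 0 r "\<lambda>t. \<Psi> (of_real t + 0)"] by blast
  show ?thesis
    by (rule that[OF I(1)]) (use I(2,3) r(1,3) in auto)
qed

lemma regular_trajectory:
  assumes "trajectory A q T" "x \<in> T"
  shows "regular x"
  using assms horizontal_geodesic_regular unfolding trajectory_def by blast

text \<open>Any trajectory through \<open>x\<close> is the image of the maximal curve started at
  \<open>x\<close>.\<close>

lemma trajectories_eq:
  assumes "trajectory A q T" "trajectory A q T'" "x \<in> T" "x \<in> T'"
  shows "T = T'"
proof -
  obtain I \<gamma> where "maximal_curve I \<gamma>" "0 \<in> I" "\<gamma> 0 = x"
    using maximal_curve_at[OF regular_trajectory[OF assms(1,3)]] .
  then show ?thesis using trajectory_eq_maximal_curve assms by blast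
qed

end

subsection \<open>Cylinders of closed trajectories\<close>

text \<open>Rigidity asks only for accumulation, so agreement along a real segment already
  determines a flat map of a complex variable.\<close>

lemma islimpt_real_agree:
  fixes f g :: "complex \<Rightarrow> 'd"
  assumes "0 < e" "\<And>u::real. \<bar>u\<bar> < e \<Longrightarrow> f (of_real u) = g (of_real u)"
  shows "0 islimpt {z. f z = g z}"
  unfolding islimpt_approachable
proof (intro allI impI)
  fix d :: real assume "0 < d"
  then have "complex_of_real (min d e / 2) \<in> {z. f z = g z}"
    using assms(1) by (intro CollectI assms(2)) auto
  then show "\<exists>x'\<in>{z. f z = g z}. x' \<noteq> 0 \<and> dist x' 0 < d"
    using assms(1) \<open>0 < d\<close> by (intro bexI[of _ "complex_of_real (min d e / 2)"]) auto
qed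

lemma strip_open: "open J \<Longrightarrow> open (Im -` J)"
  by (intro open_vimage continuous_intros)

lemma strip_convex: "connected J \<Longrightarrow> convex (Im -` J)"
  by (intro convex_linear_vimage bounded_linear.linear[OF bounded_linear_Im]) (simp add: flip: connected_convex_1)

context quadratic_differential
begin

lemma flat_along_idI:
  assumes "open U" "\<And>\<zeta>. \<zeta> \<in> U \<Longrightarrow> flat_at \<Psi> \<zeta>" "\<zeta> \<in> U"
  shows "flat_along (\<lambda>z. z) \<Psi> \<zeta>"
  using flat_along_I[OF assms(1,2) linear_isometry_id, of \<zeta> 0] assms(3) by simp

lemma flat_identity:
  assumes "open S" "connected S" "\<And>\<zeta>. \<zeta> \<in> S \<Longrightarrow> flat_at \<Psi>1 \<zeta>" "\<And>\<zeta>. \<zeta> \<in> S \<Longrightarrow> flat_at \<Psi>2 \<zeta>"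
    and "\<zeta>0 \<in> S" "\<zeta>0 islimpt {\<zeta>. \<Psi>1 \<zeta> = \<Psi>2 \<zeta>}" "\<zeta> \<in> S"
  shows "\<Psi>1 \<zeta> = \<Psi>2 \<zeta>"
  by (rule flat_along_identity[of S "\<lambda>z. z" \<Psi>1 \<Psi>2 \<zeta>0]) (use assms flat_along_idI[of S] in auto)

lemma flat_open_map:
  assumes "open U" "\<And>\<zeta>. \<zeta> \<in> U \<Longrightarrow> flat_at \<Psi> \<zeta>"
  shows "open (\<Psi> ` U)"
proof (subst open_subopen, intro ballI)
  fix x assume "x \<in> \<Psi> ` U"
  then obtain \<zeta> where \<zeta>: "\<zeta> \<in> U" "x = \<Psi> \<zeta>" by auto
  obtain r where "0 < r" "ball \<zeta> r \<subseteq> U" "open (\<Psi> ` ball \<zeta> r)"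
    using flat_locally_inj[OF assms \<zeta>(1)] by metis
  then show "\<exists>T. open T \<and> x \<in> T \<and> T \<subseteq> \<Psi> ` U"
    using \<zeta> by (intro exI[of _ "\<Psi> ` ball \<zeta> r"]) auto
qed

lemma flat_exists_in:
  assumes "regular x" "open D" "x \<in> D"
  obtains r \<Psi> where "0 < r" "\<And>\<zeta>. \<zeta> \<in> ball 0 r \<Longrightarrow> flat_at \<Psi> \<zeta>" "\<Psi> 0 = x" "\<Psi> ` ball 0 r \<subseteq> D"
proof -
  obtain r \<Psi> where r: "0 < r" "\<And>\<zeta>. \<zeta> \<in> ball 0 r \<Longrightarrow> flat_at \<Psi> \<zeta>" "\<Psi> 0 = x"
    using flat_exists[OF assms(1)] by metis
  then have "isCont \<Psi> 0" unfolding flat_at_def by auto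
  then have "\<forall>\<^sub>F \<zeta> in nhds 0. \<Psi> \<zeta> \<in> D" using assms r(3) by (intro isCont_eventually_in) auto
  then obtain e where e: "0 < e" "\<And>\<zeta>. dist \<zeta> 0 < e \<Longrightarrow> \<Psi> \<zeta> \<in> D" unfolding eventually_nhds_metric by blast
  show ?thesis by (rule that[of "min r e" \<Psi>]) (use r e in auto)
qed

text \<open>A Lebesgue number argument: finitely many flat discs of half the radius cover
  \<open>T\<close>, and around a point in the inner half of a disc there is still a flat disc of
  half its radius.\<close>

lemma uniform_flat_radius:
  assumes "compact T" "open D" "T \<subseteq> D" "\<And>x. x \<in> T \<Longrightarrow> regular x"
  obtains r where "0 < r" "\<And>x. x \<in> T \<Longrightarrow> \<exists>\<Psi>. (\<forall>\<zeta>\<in>ball 0 r. flat_at \<Psi> \<zeta>) \<and> \<Psi> 0 = x \<and> \<Psi> ` ball 0 r \<subseteq> D"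
proof -
  have "\<forall>x\<in>T. \<exists>r \<Psi>. 0 < r \<and> (\<forall>\<zeta>\<in>ball 0 r. flat_at \<Psi> \<zeta>) \<and> \<Psi> 0 = x \<and> \<Psi> ` ball 0 r \<subseteq> D"
  proof
    fix x assume "x \<in> T"
    then obtain r \<Psi> where "0 < r" "\<And>\<zeta>. \<zeta> \<in> ball 0 r \<Longrightarrow> flat_at \<Psi> \<zeta>" "\<Psi> 0 = x" "\<Psi> ` ball 0 r \<subseteq> D"
      using flat_exists_in[of x D] assms(2-4) by (metis subsetD)
    then show "\<exists>r \<Psi>. 0 < r \<and> (\<forall>\<zeta>\<in>ball 0 r. flat_at \<Psi> \<zeta>) \<and> \<Psi> 0 = x \<and> \<Psi> ` ball 0 r \<subseteq> D" by blast
  qed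
  then obtain R \<Psi> where R: "\<And>x. x \<in> T \<Longrightarrow> 0 < R x" "\<And>x \<zeta>. x \<in> T \<Longrightarrow> \<zeta> \<in> ball 0 (R x) \<Longrightarrow> flat_at (\<Psi> x) \<zeta>"
    "\<And>x. x \<in> T \<Longrightarrow> \<Psi> x 0 = x" "\<And>x. x \<in> T \<Longrightarrow> \<Psi> x ` ball 0 (R x) \<subseteq> D" by metis
  have "open (\<Psi> x ` ball 0 (R x / 2))" if "x \<in> T" for x
    using that R(1)[OF that] by (intro flat_open_map R(2)) auto
  moreover have "T \<subseteq> (\<Union>x\<in>T. \<Psi> x ` ball 0 (R x / 2))"
  proof
    fix x assume "x \<in> T"
    then have "x \<in> \<Psi> x ` ball 0 (R x / 2)" using R(1,3)[OF \<open>x \<in> T\<close>] by (intro image_eqI[of _ _ 0]) auto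
    then show "x \<in> (\<Union>x\<in>T. \<Psi> x ` ball 0 (R x / 2))" using \<open>x \<in> T\<close> by blast
  qed
  ultimately obtain C where C: "C \<subseteq> T" "finite C" "T \<subseteq> (\<Union>x\<in>C. \<Psi> x ` ball 0 (R x / 2))"
    using compactE_image[OF assms(1), of T "\<lambda>x. \<Psi> x ` ball 0 (R x / 2)"] by blast
  \<comment> \<open>The 1 keeps the minimum meaningful if \<open>C\<close> is empty.\<close>
  define r where "r = Min (insert 1 ((\<lambda>x. R x / 2) ` C))"
  show ?thesis
  proof
    show "0 < r" unfolding r_def using C R(1) by (subst Min_gr_iff) auto
    fix x assume "x \<in> T"
    then obtain y z where y: "y \<in> C" "z \<in> ball 0 (R y / 2)" "x = \<Psi> y z" using C(3) by blast
    have yT: "y \<in> T" using y(1) C(1) by blast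
    have r: "r \<le> R y / 2" unfolding r_def using y(1) C(2) by (intro Min_le) auto
    have in_ball: "1 * \<zeta> + z \<in> ball 0 (R y)" if "\<zeta> \<in> ball 0 r" for \<zeta>
    proof -
      have "norm (\<zeta> + z) \<le> norm \<zeta> + norm z" by (rule norm_triangle_ineq)
      then show ?thesis using that y(2) r by auto
    qed
    show "\<exists>\<Psi>. (\<forall>\<zeta>\<in>ball 0 r. flat_at \<Psi> \<zeta>) \<and> \<Psi> 0 = x \<and> \<Psi> ` ball 0 r \<subseteq> D"
    proof (intro exI[of _ "\<lambda>\<zeta>. \<Psi> y (1 * \<zeta> + z)"] conjI ballI)
      show "flat_at (\<lambda>\<zeta>. \<Psi> y (1 * \<zeta> + z)) \<zeta>" if "\<zeta> \<in> ball 0 r" for \<zeta>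
        using in_ball[OF that] by (intro flat_at_affine R(2) yT) auto
      show "(\<lambda>\<zeta>. \<Psi> y (1 * \<zeta> + z)) ` ball 0 r \<subseteq> D"
        using in_ball R(4)[OF yT] by blast
    qed (use y in simp)
  qed
qed

text \<open>On a compact image the flat radius is bounded below, so \<open>I\<close> contains a ball
  of fixed radius about each of its points and is closed as well as open.\<close>

lemma maximal_curve_compact:
  assumes max: "maximal_curve I \<gamma>" and "compact (\<gamma> ` I)"
  shows "I = UNIV"
proof -
  obtain r where r: "0 < r" "\<And>x. x \<in> \<gamma> ` I \<Longrightarrow> \<exists>\<Psi>. (\<forall>\<zeta>\<in>ball 0 r. flat_at \<Psi> \<zeta>) \<and> \<Psi> 0 = x \<and> \<Psi> ` ball 0 r \<subseteq> UNIV"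
    using uniform_flat_radius[OF assms(2) open_UNIV] regular_trajectory[OF maximal_curve_trajectory[OF max]] by blast
  have step: "ball u r \<subseteq> I" if "u \<in> I" for u
  proof -
    obtain \<Psi> where "\<And>\<zeta>. \<zeta> \<in> ball 0 r \<Longrightarrow> flat_at \<Psi> \<zeta>" "\<Psi> 0 = \<gamma> u"
      using r(2)[of "\<gamma> u"] \<open>u \<in> I\<close> by blast
    then obtain \<sigma> :: real where \<sigma>: "\<And>s. \<bar>s\<bar> < r \<Longrightarrow> u + s \<in> I \<and> \<gamma> (u + s) = \<Psi> (of_real (\<sigma> * s))"
      using maximal_curve_extend[OF max \<open>u \<in> I\<close> r(1)] by metis
    show ?thesis
    proof
      fix t assume "t \<in> ball u r"
      then have "\<bar>t - u\<bar> < r" by (simp add: dist_real_def)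
      then show "t \<in> I" using \<sigma>[of "t - u"] by simp
    qed
  qed
  have "closed I"
    unfolding closed_limpt
  proof (intro allI impI)
    fix t assume "t islimpt I"
    then obtain u where "u \<in> I" "dist u t < r" using r(1) unfolding islimpt_approachable by blast
    then show "t \<in> I" using step[of u] by auto
  qed
  then show ?thesis using max clopen[of I] unfolding maximal_curve_def by blast
qed

lemma flat_along_locally_inj:
  assumes "flat_along \<iota> f t" "linear_isometry \<iota>"
  obtains r where "0 < r" "inj_on f (ball t r)"
proof -
  obtain r \<Psi> where r: "0 < r" "\<And>\<zeta>. \<zeta> \<in> ball 0 r \<Longrightarrow> flat_at \<Psi> \<zeta>" "\<And>u. norm u < r \<Longrightarrow> f (t + u) = \<Psi> (\<iota> u)"
    using assms(1) unfolding flat_along_def by blast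
  have "0 \<in> ball (0::complex) r" using r(1) by simp
  then obtain e where e: "0 < e" "inj_on \<Psi> (ball 0 e)" using flat_locally_inj[OF open_ball r(2)] by metis
  have \<iota>: "linear \<iota>" "\<And>u. norm (\<iota> u) = norm u" using assms(2) unfolding linear_isometry_def by auto
  show ?thesis
  proof
    show "0 < min r e" using r e by simp
    show "inj_on f (ball t (min r e))"
    proof (rule inj_onI)
      fix x y assume x: "x \<in> ball t (min r e)" and y: "y \<in> ball t (min r e)" and eq: "f x = f y"
      have n: "norm (x - t) < min r e" "norm (y - t) < min r e"
        using x y by (auto simp: dist_norm norm_minus_commute)
      then have "\<Psi> (\<iota> (x - t)) = \<Psi> (\<iota> (y - t))"
        using eq r(3)[of "x - t"] r(3)[of "y - t"] by simp
      then have "\<iota> (x - t) = \<iota> (y - t)"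
        by (rule inj_onD[OF e(2)]) (use n \<iota>(2) in auto)
      then have "\<iota> (x - y) = 0" using \<iota>(1) by (simp add: linear_diff)
      then show "x = y" using \<iota>(2)[of "x - y"] by simp
    qed
  qed
qed

text \<open>
  If the maximal curve were injective, it would lift a parametrisation of the trajectory by a
  compact interval to a continuous surjection onto the real line.
\<close>

lemma closed_trajectory_periodic:
  assumes "closed_trajectory A q T" "x \<in> T"
  obtains \<gamma> \<l> where "maximal_curve UNIV \<gamma>" "0 < \<l>" "\<gamma> 0 = x" "\<And>t. \<gamma> (t + \<l>) = \<gamma> t" "range \<gamma> = T" "compact T"
proof -
  obtain I' \<delta> a b where \<delta>: "horizontal_geodesic A q I' \<delta>" "{a..b} \<subseteq> I'" "T = \<delta> ` {a..b}" and T: "trajectory A q T"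
    using assms unfolding closed_trajectory_def by blast
  have "continuous_on {a..b} \<delta>" using \<delta>(1,2) unfolding horizontal_geodesic_def by (blast intro: continuous_on_subset)
  then have cT: "compact T" unfolding \<delta>(3) by (intro compact_continuous_image) auto
  obtain I \<gamma> where \<gamma>: "maximal_curve I \<gamma>" "0 \<in> I" "\<gamma> 0 = x"
    using maximal_curve_at[OF regular_trajectory[OF T assms(2)]] .
  have eT: "T = \<gamma> ` I" using trajectory_eq_maximal_curve[OF \<gamma>(1) T] \<gamma>(2,3) assms(2) by blast
  have "I = UNIV" using maximal_curve_compact[OF \<gamma>(1)] cT eT by simp
  note \<gamma> = \<gamma>[unfolded this] and eT = eT[unfolded this]
  have fl: "flat_along complex_of_real \<gamma> t" for t using \<gamma>(1) unfolding maximal_curve_def by blast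
  have "\<not> inj \<gamma>"
  proof
    assume inj: "inj \<gamma>"
    define s where "s = inv \<gamma> \<circ> \<delta>"
    \<comment> \<open>Near \<open>t\<close> the geodesic moves along the maximal curve by the
      continuous amount \<open>y\<close>; by injectivity \<open>s\<close> equals
      \<open>u + y\<close> there.\<close>
    have "isCont s t" if t: "t \<in> {a..b}" for t
    proof -
      obtain u where u: "\<delta> t = \<gamma> u" using t eT \<delta>(3) by blast
      obtain r \<Psi> where r: "0 < r" "\<And>\<zeta>. \<zeta> \<in> ball 0 r \<Longrightarrow> flat_at \<Psi> \<zeta>" "\<And>w. norm w < r \<Longrightarrow> \<gamma> (u + w) = \<Psi> (of_real w)"
        using fl[of u] unfolding flat_along_def by blast
      have *: "t \<in> I'" "0 \<in> ball (0::complex) r" "\<Psi> 0 = \<delta> t" using r(1) r(3)[of 0] t \<delta>(2) u by auto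
      obtain y where y: "isCont y t" "\<forall>\<^sub>F s in nhds t. s \<in> I' \<and> 0 + complex_of_real (y s) \<in> ball 0 r \<and> \<delta> s = \<Psi> (0 + of_real (y s))"
        using horizontal_geodesic_flat[OF \<delta>(1) *(1) open_ball r(2) *(2,3)] by blast
      have "\<forall>\<^sub>F t in nhds t. u + y t = s t"
        using y(2)
      proof eventually_elim
        case (elim t)
        then have "\<delta> t = \<gamma> (u + y t)" using r(3)[of "y t"] by simp
        then show ?case unfolding s_def using inj by simp
      qed
      moreover have "isCont (\<lambda>t. u + y t) t" using y(1) by (intro continuous_intros)
      ultimately show ?thesis by (subst (asm) isCont_cong)
    qed
    then have "compact (s ` {a..b})"
      by (intro compact_continuous_image continuous_at_imp_continuous_on) auto
    moreover have "s ` {a..b} = UNIV"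
    proof (intro equalityI subsetI)
      fix u :: real
      obtain t where "t \<in> {a..b}" "\<gamma> u = \<delta> t" using eT \<delta>(3) by blast
      then show "u \<in> s ` {a..b}" unfolding s_def using inj by (intro image_eqI[of _ _ t]) (auto simp flip: \<open>\<gamma> u = \<delta> t\<close>)
    qed auto
    ultimately show False using compact_imp_bounded not_bounded_UNIV by metis
  qed
  then obtain s1 s2 where s: "s1 < s2" "\<gamma> s1 = \<gamma> s2" unfolding inj_def by (metis linorder_neqE)
  obtain r1 \<Psi>1 where r1: "0 < r1" "\<And>\<zeta>. \<zeta> \<in> ball 0 r1 \<Longrightarrow> flat_at \<Psi>1 \<zeta>" "\<And>w. norm w < r1 \<Longrightarrow> \<gamma> (s1 + w) = \<Psi>1 (of_real w)"
    using fl[of s1] unfolding flat_along_def by blast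
  have b0: "0 \<in> ball (0::complex) r1" using r1(1) by simp
  have "\<Psi>1 0 = \<gamma> s2" using s(2) r1(3)[of 0] r1(1) by simp
  then obtain \<sigma> where \<sigma>: "\<sigma> \<in> {1, -1::real}" "\<And>w. \<bar>w\<bar> < r1 \<Longrightarrow> \<gamma> (s2 + w) = \<Psi>1 (of_real (\<sigma> * w))"
    using maximal_curve_extend[OF \<gamma>(1) UNIV_I r1(1,2), of s2] by metis
  have loc: "\<gamma> (s2 + w) = \<gamma> (s1 + \<sigma> * w)" if "\<bar>w\<bar> < r1" for w
    using \<sigma>(2)[OF that] r1(3)[of "\<sigma> * w"] \<sigma>(1) that by auto
  \<comment> \<open>Two parameters of one point yield a symmetry of the curve, a translation or a
    reflection of the line, first near \<open>s2\<close> and by rigidity everywhere.\<close>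
  have glob: "\<gamma> (\<sigma> *\<^sub>R t + (s1 - \<sigma> * s2)) = \<gamma> t" for t
  proof (rule flat_along_identity[of UNIV complex_of_real])
    show "flat_along complex_of_real (\<lambda>t. \<gamma> (\<sigma> *\<^sub>R t + (s1 - \<sigma> * s2))) t" for t
      using fl \<sigma>(1) by (intro flat_along_affine) auto
    have "ball s2 r1 \<subseteq> {s. \<gamma> (\<sigma> *\<^sub>R s + (s1 - \<sigma> * s2)) = \<gamma> s}"
    proof
      fix t assume "t \<in> ball s2 r1"
      then show "t \<in> {s. \<gamma> (\<sigma> *\<^sub>R s + (s1 - \<sigma> * s2)) = \<gamma> s}"
        using loc[of "t - s2"] by (simp add: dist_real_def abs_minus_commute algebra_simps)
    qed
    then show "s2 islimpt {s. \<gamma> (\<sigma> *\<^sub>R s + (s1 - \<sigma> * s2)) = \<gamma> s}"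
      by (rule islimpt_subset[OF interior_limit_point, rotated]) (use r1(1) in auto)
  qed (use fl in auto)
  \<comment> \<open>A reflection would fix the midpoint \<open>m\<close>, and the curve would fold
    back on itself there.\<close>
  have "\<sigma> = 1"
  proof (rule ccontr)
    assume "\<sigma> \<noteq> 1"
    then have "\<sigma> = -1" using \<sigma>(1) by auto
    define m where "m = (s1 + s2) / 2"
    obtain r where r: "0 < r" "inj_on \<gamma> (ball m r)" using flat_along_locally_inj[OF fl] by auto
    have "\<gamma> (m + r/2) = \<gamma> (m - r/2)"
    proof -
      have "\<sigma> *\<^sub>R (m - r/2) + (s1 - \<sigma> * s2) = m + r/2"
        unfolding \<open>\<sigma> = -1\<close> m_def by (simp add: field_simps)
      then show ?thesis using glob[of "m - r/2"] by simp
    qed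
    then have "m + r/2 = m - r/2" by (rule inj_onD[OF r(2)]) (use r(1) in \<open>auto simp: dist_real_def\<close>)
    then show False using r(1) by simp
  qed
  show ?thesis
  proof (rule that[OF \<gamma>(1) _ \<gamma>(3) _ eT[symmetric] cT])
    show "0 < s2 - s1" using s by simp
    show "\<gamma> (t + (s2 - s1)) = \<gamma> t" for t
      using glob[of "t + (s2 - s1)"] unfolding \<open>\<sigma> = 1\<close> by simp
  qed
qed

text \<open>Flat discs of a common radius centred on the trajectory, all oriented by
  \<open>\<gamma>\<close>, fit together: overlapping ones agree on a real segment and hence
  throughout the overlap. Periodicity passes from the real axis to the strip in the same
  way.\<close>

lemma annulus:
  assumes max: "maximal_curve UNIV \<gamma>" and per: "\<And>t. \<gamma> (t + \<l>) = \<gamma> t"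
    and D: "compact (range \<gamma>)" "range \<gamma> \<subseteq> D" "open D"
  obtains \<epsilon> \<Phi> where "0 < \<epsilon>" "\<And>\<zeta>. \<bar>Im \<zeta>\<bar> < \<epsilon> \<Longrightarrow> flat_at \<Phi> \<zeta>" "\<And>\<zeta>. \<bar>Im \<zeta>\<bar> < \<epsilon> \<Longrightarrow> \<Phi> \<zeta> \<in> D"
    "\<And>s. \<Phi> (of_real s) = \<gamma> s" "\<And>\<zeta>. \<bar>Im \<zeta>\<bar> < \<epsilon> \<Longrightarrow> \<Phi> (\<zeta> + of_real \<l>) = \<Phi> \<zeta>"
proof -
  have "regular x" if "x \<in> range \<gamma>" for x
    using regular_trajectory[OF maximal_curve_trajectory[OF max] that] .
  then obtain r where r: "0 < r" "\<And>x. x \<in> range \<gamma> \<Longrightarrow> \<exists>\<Psi>. (\<forall>\<zeta>\<in>ball 0 r. flat_at \<Psi> \<zeta>) \<and> \<Psi> 0 = x \<and> \<Psi> ` ball 0 r \<subseteq> D"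
    using uniform_flat_radius[OF D(1,3,2)] by metis
  have "\<exists>\<Psi>. (\<forall>\<zeta>\<in>ball 0 r. flat_at \<Psi> \<zeta> \<and> \<Psi> \<zeta> \<in> D) \<and> (\<forall>u. \<bar>u\<bar> < r \<longrightarrow> \<Psi> (of_real u) = \<gamma> (s + u))" for s
  proof -
    obtain \<Psi> where \<Psi>: "\<And>\<zeta>. \<zeta> \<in> ball 0 r \<Longrightarrow> flat_at \<Psi> \<zeta>" "\<Psi> 0 = \<gamma> s" "\<Psi> ` ball 0 r \<subseteq> D"
      using r(2)[of "\<gamma> s"] by blast
    obtain \<sigma> where \<sigma>: "\<sigma> \<in> {1, -1::real}" "\<And>u. \<bar>u\<bar> < r \<Longrightarrow> \<gamma> (s + u) = \<Psi> (of_real (\<sigma> * u))"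
      using maximal_curve_extend[OF max UNIV_I r(1) \<Psi>(1,2)] by metis
    show ?thesis
    proof (intro exI[of _ "\<lambda>z. \<Psi> (of_real \<sigma> * z + 0)"] conjI ballI allI impI)
      fix \<zeta> :: complex assume "\<zeta> \<in> ball 0 r"
      then have "of_real \<sigma> * \<zeta> + 0 \<in> ball 0 r" using \<sigma>(1) by auto
      then show "flat_at (\<lambda>z. \<Psi> (of_real \<sigma> * z + 0)) \<zeta>"
        using \<sigma>(1) by (intro flat_at_affine \<Psi>(1)) auto
      show "\<Psi> (of_real \<sigma> * \<zeta> + 0) \<in> D"
        using \<Psi>(3) \<open>of_real \<sigma> * \<zeta> + 0 \<in> ball 0 r\<close> by blast
    qed (use \<sigma>(2) in simp)
  qed
  then obtain \<Psi> where \<Psi>: "\<And>s \<zeta>. \<zeta> \<in> ball 0 r \<Longrightarrow> flat_at (\<Psi> s) \<zeta>" "\<And>s \<zeta>. \<zeta> \<in> ball 0 r \<Longrightarrow> \<Psi> s \<zeta> \<in> D"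
    "\<And>s u. \<bar>u\<bar> < r \<Longrightarrow> \<Psi> s (of_real u) = \<gamma> (s + u)" by metis
  \<comment> \<open>Each vertical segment is read off in the disc centred at its foot;
    \<open>shift\<close> and \<open>loc\<close> show that nearby discs give the same values, so that
    \<open>\<Phi>\<close> is flat in both directions.\<close>
  define \<Phi> where "\<Phi> \<zeta> = \<Psi> (Re \<zeta>) (\<i> * of_real (Im \<zeta>))" for \<zeta>
  have shift: "\<Psi> s \<zeta> = \<Psi> s0 (1 * \<zeta> + of_real (s - s0))" if "\<bar>s - s0\<bar> < r/2" "\<zeta> \<in> ball 0 (r/2)" for s s0 \<zeta>
  proof (rule flat_identity[of "ball 0 (r/2)" "\<Psi> s" "\<lambda>z. \<Psi> s0 (1 * z + of_real (s - s0))" 0])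
    have tri: "1 * z + of_real (s - s0) \<in> ball 0 r" if "z \<in> ball 0 (r/2)" for z :: complex
    proof -
      have "norm (z + of_real (s - s0)) \<le> norm z + norm (complex_of_real (s - s0))" by (rule norm_triangle_ineq)
      then show ?thesis using that \<open>\<bar>s - s0\<bar> < r/2\<close> by (auto simp del: of_real_diff)
    qed
    then show "flat_at (\<lambda>z. \<Psi> s0 (1 * z + of_real (s - s0))) z" if "z \<in> ball 0 (r/2)" for z
      using that by (intro flat_at_affine \<Psi>(1)) auto
    show "flat_at (\<Psi> s) z" if "z \<in> ball 0 (r/2)" for z using that r(1) by (intro \<Psi>(1)) auto
    show "0 islimpt {z. \<Psi> s z = \<Psi> s0 (1 * z + of_real (s - s0))}"
    proof (rule islimpt_real_agree[of "r/2"])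
      fix u :: real assume "\<bar>u\<bar> < r/2"
      show "\<Psi> s (of_real u) = \<Psi> s0 (1 * of_real u + of_real (s - s0))"
      proof -
        have "\<bar>u + (s - s0)\<bar> < r" using \<open>\<bar>u\<bar> < r/2\<close> that(1) by (auto simp: abs_if split: if_splits)
        then show ?thesis
          using \<Psi>(3)[of u s] \<Psi>(3)[of "u + (s - s0)" s0] \<open>\<bar>u\<bar> < r/2\<close> r(1)
          by (simp flip: of_real_add of_real_diff add: algebra_simps)
      qed
    qed (use r(1) in simp)
  qed (use that r(1) in auto)
  have loc: "\<Phi> \<zeta> = \<Psi> s0 (1 * \<zeta> + - of_real s0)" if "\<bar>Re \<zeta> - s0\<bar> < r/2" "\<bar>Im \<zeta>\<bar> < r/2" for \<zeta> s0
  proof -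
    have "\<Phi> \<zeta> = \<Psi> s0 (1 * (\<i> * of_real (Im \<zeta>)) + of_real (Re \<zeta> - s0))"
      unfolding \<Phi>_def using that by (intro shift) (auto simp: norm_mult)
    moreover have "1 * (\<i> * of_real (Im \<zeta>)) + of_real (Re \<zeta> - s0) = 1 * \<zeta> + - of_real s0"
      by (simp add: complex_eq_iff)
    ultimately show ?thesis by (simp only:)
  qed
  have flat: "flat_at \<Phi> \<zeta>" if "\<bar>Im \<zeta>\<bar> < r/2" for \<zeta>
  proof -
    define s0 where "s0 = Re \<zeta>"
    have eq: "1 * \<zeta> + - of_real s0 = \<i> * of_real (Im \<zeta>)" unfolding s0_def by (simp add: complex_eq_iff)
    have "norm (1 * \<zeta> + - of_real s0) = \<bar>Im \<zeta>\<bar>" unfolding eq by (simp add: norm_mult)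
    then have "flat_at (\<lambda>\<zeta>. \<Psi> s0 (1 * \<zeta> + - of_real s0)) \<zeta>"
      using that r(1) by (intro flat_at_affine \<Psi>(1)) auto
    moreover have "\<forall>\<^sub>F z in nhds \<zeta>. \<Psi> s0 (1 * z + - of_real s0) = \<Phi> z"
    proof -
      have "open {z. \<bar>Re z - s0\<bar> < r/2 \<and> \<bar>Im z\<bar> < r/2}"
        by (intro open_Collect_conj open_Collect_less continuous_intros)
      then have "\<forall>\<^sub>F z in nhds \<zeta>. z \<in> {z. \<bar>Re z - s0\<bar> < r/2 \<and> \<bar>Im z\<bar> < r/2}"
        using that r(1) by (intro eventually_nhds_in_open) (auto simp: s0_def)
      then show ?thesis by eventually_elim (use loc in auto)
    qed
    ultimately show ?thesis by (subst (asm) flat_at_cong)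
  qed
  have real: "\<Phi> (of_real s) = \<gamma> s" for s unfolding \<Phi>_def using \<Psi>(3)[of 0 s] r(1) by simp
  have strip: "open {z. \<bar>Im z\<bar> < r/2}" "connected {z. \<bar>Im z\<bar> < r/2}"
  proof -
    have eq: "{z. \<bar>Im z\<bar> < r/2} = Im -` {- r/2<..<r/2}" by auto
    show "open {z. \<bar>Im z\<bar> < r/2}" "connected {z. \<bar>Im z\<bar> < r/2}"
      unfolding eq by (auto intro: strip_open convex_connected strip_convex)
  qed
  show ?thesis
  proof
    show "0 < r/2" using r(1) by simp
    show "\<Phi> \<zeta> \<in> D" if "\<bar>Im \<zeta>\<bar> < r/2" for \<zeta>
      unfolding \<Phi>_def using that r(1) by (intro \<Psi>(2)) (auto simp: norm_mult)
    show "\<Phi> (\<zeta> + of_real \<l>) = \<Phi> \<zeta>" if "\<bar>Im \<zeta>\<bar> < r/2" for \<zeta>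
    proof -
      have "\<Phi> (1 * \<zeta> + of_real \<l>) = \<Phi> \<zeta>"
      proof (rule flat_identity[OF strip, of "\<lambda>z. \<Phi> (1 * z + of_real \<l>)" \<Phi> 0])
        show "flat_at (\<lambda>z. \<Phi> (1 * z + of_real \<l>)) z" if "z \<in> {z. \<bar>Im z\<bar> < r/2}" for z
          using that by (intro flat_at_affine flat) auto
        show "0 islimpt {z. \<Phi> (1 * z + of_real \<l>) = \<Phi> z}"
          using real per by (intro islimpt_real_agree[of 1]) (auto simp flip: of_real_add)
      qed (use flat r(1) that in auto)
      then show ?thesis by simp
    qed
  qed (use flat real in auto)
qed

text \<open>Injectivity modulo the period is not built in, and \<open>\<l>\<close> may be a multiple
  of the least period. A torus filled by closed trajectories would qualify as \<open>D\<close>;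
  \<open>cylinder_injective\<close> deals with this case. The interval \<open>J\<close> may be
  unbounded.\<close>

definition cylinder :: "'a set \<Rightarrow> real set \<Rightarrow> (complex \<Rightarrow> 'a) \<Rightarrow> real \<Rightarrow> bool" where
  "cylinder D J \<Phi> \<l> \<longleftrightarrow> open J \<and> connected J \<and> J \<noteq> {} \<and> 0 < \<l> \<and> (\<forall>\<zeta>. Im \<zeta> \<in> J \<longrightarrow> flat_at \<Phi> \<zeta>) \<and>
     \<Phi> ` (Im -` J) = D \<and> (\<forall>\<zeta>. Im \<zeta> \<in> J \<longrightarrow> \<Phi> (\<zeta> + of_real \<l>) = \<Phi> \<zeta>)"

text \<open>
  The image of a maximal flat strip is clopen, because the annulus around a closed trajectory
  that meets the image can be glued to the strip.
\<close>

lemma cylinder_exists: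
  assumes D: "open D" "connected D" "D \<noteq> {}"
    and cl: "\<And>x. x \<in> D \<Longrightarrow> \<exists>T. closed_trajectory A q T \<and> x \<in> T \<and> T \<subseteq> D"
  obtains J \<Phi> \<l> where "cylinder D J \<Phi> \<l>"
proof -
  define ann where "ann x \<epsilon> \<Phi> \<l> \<longleftrightarrow> 0 < \<epsilon> \<and> 0 < \<l> \<and> \<Phi> 0 = x \<and> (\<forall>\<zeta>. \<bar>Im \<zeta>\<bar> < \<epsilon> \<longrightarrow> flat_at \<Phi> \<zeta> \<and> \<Phi> \<zeta> \<in> D) \<and>
    (\<forall>\<zeta>. \<bar>Im \<zeta>\<bar> < \<epsilon> \<longrightarrow> \<Phi> (\<zeta> + of_real \<l>) = \<Phi> \<zeta>)" for x \<epsilon> \<l> and \<Phi> :: "complex \<Rightarrow> 'a"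
  have ann: "\<exists>\<epsilon> \<Phi> \<l>. ann x \<epsilon> \<Phi> \<l>" if x: "x \<in> D" for x
  proof -
    obtain T where T: "closed_trajectory A q T" "x \<in> T" "T \<subseteq> D" using cl[OF x] by blast
    obtain \<gamma> \<l> where \<gamma>: "maximal_curve UNIV \<gamma>" "0 < \<l>" "\<gamma> 0 = x" "\<And>t. \<gamma> (t + \<l>) = \<gamma> t" "range \<gamma> = T" "compact T"
      using closed_trajectory_periodic[OF T(1,2)] by blast
    obtain \<epsilon> \<Phi> where "0 < \<epsilon>" "\<And>\<zeta>. \<bar>Im \<zeta>\<bar> < \<epsilon> \<Longrightarrow> flat_at \<Phi> \<zeta>" "\<And>\<zeta>. \<bar>Im \<zeta>\<bar> < \<epsilon> \<Longrightarrow> \<Phi> \<zeta> \<in> D"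
      "\<And>s. \<Phi> (of_real s) = \<gamma> s" "\<And>\<zeta>. \<bar>Im \<zeta>\<bar> < \<epsilon> \<Longrightarrow> \<Phi> (\<zeta> + of_real \<l>) = \<Phi> \<zeta>"
      using annulus[OF \<gamma>(1,4), of D] \<gamma>(5,6) T(3) D(1) by metis
    then have "ann x \<epsilon> \<Phi> \<l>" unfolding ann_def using \<gamma>(2,3) by (metis of_real_0)
    then show ?thesis by blast
  qed
  obtain x0 where "x0 \<in> D" using D(3) by blast
  then obtain \<epsilon>0 \<Phi>0 \<l> where a0: "ann x0 \<epsilon>0 \<Phi>0 \<l>" using ann by blast
  define S0 where "S0 = Im -` {- \<epsilon>0<..<\<epsilon>0}"
  have S0: "\<zeta> \<in> S0 \<longleftrightarrow> \<bar>Im \<zeta>\<bar> < \<epsilon>0" for \<zeta> unfolding S0_def by auto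
  define \<U> where "\<U> = {Im -` J | J::real set. open J \<and> connected J \<and> 0 \<in> J}"
  define P where "P \<Phi> \<zeta> \<longleftrightarrow> flat_along (\<lambda>z. z) \<Phi> \<zeta> \<and> \<Phi> \<zeta> \<in> D" for \<Phi> \<zeta>
  show thesis
  proof (rule maximal_extension[of P \<U> S0 \<Phi>0])
    show "P g t" if "\<forall>\<^sub>F s in nhds t. f s = g s" "P f t" for f g t
      using flat_along_cong[OF that(1)] that(2) eventually_nhds_x_imp_x[OF that(1)] unfolding P_def by simp
    show "open U" if "U \<in> \<U>" for U using that strip_open unfolding \<U>_def by blast
    show "\<Union>\<C> \<in> \<U>" if C: "\<C> \<noteq> {}" "\<C> \<subseteq> \<U>" for \<C>
    proof -
      define \<J> where "\<J> = {J. open J \<and> connected J \<and> 0 \<in> J \<and> Im -` J \<in> \<C>}"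
      have "\<Union>\<C> = Im -` \<Union>\<J>" using C(2) unfolding \<U>_def \<J>_def by blast
      moreover have "\<J> \<noteq> {}" using C unfolding \<U>_def \<J>_def by blast
      then have "open (\<Union>\<J>)" "connected (\<Union>\<J>)" "0 \<in> \<Union>\<J>"
        unfolding \<J>_def by (auto intro!: connected_Union)
      ultimately show ?thesis unfolding \<U>_def by blast
    qed
    have "0 < \<epsilon>0" using a0 unfolding ann_def by auto
    then show "S0 \<in> \<U>" unfolding \<U>_def S0_def by (intro CollectI exI[of _ "{- \<epsilon>0<..<\<epsilon>0}"]) auto
    have "open S0" unfolding S0_def by (intro strip_open) auto
    then show "P \<Phi>0 t" if "t \<in> S0" for t
      unfolding P_def using that a0 flat_along_idI[of S0 \<Phi>0 t] unfolding ann_def S0 by auto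
    fix U \<Phi>
    assume U: "U \<in> \<U>" "S0 \<subseteq> U" "\<And>t. t \<in> U \<Longrightarrow> P \<Phi> t" "\<And>t. t \<in> S0 \<Longrightarrow> \<Phi> t = \<Phi>0 t"
      and max: "\<And>V g. \<lbrakk>V \<in> \<U>; U \<subseteq> V; \<And>t. t \<in> V \<Longrightarrow> P g t; \<And>t. t \<in> U \<Longrightarrow> g t = \<Phi> t\<rbrakk> \<Longrightarrow> V = U"
    obtain J where J: "open J" "connected J" "0 \<in> J" "U = Im -` J" using U(1) unfolding \<U>_def by blast
    have oU: "open U" and cU: "connected U" unfolding J(4)
      using J by (auto intro: strip_open convex_connected strip_convex)
    have fl: "flat_at \<Phi> \<zeta>" "\<Phi> \<zeta> \<in> D" if "\<zeta> \<in> U" for \<zeta>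
      using U(3)[OF that] flat_along_at unfolding P_def by auto
    \<comment> \<open>The period of the initial annulus is carried through the whole strip by
      rigidity.\<close>
    have per: "\<Phi> (\<zeta> + of_real \<l>) = \<Phi> \<zeta>" if "\<zeta> \<in> U" for \<zeta>
    proof -
      have "\<Phi> (1 * \<zeta> + of_real \<l>) = \<Phi> \<zeta>"
      proof (rule flat_identity[OF oU cU, of "\<lambda>z. \<Phi> (1 * z + of_real \<l>)" \<Phi> 0])
        show "flat_at (\<lambda>z. \<Phi> (1 * z + of_real \<l>)) z" if "z \<in> U" for z
          using that by (intro flat_at_affine fl) (auto simp: J(4))
        have "0 \<in> S0" using \<open>0 < \<epsilon>0\<close> unfolding S0 by simp
        then show "0 \<in> U" using U(2) by blast
        have "S0 \<subseteq> {z. \<Phi> (1 * z + of_real \<l>) = \<Phi> z}"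
        proof
          fix z assume z: "z \<in> S0"
          then have "z + of_real \<l> \<in> S0" unfolding S0 by simp
          then show "z \<in> {z. \<Phi> (1 * z + of_real \<l>) = \<Phi> z}"
            using z U(4) a0 unfolding ann_def S0 by simp
        qed
        then show "0 islimpt {z. \<Phi> (1 * z + of_real \<l>) = \<Phi> z}"
          using \<open>open S0\<close> \<open>0 \<in> S0\<close> by (intro islimpt_subset[OF interior_limit_point]) (auto simp: interior_open)
      qed (use fl that in auto)
      then show ?thesis by simp
    qed
    have surj: "y \<in> \<Phi> ` U" if y: "y \<in> D" for y
    proof (rule connected_induction_simple[OF D(2) \<open>x0 \<in> D\<close> y, of "\<lambda>y. y \<in> \<Phi> ` U"])
      have "0 \<in> S0" using \<open>0 < \<epsilon>0\<close> unfolding S0 by simp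
      then have "\<Phi> 0 = x0" "0 \<in> U" using U(2,4) a0 unfolding ann_def by auto
      then show "x0 \<in> \<Phi> ` U" by blast
      fix a assume "a \<in> D"
      then obtain \<epsilon> \<Psi> \<l>' where \<Psi>: "ann a \<epsilon> \<Psi> \<l>'" using ann by blast
      have "0 < \<epsilon>" using \<Psi> unfolding ann_def by blast
      define S where "S = Im -` {- \<epsilon><..<\<epsilon>}"
      have S: "\<zeta> \<in> S \<longleftrightarrow> \<bar>Im \<zeta>\<bar> < \<epsilon>" for \<zeta> unfolding S_def by auto
      have oS: "open S" unfolding S_def by (intro strip_open) auto
      have flS: "flat_at \<Psi> \<zeta>" "\<Psi> \<zeta> \<in> D" if "\<zeta> \<in> S" for \<zeta> using \<Psi> that unfolding S ann_def by auto
      have step: "y \<in> \<Phi> ` U" if xS: "x \<in> \<Psi> ` S" and xU: "x \<in> \<Phi> ` U" and yS: "y \<in> \<Psi> ` S" for x y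
      proof -
        obtain \<zeta>2 \<zeta>1 where \<zeta>: "\<zeta>2 \<in> S" "\<zeta>1 \<in> U" "x = \<Psi> \<zeta>2" "x = \<Phi> \<zeta>1" using xS xU by blast
        have "\<Psi> \<zeta>2 = \<Phi> \<zeta>1" using \<zeta> by simp
        then obtain r \<sigma> where r: "0 < r" "\<sigma> \<in> {1, -1::real}" "\<And>u. norm u < r \<Longrightarrow> \<Phi> (\<zeta>1 + u) = \<Psi> (\<zeta>2 + of_real \<sigma> * u)"
          using flat_transition[OF oS flS(1) \<zeta>(1) oU fl(1) \<zeta>(2)] by metis
        define k where "k = \<zeta>2 - of_real \<sigma> * \<zeta>1"
        \<comment> \<open>The annulus is rewritten in the parameter of the strip. An affine change
          of slope 1 or -1 maps horizontals to horizontals, so the new domain \<open>V\<close> is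
          again a full strip, and maximality forces it into \<open>U\<close>.\<close>
        define g where "g z = \<Psi> (of_real \<sigma> * z + k)" for z
        define J' where "J' = {t. \<bar>\<sigma> * t + Im k\<bar> < \<epsilon>}"
        have J': "Im z \<in> J' \<longleftrightarrow> of_real \<sigma> * z + k \<in> S" for z unfolding J'_def S by simp
        have J'eq: "J' = {- \<epsilon> - \<sigma> * Im k <..< \<epsilon> - \<sigma> * Im k}"
          using r(2) unfolding J'_def by auto
        have z1J': "Im \<zeta>1 \<in> J'" unfolding J' using \<zeta>(1) unfolding k_def by simp
        have J'c: "open J'" "connected J'" unfolding J'eq by auto
        define V where "V = Im -` J'"
        have oV: "open V" unfolding V_def using J'c strip_open by blast
        have flV: "flat_at g z" "g z \<in> D" if "z \<in> V" for z
          using that r(2) unfolding g_def V_def vimage_eq J' by (auto intro!: flat_at_affine flS(1) flS(2))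
        have agree: "\<Phi> z = g z" if "z \<in> U" "z \<in> V" for z
        proof (rule flat_identity[of "U \<inter> V" \<Phi> g \<zeta>1])
          have "connected (J \<inter> J')" using J(2) J'c(2) by (metis is_interval_connected_1 is_interval_Int)
          moreover have "U \<inter> V = Im -` (J \<inter> J')" unfolding J(4) V_def by blast
          ultimately show "connected (U \<inter> V)" by (simp only: convex_connected strip_convex)
          show "\<zeta>1 \<in> U \<inter> V" using \<zeta>(2) z1J' unfolding V_def by blast
          have "ball \<zeta>1 r \<subseteq> {z. \<Phi> z = g z}"
          proof
            fix z assume "z \<in> ball \<zeta>1 r"
            then have "norm (z - \<zeta>1) < r" by (simp add: dist_norm norm_minus_commute)
            then show "z \<in> {z. \<Phi> z = g z}"
              using r(3)[of "z - \<zeta>1"] by (simp add: g_def k_def algebra_simps)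
          qed
          then show "\<zeta>1 islimpt {z. \<Phi> z = g z}"
            by (rule islimpt_subset[OF interior_limit_point, rotated]) (use r(1) in auto)
        qed (use oU oV fl flV that in auto)
        have "U \<union> V = U"
        proof (rule max[of "U \<union> V" "\<lambda>z. if z \<in> U then \<Phi> z else g z"])
          have "U \<union> V = Im -` (J \<union> J')" unfolding J(4) V_def by blast
          moreover have "connected (J \<union> J')"
            using J(2) J'c(2) z1J' \<zeta>(2) unfolding J(4) by (intro connected_Un) auto
          ultimately show "U \<union> V \<in> \<U>" unfolding \<U>_def using J(1,3) J'c(1) by blast
          show "P (\<lambda>z. if z \<in> U then \<Phi> z else g z) t" if "t \<in> U \<union> V" for t
            unfolding P_def
          proof
            show "flat_along (\<lambda>z. z) (\<lambda>z. if z \<in> U then \<Phi> z else g z) t"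
              by (rule flat_along_glue[OF oU oV _ _ agree that])
                 (use flat_along_idI[OF oU fl(1)] flat_along_idI[OF oV flV(1)] in auto)
            show "(if t \<in> U then \<Phi> t else g t) \<in> D" using that fl(2) flV(2) by auto
          qed
        qed auto
        then have VU: "V \<subseteq> U" by blast
        obtain \<zeta>' where \<zeta>': "\<zeta>' \<in> S" "y = \<Psi> \<zeta>'" using yS by blast
        define z where "z = of_real \<sigma> * (\<zeta>' - k)"
        have z: "of_real \<sigma> * z + k = \<zeta>'" using r(2) unfolding z_def by auto
        then have "z \<in> V" unfolding V_def vimage_eq J' using \<zeta>'(1) by simp
        moreover have "g z = y" unfolding g_def z using \<zeta>'(2) by simp
        ultimately show ?thesis using VU agree by (metis image_eqI subsetD)
      qed
      have "open (\<Psi> ` S)" using flat_open_map[OF oS flS(1)] .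
      moreover have "a \<in> \<Psi> ` S" using \<Psi> \<open>0 < \<epsilon>\<close> unfolding ann_def by (intro image_eqI[of _ _ 0]) (auto simp: S)
      moreover have "\<Psi> ` S \<subseteq> D" using flS(2) by blast
      ultimately show "\<exists>T. openin (top_of_set D) T \<and> a \<in> T \<and> (\<forall>x\<in>T. \<forall>y\<in>T. x \<in> \<Phi> ` U \<longrightarrow> y \<in> \<Phi> ` U)"
        using step openin_open_eq[OF D(1)] by (intro exI[of _ "\<Psi> ` S"]) blast
    qed
    have "0 < \<l>" using a0 unfolding ann_def by blast
    have "cylinder D J \<Phi> \<l>"
      unfolding cylinder_def
    proof (intro conjI allI impI)
      show "\<Phi> ` (Im -` J) = D" using surj fl(2) unfolding J(4) by blast
    qed (use J \<open>0 < \<l>\<close> fl per in auto)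
    then show thesis by (rule that)
  qed
qed

lemma cylinder_int_period:
  assumes "cylinder D J \<Phi> \<l>" "Im \<zeta> \<in> J"
  shows "\<Phi> (\<zeta> + of_int n * of_real \<l>) = \<Phi> \<zeta>"
proof -
  have nat: "\<Phi> (\<zeta> + of_nat m * of_real \<l>) = \<Phi> \<zeta>" if "Im \<zeta> \<in> J" for m \<zeta>
  proof (induction m)
    case (Suc m)
    have "\<Phi> ((\<zeta> + of_nat m * of_real \<l>) + of_real \<l>) = \<Phi> (\<zeta> + of_nat m * of_real \<l>)"
      using assms(1) that unfolding cylinder_def by (metis Im_complex_of_real add.right_neutral complex_Im_of_nat of_real_mult of_real_of_nat_eq plus_complex.simps(2))
    then show ?case using Suc by (simp add: algebra_simps)
  qed simp
  show ?thesis
  proof (cases "n \<ge> 0")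
    case True
    then show ?thesis using nat[OF assms(2), of "nat n"] by simp
  next
    case False
    have "Im (\<zeta> + of_int n * of_real \<l>) \<in> J" using assms(2) by simp
    from nat[OF this, of "nat (- n)"] False show ?thesis by simp
  qed
qed

text \<open>By periodicity a closed rectangle of width \<open>\<l>\<close> has the same image as the
  band.\<close>

lemma cylinder_level_compact:
  assumes cyl: "cylinder D J \<Phi> \<l>" and "\<alpha> \<in> J" "\<beta> \<in> J"
  shows "compact (\<Phi> ` {\<zeta>. \<alpha> \<le> Im \<zeta> \<and> Im \<zeta> \<le> \<beta>})"
proof -
  have J: "\<And>y. \<alpha> \<le> y \<Longrightarrow> y \<le> \<beta> \<Longrightarrow> y \<in> J" "0 < \<l>"
    using cyl assms(2,3) connected_contains_Icc[of J \<alpha> \<beta>] unfolding cylinder_def by auto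
  define R where "R = cbox (Complex 0 \<alpha>) (Complex \<l> \<beta>)"
  have "continuous_on R \<Phi>"
    using cyl J unfolding cylinder_def flat_at_def R_def
    by (intro continuous_at_imp_continuous_on) (auto simp: in_cbox_complex_iff)
  then have "compact (\<Phi> ` R)" unfolding R_def by (intro compact_continuous_image) auto
  moreover have "\<Phi> ` R = \<Phi> ` {\<zeta>. \<alpha> \<le> Im \<zeta> \<and> Im \<zeta> \<le> \<beta>}"
  proof (intro equalityI subsetI)
    fix x assume "x \<in> \<Phi> ` {\<zeta>. \<alpha> \<le> Im \<zeta> \<and> Im \<zeta> \<le> \<beta>}"
    then obtain \<zeta> where \<zeta>: "\<alpha> \<le> Im \<zeta>" "Im \<zeta> \<le> \<beta>" "x = \<Phi> \<zeta>" by auto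
    define n where "n = \<lfloor>Re \<zeta> / \<l>\<rfloor>"
    have "real_of_int n \<le> Re \<zeta> / \<l>" "Re \<zeta> / \<l> < real_of_int n + 1" unfolding n_def by linarith+
    then have "real_of_int n * \<l> \<le> Re \<zeta>" "Re \<zeta> \<le> real_of_int n * \<l> + \<l>"
      using J(2) by (auto simp: field_simps)
    then have "\<zeta> + of_int (- n) * of_real \<l> \<in> R" using \<zeta> unfolding R_def by (simp add: in_cbox_complex_iff)
    moreover have "x = \<Phi> (\<zeta> + of_int (- n) * of_real \<l>)"
      using cylinder_int_period[OF cyl, of \<zeta> "- n"] J(1) \<zeta> by simp
    ultimately show "x \<in> \<Phi> ` R" by blast
  qed (auto simp: R_def in_cbox_complex_iff)
  ultimately show ?thesis by simp
qed

text \<open>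
  Two parameters of the same point differ by a deck transformation. A half-turn would have a
  fixed point, and a translation that changes the height would make the cylinder a torus.
\<close>

lemma cylinder_injective:
  assumes cyl: "cylinder D J \<Phi> \<l>" and nc: "\<not> compact D"
    and \<zeta>: "Im \<zeta>1 \<in> J" "Im \<zeta>2 \<in> J" "\<Phi> \<zeta>1 = \<Phi> \<zeta>2"
  shows "Im \<zeta>1 = Im \<zeta>2" "\<exists>r>0. \<forall>u. norm u < r \<longrightarrow> \<Phi> (\<zeta>2 + u) = \<Phi> (\<zeta>1 + u)"
proof -
  have J: "open J" "connected J" and fl: "\<And>\<zeta>. Im \<zeta> \<in> J \<Longrightarrow> flat_at \<Phi> \<zeta>" and im: "\<Phi> ` (Im -` J) = D"
    using cyl unfolding cylinder_def by auto
  have btw: "y \<in> J" if "a \<in> J" "b \<in> J" "a \<le> y" "y \<le> b" for a b y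
    using connected_contains_Icc[OF J(2) that(1,2)] that(3,4) by auto
  have fl': "\<And>\<zeta>. \<zeta> \<in> Im -` J \<Longrightarrow> flat_at \<Phi> \<zeta>" using fl by blast
  have \<zeta>': "\<zeta>1 \<in> Im -` J" "\<zeta>2 \<in> Im -` J" using \<zeta> by auto
  obtain r \<sigma> where r: "0 < r" "\<sigma> \<in> {1, -1::real}" "\<And>u. norm u < r \<Longrightarrow> \<Phi> (\<zeta>2 + u) = \<Phi> (\<zeta>1 + of_real \<sigma> * u)"
    using flat_transition[OF strip_open[OF J(1)] fl' \<zeta>'(1) strip_open[OF J(1)] fl' \<zeta>'(2) \<zeta>(3)] by metis
  \<comment> \<open>The affine map with slope \<open>\<sigma>\<close> and constant \<open>k\<close>
    takes \<open>\<zeta>2\<close> to \<open>\<zeta>1\<close> and is the local relation between the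
    two parameters; \<open>J'\<close> collects the heights at which it stays in the strip.\<close>
  define k where "k = \<zeta>1 - of_real \<sigma> * \<zeta>2"
  define J' where "J' = {y. \<sigma> * y + Im k \<in> J}"
  have J'eq: "J' = (\<lambda>y. \<sigma> * y - \<sigma> * Im k) ` J"
  proof (intro equalityI subsetI)
    fix y assume "y \<in> J'"
    then show "y \<in> (\<lambda>y. \<sigma> * y - \<sigma> * Im k) ` J"
      using r(2) unfolding J'_def by (intro image_eqI[of _ _ "\<sigma> * y + Im k"]) auto
  qed (use r(2) in \<open>auto simp: J'_def\<close>)
  have "connected J'" unfolding J'eq using J(2) by (intro connected_continuous_image continuous_intros)
  then have cJ: "connected (J \<inter> J')" using J(2) by (metis is_interval_connected_1 is_interval_Int)
  have oJ: "open (J \<inter> J')"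
  proof (rule open_Int[OF J(1)])
    have "open ((\<lambda>y. \<sigma> * y + Im k) -` J)" using J(1) by (intro open_vimage continuous_intros)
    then show "open J'" unfolding J'_def vimage_def .
  qed
  have glob: "\<Phi> (of_real \<sigma> * z + k) = \<Phi> z" if "Im z \<in> J" "\<sigma> * Im z + Im k \<in> J" for z
  proof (rule flat_identity[of "Im -` (J \<inter> J')" "\<lambda>z. \<Phi> (of_real \<sigma> * z + k)" \<Phi> \<zeta>2])
    show "open (Im -` (J \<inter> J'))" "connected (Im -` (J \<inter> J'))"
      using strip_open[OF oJ] convex_connected[OF strip_convex[OF cJ]] .
    show "flat_at (\<lambda>z. \<Phi> (of_real \<sigma> * z + k)) z" if "z \<in> Im -` (J \<inter> J')" for z
      using that r(2) by (intro flat_at_affine fl) (auto simp: J'_def)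
    show "\<zeta>2 \<in> Im -` (J \<inter> J')" using \<zeta> unfolding J'_def k_def by simp
    have "ball \<zeta>2 r \<subseteq> {z. \<Phi> (of_real \<sigma> * z + k) = \<Phi> z}"
    proof
      fix z assume "z \<in> ball \<zeta>2 r"
      then have "norm (z - \<zeta>2) < r" by (simp add: dist_norm norm_minus_commute)
      then show "z \<in> {z. \<Phi> (of_real \<sigma> * z + k) = \<Phi> z}"
        using r(3)[of "z - \<zeta>2"] by (simp add: k_def algebra_simps)
    qed
    then show "\<zeta>2 islimpt {z. \<Phi> (of_real \<sigma> * z + k) = \<Phi> z}"
      by (rule islimpt_subset[OF interior_limit_point, rotated]) (use r(1) in auto)
  qed (use that fl in \<open>auto simp: J'_def\<close>)
  have \<sigma>1: "\<sigma> = 1"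
  proof (rule ccontr)
    assume "\<sigma> \<noteq> 1"
    then have \<sigma>: "\<sigma> = -1" using r(2) by auto
    define m where "m = (\<zeta>1 + \<zeta>2) / 2"
    have mJ: "Im m \<in> J"
    proof (cases "Im \<zeta>1 \<le> Im \<zeta>2")
      case True
      then show ?thesis using btw[OF \<zeta>(1,2), of "Im m"] unfolding m_def by (simp add: field_simps)
    next
      case False
      then show ?thesis using btw[OF \<zeta>(2,1), of "Im m"] unfolding m_def by (simp add: field_simps)
    qed
    then have m: "m \<in> Im -` J" by simp
    obtain e where e: "0 < e" "ball m e \<subseteq> Im -` J" "inj_on \<Phi> (ball m e)"
      using flat_locally_inj[OF strip_open[OF J(1)] fl' m] by metis
    define z where "z = m - of_real (e/2)"
    have z2: "of_real \<sigma> * z + k = m + of_real (e/2)"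
      unfolding \<sigma> k_def z_def m_def by (simp add: field_simps)
    have "Im z \<in> J" unfolding z_def using mJ by simp
    moreover have "\<sigma> * Im z + Im k = Im m" using arg_cong[OF z2, of Im] by simp
    ultimately have "\<Phi> (m + of_real (e/2)) = \<Phi> z" using glob[of z] mJ z2 by simp
    then have "m + of_real (e/2) = z"
      by (rule inj_onD[OF e(3)]) (use e(1) in \<open>auto simp: z_def dist_norm\<close>)
    then show False using e(1) unfolding z_def by (simp add: complex_eq_iff)
  qed
  show "\<exists>r>0. \<forall>u. norm u < r \<longrightarrow> \<Phi> (\<zeta>2 + u) = \<Phi> (\<zeta>1 + u)"
    using r \<sigma>1 by auto
  show "Im \<zeta>1 = Im \<zeta>2"
  proof (rule ccontr)
    assume ne: "Im \<zeta>1 \<noteq> Im \<zeta>2"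
    define y0 where "y0 = min (Im \<zeta>1) (Im \<zeta>2)"
    define h where "h = \<bar>Im \<zeta>1 - Im \<zeta>2\<bar>"
    define c where "c = (if Im \<zeta>1 > Im \<zeta>2 then \<zeta>1 - \<zeta>2 else \<zeta>2 - \<zeta>1)"
    have c: "Im c = h" "h > 0" using ne unfolding c_def h_def by auto
    have yJ: "y0 \<in> J" "y0 + h \<in> J" using \<zeta> unfolding y0_def h_def by (auto simp: min_def abs_if)
    have tr: "\<Phi> (z + c) = \<Phi> z" if "Im z \<in> J" "Im z + h \<in> J" for z
    proof (cases "Im \<zeta>1 > Im \<zeta>2")
      case True
      then show ?thesis using glob[of z] that c(1) unfolding \<sigma>1 k_def c_def by (simp add: algebra_simps)
    next
      case False
      then show ?thesis using glob[of "z + c"] that c(1) unfolding \<sigma>1 k_def c_def by (simp add: algebra_simps)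
    qed
    \<comment> \<open>Translation by \<open>c\<close> changes the height by \<open>h\<close> and
      keeps the point. Repeating it brings every height into an interval of length \<open>h\<close>,
      so that \<open>D\<close> would be the image of a compact band.\<close>
    have reduce: "\<Phi> z \<in> \<Phi> ` {\<zeta>. y0 \<le> Im \<zeta> \<and> Im \<zeta> \<le> y0 + h}"
      if "Im z \<in> J" "y0 - of_nat n * h \<le> Im z" "Im z \<le> y0 + h + of_nat n * h" for n z
      using that
    proof (induction n arbitrary: z)
      case (Suc n)
      have nh: "0 \<le> real n * h" "real (Suc n) * h = real n * h + h" using c(2) by (auto simp: algebra_simps)
      have imc: "Im (z + c) = Im z + h" "Im (z - c) = Im z - h" using c(1) by simp_all
      consider "Im z < y0" | "Im z > y0 + h" | "y0 \<le> Im z" "Im z \<le> y0 + h" by linarith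
      then show ?case
      proof cases
        case 1
        then have "Im z + h \<in> J" using btw[OF Suc.prems(1) yJ(2)] c(2) by simp
        moreover have "y0 - real n * h \<le> Im z + h" "Im z + h \<le> y0 + h + real n * h"
          using Suc.prems(2) 1 nh by linarith+
        ultimately have "\<Phi> (z + c) \<in> \<Phi> ` {\<zeta>. y0 \<le> Im \<zeta> \<and> Im \<zeta> \<le> y0 + h}"
          using Suc.IH[of "z + c"] unfolding imc by blast
        then show ?thesis using tr[OF Suc.prems(1)] \<open>Im z + h \<in> J\<close> by simp
      next
        case 2
        then have "Im z - h \<in> J" using btw[OF yJ(1) Suc.prems(1)] c(2) by simp
        moreover have "y0 - real n * h \<le> Im z - h" "Im z - h \<le> y0 + h + real n * h"
          using Suc.prems(3) 2 nh by linarith+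
        ultimately have "\<Phi> (z - c) \<in> \<Phi> ` {\<zeta>. y0 \<le> Im \<zeta> \<and> Im \<zeta> \<le> y0 + h}"
          using Suc.IH[of "z - c"] unfolding imc by blast
        then show ?thesis using tr[of "z - c"] \<open>Im z - h \<in> J\<close> Suc.prems(1) c(1) by simp
      qed auto
    qed auto
    have "D \<subseteq> \<Phi> ` {\<zeta>. y0 \<le> Im \<zeta> \<and> Im \<zeta> \<le> y0 + h}"
    proof
      fix x assume "x \<in> D"
      then obtain z where z: "Im z \<in> J" "x = \<Phi> z" using im by blast
      obtain n :: nat where "\<bar>Im z - y0\<bar> / h < of_nat n" using reals_Archimedean2 by blast
      then have "\<bar>Im z - y0\<bar> < of_nat n * h" using c(2) by (simp add: field_simps)
      then show "x \<in> \<Phi> ` {\<zeta>. y0 \<le> Im \<zeta> \<and> Im \<zeta> \<le> y0 + h}"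
        unfolding z(2) using c(2) by (intro reduce[OF z(1), of n]) auto
    qed
    moreover have "\<Phi> ` {\<zeta>. y0 \<le> Im \<zeta> \<and> Im \<zeta> \<le> y0 + h} \<subseteq> D"
      using im btw[OF yJ] by blast
    ultimately have "D = \<Phi> ` {\<zeta>. y0 \<le> Im \<zeta> \<and> Im \<zeta> \<le> y0 + h}" by blast
    then show False using nc cylinder_level_compact[OF cyl yJ] by simp
  qed
qed

section \<open>The height function and the ends of a cylinder\<close>

definition height :: "real set \<Rightarrow> (complex \<Rightarrow> 'a) \<Rightarrow> 'a \<Rightarrow> real" where
  "height J \<Phi> x = Im (SOME \<zeta>. Im \<zeta> \<in> J \<and> \<Phi> \<zeta> = x)"

text \<open>The choice in \<open>height\<close> is harmless because all parameters of a point have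
  the same imaginary part.\<close>

lemma height_eq:
  assumes "cylinder D J \<Phi> \<l>" "\<not> compact D" "Im \<zeta> \<in> J"
  shows "height J \<Phi> (\<Phi> \<zeta>) = Im \<zeta>"
proof -
  have "Im (SOME \<zeta>'. Im \<zeta>' \<in> J \<and> \<Phi> \<zeta>' = \<Phi> \<zeta>) \<in> J \<and> \<Phi> (SOME \<zeta>'. Im \<zeta>' \<in> J \<and> \<Phi> \<zeta>' = \<Phi> \<zeta>) = \<Phi> \<zeta>"
    by (rule someI[of "\<lambda>\<zeta>'. Im \<zeta>' \<in> J \<and> \<Phi> \<zeta>' = \<Phi> \<zeta>"]) (use assms(3) in simp)
  then show ?thesis unfolding height_def using cylinder_injective(1)[OF assms(1,2)] assms(3) by blast
qed

text \<open>Flat maps are open, so the height inherits continuity from the imaginary part.\<close>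

lemma height_continuous:
  assumes cyl: "cylinder D J \<Phi> \<l>" and nc: "\<not> compact D"
  shows "continuous_on D (height J \<Phi>)"
proof (rule continuous_at_imp_continuous_on, intro ballI)
  fix x assume "x \<in> D"
  have J: "open J" "\<And>\<zeta>. Im \<zeta> \<in> J \<Longrightarrow> flat_at \<Phi> \<zeta>" "\<Phi> ` (Im -` J) = D" using cyl unfolding cylinder_def by auto
  obtain \<zeta> where \<zeta>: "Im \<zeta> \<in> J" "x = \<Phi> \<zeta>" using \<open>x \<in> D\<close> J(3) by blast
  show "isCont (height J \<Phi>) x"
    unfolding continuous_at_open
  proof (intro allI impI)
    fix T assume T: "open T \<and> height J \<Phi> x \<in> T"
    define U where "U = Im -` (J \<inter> T)"
    have "open (\<Phi> ` U)" using J T unfolding U_def by (intro flat_open_map strip_open) auto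
    moreover have "x \<in> \<Phi> ` U" using T \<zeta> height_eq[OF cyl nc \<zeta>(1)] unfolding U_def by auto
    moreover have "\<forall>x'\<in>\<Phi> ` U. height J \<Phi> x' \<in> T" using height_eq[OF cyl nc] unfolding U_def by auto
    ultimately show "\<exists>S. open S \<and> x \<in> S \<and> (\<forall>x'\<in>S. height J \<Phi> x' \<in> T)" by blast
  qed
qed

text \<open>A half-turn of the parameter preserves flatness and exchanges the two ends.\<close>

lemma cylinder_flip:
  assumes "cylinder D J \<Phi> \<l>"
  shows "cylinder D (uminus ` J) (\<lambda>z. \<Phi> (- z)) \<l>"
  unfolding cylinder_def
proof (intro conjI allI impI)
  note c = assms[unfolded cylinder_def]
  show "open (uminus ` J)" using c open_negations by blast
  show "connected (uminus ` J)" using c by (intro connected_continuous_image continuous_intros) auto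
  show "uminus ` J \<noteq> {}" "0 < \<l>" using c by auto
  fix \<zeta> :: complex assume "Im \<zeta> \<in> uminus ` J"
  then have \<zeta>: "Im (- \<zeta>) \<in> J" by auto
  then have "flat_at (\<lambda>z. \<Phi> ((-1) * z + 0)) \<zeta>" using c by (intro flat_at_affine) auto
  then show "flat_at (\<lambda>z. \<Phi> (- z)) \<zeta>" by simp
  have "Im (- \<zeta> - of_real \<l>) \<in> J" using \<zeta> by simp
  then have "\<Phi> (- \<zeta> - of_real \<l> + of_real \<l>) = \<Phi> (- \<zeta> - of_real \<l>)" using c by blast
  then show "\<Phi> (- (\<zeta> + of_real \<l>)) = \<Phi> (- \<zeta>)" by simp
next
  have "(\<lambda>z. \<Phi> (- z)) ` (Im -` uminus ` J) = \<Phi> ` (Im -` J)"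
  proof (intro equalityI subsetI)
    fix x assume "x \<in> \<Phi> ` (Im -` J)"
    then obtain \<zeta> where "Im \<zeta> \<in> J" "x = \<Phi> \<zeta>" by blast
    then show "x \<in> (\<lambda>z. \<Phi> (- z)) ` (Im -` uminus ` J)" by (intro image_eqI[of _ _ "- \<zeta>"]) auto
  qed auto
  then show "(\<lambda>z. \<Phi> (- z)) ` (Im -` uminus ` J) = D" using assms unfolding cylinder_def by simp
qed

text \<open>
  The set of points above (below) the heights of a small circle around \<open>p\<close> is connected and
  misses the circle. Points near \<open>p\<close> lie in one of these two sets, which is thus contained in the disc.
\<close>

lemma punctured_disc_end:
  assumes cyl: "cylinder (D - {p}) J \<Phi> \<l>" and D: "open D" "p \<in> D" and nc: "\<not> compact (D - {p})"
  shows "(\<forall>\<alpha>\<in>J. \<exists>K. compact K \<and> K \<subseteq> D \<and> (\<forall>\<zeta>. Im \<zeta> \<in> J \<longrightarrow> \<Phi> \<zeta> \<notin> K \<longrightarrow> Im \<zeta> < \<alpha>)) \<or>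
    (\<forall>\<alpha>\<in>J. \<exists>K. compact K \<and> K \<subseteq> D \<and> (\<forall>\<zeta>. Im \<zeta> \<in> J \<longrightarrow> \<Phi> \<zeta> \<notin> K \<longrightarrow> Im \<zeta> > \<alpha>))"
proof -
  have J: "open J" "connected J" "J \<noteq> {}" "\<And>\<zeta>. Im \<zeta> \<in> J \<Longrightarrow> flat_at \<Phi> \<zeta>" "\<Phi> ` (Im -` J) = D - {p}"
    using cyl unfolding cylinder_def by auto
  have btw: "y \<in> J" if "a \<in> J" "b \<in> J" "a \<le> y" "y \<le> b" for a b y
    using connected_contains_Icc[OF J(2) that(1,2)] that(3,4) by auto
  let ?h = "height J \<Phi>"
  have hJ: "?h x \<in> J" if "x \<in> D - {p}" for x
    using that height_eq[OF cyl nc] J(5) by (metis (no_types, lifting) image_iff vimage_eq)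
  obtain c where c: "c \<in> A" "p \<in> fst c" using chart_exists[OF surface] .
  define z0 where "z0 = snd c p"
  have "open (snd c ` (fst c \<inter> D))"
    using D(1) riemann_surface_chart(1)[OF surface c(1)] by (intro chart_open_image[OF surface c(1)]) auto
  moreover have "z0 \<in> snd c ` (fst c \<inter> D)" using c(2) D(2) unfolding z0_def by blast
  ultimately obtain r where r: "0 < r" "cball z0 r \<subseteq> snd c ` (fst c \<inter> D)"
    using open_contains_cball by metis
  let ?i = "chart_inv c"
  have i: "?i z \<in> D" "?i z \<in> fst c" "snd c (?i z) = z" if z: "z \<in> cball z0 r" for z
  proof -
    obtain x where x: "x \<in> fst c" "x \<in> D" "z = snd c x" using z r(2) by blast
    then show "?i z \<in> D" "?i z \<in> fst c" "snd c (?i z) = z"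
      using chart_inv_simps(1)[OF surface c(1) x(1)] by auto
  qed
  have ip: "?i z0 = p" unfolding z0_def using chart_inv_simps(1)[OF surface c] .
  have inp: "?i z \<noteq> p" if "z \<in> cball z0 r" "z \<noteq> z0" for z
    using i(3)[OF that(1)] that(2) unfolding z0_def by auto
  have cont: "continuous_on (cball z0 r) ?i"
    using riemann_surface_chart(3)[OF surface c(1)] r(2) unfolding homeomorphism_def
    by (meson continuous_on_subset image_mono inf_le1 order_trans)
  \<comment> \<open>A closed coordinate disc about \<open>p\<close>, its boundary circle and its
    interior.\<close>
  define B S N where "B = ?i ` cball z0 r" and "S = ?i ` sphere z0 r" and "N = ?i ` ball z0 r"
  have B: "compact B" "B \<subseteq> D" unfolding B_def using cont i(1) by (auto intro: compact_continuous_image)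
  have S: "compact S" "S \<subseteq> D - {p}" "S \<noteq> {}"
  proof -
    show "compact S" unfolding S_def by (intro compact_continuous_image continuous_on_subset[OF cont sphere_cball]) auto
    show "S \<noteq> {}" unfolding S_def using r(1) by simp
    show "S \<subseteq> D - {p}"
    proof
      fix x assume "x \<in> S"
      then obtain z where z: "z \<in> sphere z0 r" "x = ?i z" unfolding S_def by blast
      then have "z \<in> cball z0 r" "z \<noteq> z0" using r(1) by auto
      then show "x \<in> D - {p}" using i(1) inp z(2) by blast
    qed
  qed
  have "ball z0 r \<subseteq> snd c ` fst c" using r(2) by (auto dest!: subsetD[OF ball_subset_cball] subsetD)
  then have "open N" unfolding N_def by (intro chart_inv_open_image[OF surface c(1)]) auto
  moreover have "B = N \<union> S" unfolding N_def B_def S_def by (simp only: image_Un[symmetric]) (auto simp: le_less)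
  ultimately have N: "open N" "B = N \<union> S" by auto
  obtain x1 x2 where x: "x1 \<in> S" "x2 \<in> S" "\<And>x. x \<in> S \<Longrightarrow> ?h x1 \<le> ?h x \<and> ?h x \<le> ?h x2"
  proof -
    have "continuous_on S ?h" using continuous_on_subset[OF height_continuous[OF cyl nc] S(2)] .
    then obtain x1 x2 where "x1 \<in> S" "\<forall>x\<in>S. ?h x1 \<le> ?h x" "x2 \<in> S" "\<forall>x\<in>S. ?h x \<le> ?h x2"
      using continuous_attains_inf[OF S(1,3)] continuous_attains_sup[OF S(1,3)] by blast
    then show ?thesis using that by blast
  qed
  define \<alpha>0 \<beta>0 where "\<alpha>0 = ?h x1" and "\<beta>0 = ?h x2"
  have ab: "\<alpha>0 \<in> J" "\<beta>0 \<in> J" unfolding \<alpha>0_def \<beta>0_def using hJ x(1,2) S(2) by auto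
  have hS: "\<Phi> \<zeta> \<notin> S" if "Im \<zeta> \<in> J" "Im \<zeta> < \<alpha>0 \<or> \<beta>0 < Im \<zeta>" for \<zeta>
    using x(3)[of "\<Phi> \<zeta>"] height_eq[OF cyl nc that(1)] that(2) unfolding \<alpha>0_def \<beta>0_def by auto
  \<comment> \<open>Leaving the disc without crossing the circle would disconnect
    \<open>X\<close>.\<close>
  have sub: "X \<subseteq> B" if "connected X" "X \<inter> S = {}" "X \<inter> N \<noteq> {}" for X
  proof -
    have "open (- B)" using B(1) compact_imp_closed by blast
    moreover have "N \<inter> - B \<inter> X = {}" "X \<subseteq> N \<union> - B" using N(2) that(2) by auto
    ultimately have "N \<inter> X = {} \<or> - B \<inter> X = {}" using connectedD[OF that(1) N(1)] by blast
    then show ?thesis using that(3) by auto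
  qed
  define X1 X2 where "X1 = \<Phi> ` (Im -` (J \<inter> {\<beta>0<..}))" and "X2 = \<Phi> ` (Im -` (J \<inter> {..<\<alpha>0}))"
  have X: "open X1" "open X2" "connected X1" "connected X2" "X1 \<inter> S = {}" "X2 \<inter> S = {}" "X1 \<inter> X2 = {}"
  proof -
    have conv: "connected (J \<inter> {\<beta>0<..})" "connected (J \<inter> {..<\<alpha>0})"
      using J(2) by (metis is_interval_connected_1 is_interval_Int is_interval_oi is_interval_io)+
    have contc: "continuous_on (Im -` (J \<inter> T)) \<Phi>" for T
      using J(4) unfolding flat_at_def by (auto intro: continuous_at_imp_continuous_on)
    show "open X1" "open X2" unfolding X1_def X2_def
      using J(1,4) by (auto intro!: flat_open_map strip_open)
    show "connected X1" "connected X2" unfolding X1_def X2_def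
      by (intro connected_continuous_image contc convex_connected strip_convex conv)+
    show "X1 \<inter> S = {}" "X2 \<inter> S = {}" unfolding X1_def X2_def using hS by auto
    have "\<alpha>0 \<le> \<beta>0" unfolding \<alpha>0_def \<beta>0_def using x by auto
    then show "X1 \<inter> X2 = {}" unfolding X1_def X2_def
      using cylinder_injective(1)[OF cyl nc] by fastforce
  qed
  \<comment> \<open>The compact band between the extreme heights on the circle misses
    \<open>p\<close>, so a small punctured disc \<open>P\<close> about \<open>p\<close> misses it
    too. Being connected, \<open>P\<close> lies entirely above or entirely below the band.\<close>
  define M where "M = \<Phi> ` {\<zeta>. \<alpha>0 \<le> Im \<zeta> \<and> Im \<zeta> \<le> \<beta>0}"
  have M: "compact M" unfolding M_def by (rule cylinder_level_compact[OF cyl ab])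
  have "M \<subseteq> D - {p}" unfolding M_def J(5)[symmetric] using btw[OF ab] by auto
  have isC: "isCont ?i z0" unfolding z0_def using chart_isCont(2)[OF surface c] .
  have "\<forall>\<^sub>F z in nhds z0. ?i z \<in> - M"
    using M \<open>M \<subseteq> D - {p}\<close> ip by (intro isCont_eventually_in[OF isC]) (auto simp: compact_imp_closed open_Compl)
  then obtain r1 where r1: "0 < r1" "\<And>z. dist z z0 < r1 \<Longrightarrow> ?i z \<notin> M"
    unfolding eventually_nhds_metric by auto
  define P where "P = ?i ` (ball z0 (min r r1) - {z0})"
  have "connected P" unfolding P_def
  proof (rule connected_continuous_image)
    show "continuous_on (ball z0 (min r r1) - {z0}) ?i"
      by (rule continuous_on_subset[OF cont]) auto
    show "connected (ball z0 (min r r1) - {z0})"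
      using r(1) r1(1) by (intro connected_punctured_convex) (auto simp: aff_dim_open)
  qed
  have PX: "P \<subseteq> X1 \<union> X2"
  proof
    fix x assume "x \<in> P"
    then obtain z where z: "z \<in> ball z0 (min r r1)" "z \<noteq> z0" "x = ?i z" unfolding P_def by blast
    then have zc: "z \<in> cball z0 r" by auto
    have "x \<in> D - {p}" using i(1)[OF zc] inp[OF zc] z by simp
    then obtain \<zeta> where \<zeta>: "Im \<zeta> \<in> J" "x = \<Phi> \<zeta>" using J(5) by blast
    have "x \<notin> M" using r1(2)[of z] z by (simp add: dist_commute)
    then have "Im \<zeta> < \<alpha>0 \<or> \<beta>0 < Im \<zeta>" using \<zeta> unfolding M_def by force
    then show "x \<in> X1 \<union> X2" using \<zeta> unfolding X1_def X2_def by auto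
  qed
  have "P \<noteq> {}"
  proof -
    have "z0 + of_real (min r r1 / 2) \<in> ball z0 (min r r1) - {z0}" using r(1) r1(1) by (auto simp: dist_norm)
    then show ?thesis unfolding P_def by blast
  qed
  have "P \<subseteq> N" unfolding P_def N_def by auto
  have "X1 \<inter> P = {} \<or> X2 \<inter> P = {}"
    using connectedD[OF \<open>connected P\<close> X(1,2)] X(7) PX by blast
  then show ?thesis
  proof
    assume "X2 \<inter> P = {}"
    then have "X1 \<inter> N \<noteq> {}" using PX \<open>P \<noteq> {}\<close> \<open>P \<subseteq> N\<close> by blast
    then have XB: "X1 \<subseteq> B" by (rule sub[OF X(3,5)])
    have "\<exists>K. compact K \<and> K \<subseteq> D \<and> (\<forall>\<zeta>. Im \<zeta> \<in> J \<longrightarrow> \<Phi> \<zeta> \<notin> K \<longrightarrow> Im \<zeta> < \<alpha>)" if "\<alpha> \<in> J" for \<alpha>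
    \<comment> \<open>Points outside \<open>B\<close> have height at most \<open>\<beta>0\<close>,
      and the added band takes away the heights from \<open>\<alpha>\<close> to
      \<open>\<beta>0\<close>. For \<open>\<alpha> > \<beta>0\<close> the band is empty.\<close>
    proof (intro exI[of _ "B \<union> \<Phi> ` {\<zeta>. \<alpha> \<le> Im \<zeta> \<and> Im \<zeta> \<le> \<beta>0}"] conjI allI impI)
      show "compact (B \<union> \<Phi> ` {\<zeta>. \<alpha> \<le> Im \<zeta> \<and> Im \<zeta> \<le> \<beta>0})"
        using cylinder_level_compact[OF cyl that ab(2)] B(1) by blast
      show "B \<union> \<Phi> ` {\<zeta>. \<alpha> \<le> Im \<zeta> \<and> Im \<zeta> \<le> \<beta>0} \<subseteq> D"
        using B(2) J(5) btw[OF that ab(2)] by blast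
      fix \<zeta> assume \<zeta>: "Im \<zeta> \<in> J" "\<Phi> \<zeta> \<notin> B \<union> \<Phi> ` {\<zeta>. \<alpha> \<le> Im \<zeta> \<and> Im \<zeta> \<le> \<beta>0}"
      then have "\<Phi> \<zeta> \<notin> X1" using XB by blast
      then have "Im \<zeta> \<le> \<beta>0" using \<zeta>(1) unfolding X1_def by force
      then show "Im \<zeta> < \<alpha>" using \<zeta>(2) by force
    qed
    then show ?thesis by blast
  next
    assume "X1 \<inter> P = {}"
    then have "X2 \<inter> N \<noteq> {}" using PX \<open>P \<noteq> {}\<close> \<open>P \<subseteq> N\<close> by blast
    then have XB: "X2 \<subseteq> B" by (rule sub[OF X(4,6)])
    have "\<exists>K. compact K \<and> K \<subseteq> D \<and> (\<forall>\<zeta>. Im \<zeta> \<in> J \<longrightarrow> \<Phi> \<zeta> \<notin> K \<longrightarrow> Im \<zeta> > \<alpha>)" if "\<alpha> \<in> J" for \<alpha>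
    proof (intro exI[of _ "B \<union> \<Phi> ` {\<zeta>. \<alpha>0 \<le> Im \<zeta> \<and> Im \<zeta> \<le> \<alpha>}"] conjI allI impI)
      show "compact (B \<union> \<Phi> ` {\<zeta>. \<alpha>0 \<le> Im \<zeta> \<and> Im \<zeta> \<le> \<alpha>})"
        using cylinder_level_compact[OF cyl ab(1) that] B(1) by blast
      show "B \<union> \<Phi> ` {\<zeta>. \<alpha>0 \<le> Im \<zeta> \<and> Im \<zeta> \<le> \<alpha>} \<subseteq> D"
        using B(2) J(5) btw[OF ab(1) that] by blast
      fix \<zeta> assume \<zeta>: "Im \<zeta> \<in> J" "\<Phi> \<zeta> \<notin> B \<union> \<Phi> ` {\<zeta>. \<alpha>0 \<le> Im \<zeta> \<and> Im \<zeta> \<le> \<alpha>}"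
      then have "\<Phi> \<zeta> \<notin> X2" using XB by blast
      then have "\<alpha>0 \<le> Im \<zeta>" using \<zeta>(1) unfolding X2_def by force
      then show "Im \<zeta> > \<alpha>" using \<zeta>(2) by force
    qed
    then show ?thesis by blast
  qed
qed

text \<open>The orientation is normalised, by a half-turn if necessary, so that the boundary of
  \<open>D\<close> is approached at the lower end of \<open>J\<close>. The base height used later is
  therefore an infimum.\<close>

lemma punctured_disc_cylinder:
  assumes "open D" "p \<in> D" "connected (D - {p})" "D \<noteq> {p}" "\<not> compact (D - {p})"
    and "\<And>x. x \<in> D - {p} \<Longrightarrow> \<exists>T. closed_trajectory A q T \<and> x \<in> T \<and> T \<subseteq> D - {p}"
  obtains J \<Phi> \<l> where "cylinder (D - {p}) J \<Phi> \<l>"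
    "\<And>\<alpha>. \<alpha> \<in> J \<Longrightarrow> \<exists>K. compact K \<and> K \<subseteq> D \<and> (\<forall>\<zeta>. Im \<zeta> \<in> J \<longrightarrow> \<Phi> \<zeta> \<notin> K \<longrightarrow> Im \<zeta> < \<alpha>)"
proof -
  obtain J \<Phi> \<l> where cyl: "cylinder (D - {p}) J \<Phi> \<l>"
    by (rule cylinder_exists[of "D - {p}"]) (use assms in auto)
  show ?thesis
    using punctured_disc_end[OF cyl assms(1,2,5)]
  proof
    assume "\<forall>\<alpha>\<in>J. \<exists>K. compact K \<and> K \<subseteq> D \<and> (\<forall>\<zeta>. Im \<zeta> \<in> J \<longrightarrow> \<Phi> \<zeta> \<notin> K \<longrightarrow> Im \<zeta> < \<alpha>)"
    then show ?thesis using that[OF cyl] by blast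
  next
    assume *: "\<forall>\<alpha>\<in>J. \<exists>K. compact K \<and> K \<subseteq> D \<and> (\<forall>\<zeta>. Im \<zeta> \<in> J \<longrightarrow> \<Phi> \<zeta> \<notin> K \<longrightarrow> Im \<zeta> > \<alpha>)"
    show ?thesis
    proof (rule that[OF cylinder_flip[OF cyl]])
      fix \<alpha> assume "\<alpha> \<in> uminus ` J"
      then have "- \<alpha> \<in> J" by auto
      then obtain K where K: "compact K" "K \<subseteq> D" "\<And>\<zeta>. Im \<zeta> \<in> J \<Longrightarrow> \<Phi> \<zeta> \<notin> K \<Longrightarrow> Im \<zeta> > - \<alpha>" using * by blast
      have "Im \<zeta> < \<alpha>" if "Im \<zeta> \<in> uminus ` J" "\<Phi> (- \<zeta>) \<notin> K" for \<zeta>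
        using K(3)[of "- \<zeta>"] that by auto
      then show "\<exists>K. compact K \<and> K \<subseteq> D \<and> (\<forall>\<zeta>. Im \<zeta> \<in> uminus ` J \<longrightarrow> \<Phi> (- \<zeta>) \<notin> K \<longrightarrow> Im \<zeta> < \<alpha>)"
        using K(1,2) by blast
    qed
  qed
qed

end

subsection \<open>Critical points\<close>

text \<open>By the Lindelof property countably many of the neighbourhoods cover \<open>S\<close>,
  and each contributes one value.\<close>

lemma countable_locally_constant:
  fixes S :: "'c::second_countable_topology set"
  assumes "\<And>x. x \<in> S \<Longrightarrow> \<exists>U. open U \<and> x \<in> U \<and> (\<forall>y\<in>U \<inter> S. F y = F x)"
  shows "countable (F ` S)"
proof -
  obtain U where U: "\<And>x. x \<in> S \<Longrightarrow> open (U x) \<and> x \<in> U x \<and> (\<forall>y\<in>U x \<inter> S. F y = F x)"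
    using assms by metis
  obtain \<F> where \<F>: "\<F> \<subseteq> U ` S" "countable \<F>" "\<Union>\<F> = \<Union>(U ` S)"
    using Lindelof[of "U ` S"] U by blast
  obtain C where C: "countable C" "C \<subseteq> S" "\<F> = U ` C"
    using \<F>(1,2) countable_subset_image by metis
  have "F ` S \<subseteq> F ` C"
  proof
    fix y assume "y \<in> F ` S"
    then obtain x where x: "x \<in> S" "y = F x" by blast
    then obtain z where "z \<in> C" "x \<in> U z" using \<F>(3) C(3) U by blast
    then have "F x = F z" using U[of z] C(2) x(1) by blast
    then show "y \<in> F ` C" using \<open>z \<in> C\<close> x(2) by blast
  qed
  then show ?thesis by (rule countable_subset) (use C(1) in simp)
qed

lemma eventually_nhds_openin:
  assumes "\<forall>\<^sub>F s in nhds t. P s" "t \<in> S"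
  shows "\<exists>U. openin (top_of_set S) U \<and> t \<in> U \<and> (\<forall>s\<in>U. P s)"
proof -
  obtain V where V: "open V" "t \<in> V" "\<forall>s\<in>V. P s" using assms(1) unfolding eventually_nhds by blast
  have "openin (top_of_set S) (S \<inter> V)" using V(1) by (rule openin_open_Int)
  then show ?thesis using V(2,3) assms(2) by blast
qed

lemma chart_at_neq_bot:
  fixes A :: "'a::t2_space chart set" and x :: 'a
  assumes "riemann_surface A"
  shows "at x \<noteq> bot"
proof
  assume bot: "at x = bot"
  obtain c where c: "c \<in> A" "x \<in> fst c" using chart_exists[OF assms] .
  have "\<forall>\<^sub>F z in at (snd c x). False"
    using eventually_chart_at[OF assms c, of "\<lambda>_. False"] bot by simp
  then show False by simp
qed

context quadratic_differential
begin

lemma quadratic_dichotomy: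
  assumes "c \<in> A" "x \<in> fst c"
  shows "(\<forall>\<^sub>F z in at (snd c x). q c z \<noteq> 0) \<or> (\<forall>\<^sub>F z in at (snd c x). q c z = 0)"
proof -
  have "q c meromorphic_on (snd c ` fst c)"
    using quadratic assms(1) unfolding meromorphic_differential_def nicely_meromorphic_on_def by blast
  then have "q c meromorphic_on {snd c x}"
    by (rule meromorphic_on_subset) (use assms(2) in auto)
  then have "isolated_singularity_at (q c) (snd c x)" "not_essential (q c) (snd c x)"
    using meromorphic_on_isolated_singularity meromorphic_on_not_essential by auto
  then have "(\<exists>\<^sub>F z in at (snd c x). q c z = 0) \<Longrightarrow> (\<forall>\<^sub>F z in at (snd c x). q c z = 0)"
    by (rule not_essential_frequently_0_imp_eventually_0)
  then show ?thesis unfolding frequently_def by blast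
qed

lemma regular_dichotomy: "(\<forall>\<^sub>F y in at x. regular y) \<or> (\<forall>\<^sub>F y in at x. \<not> regular y)"
proof -
  obtain c where c: "c \<in> A" "x \<in> fst c" using chart_exists[OF surface] .
  have "\<forall>\<^sub>F y in at x. y \<in> fst c"
    using riemann_surface_chart(1)[OF surface c(1)] c(2) eventually_at_topological by blast
  then have "(\<forall>\<^sub>F y in at x. regular y) \<longleftrightarrow> (\<forall>\<^sub>F y in at x. q c (snd c y) \<noteq> 0)"
    "(\<forall>\<^sub>F y in at x. \<not> regular y) \<longleftrightarrow> (\<forall>\<^sub>F y in at x. q c (snd c y) = 0)"
    using regular_iff[OF c(1)] by (auto intro!: eventually_cong)
  then show ?thesis
    using quadratic_dichotomy[OF c] eventually_chart_at[OF surface c, of "\<lambda>z. q c z \<noteq> 0"]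
      eventually_chart_at[OF surface c, of "\<lambda>z. q c z = 0"] by simp
qed

end

locale nonzero_quadratic_differential = quadratic_differential +
  assumes connected_surface: "connected (UNIV :: 'a set)"
    and nonzero: "\<exists>x. regular x"
begin

text \<open>Identity theorem on the surface. By the dichotomy each point has a neighbourhood on
  which the property holds everywhere or nowhere, the second because the surface has no isolated
  points; connectedness then spreads it from one regular point.\<close>

lemma regular_near: "\<forall>\<^sub>F y in at x. regular y"
proof -
  obtain x0 where x0: "regular x0" using nonzero by blast
  have near: "\<forall>\<^sub>F y in at x. regular y" if "regular x" for x
    using open_regular that unfolding eventually_at_topological by blast
  show ?thesis
  proof (rule connected_induction_simple[OF connected_surface, of x0 x "\<lambda>x. \<forall>\<^sub>F y in at x. regular y"])
    show "\<forall>\<^sub>F y in at x0. regular y" using near x0 by blast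
    fix a :: 'a
    from regular_dichotomy[of a] show "\<exists>T. openin (top_of_set UNIV) T \<and> a \<in> T \<and>
      (\<forall>x\<in>T. \<forall>y\<in>T. (\<forall>\<^sub>F z in at x. regular z) \<longrightarrow> (\<forall>\<^sub>F z in at y. regular z))"
    proof
      assume a: "\<forall>\<^sub>F y in at a. regular y"
      then obtain T where "open T" "a \<in> T" "\<And>y. y \<in> T \<Longrightarrow> y \<noteq> a \<Longrightarrow> regular y"
        unfolding eventually_at_topological by blast
      then have "\<forall>y\<in>T. \<forall>\<^sub>F z in at y. regular z" using near a by metis
      then show ?thesis using \<open>open T\<close> \<open>a \<in> T\<close> by (intro exI[of _ T]) auto
    next
      assume "\<forall>\<^sub>F y in at a. \<not> regular y"
      then obtain T where T: "open T" "a \<in> T" "\<And>y. y \<in> T \<Longrightarrow> y \<noteq> a \<Longrightarrow> \<not> regular y"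
        unfolding eventually_at_topological by blast
      have "\<not> (\<forall>\<^sub>F z in at x. regular z)" if "x \<in> T" for x
      proof
        assume r: "\<forall>\<^sub>F z in at x. regular z"
        have "\<forall>\<^sub>F z in at x. z \<in> T \<and> z \<noteq> a"
        proof (cases "x = a")
          case True
          then show ?thesis using T(1,2) unfolding eventually_at_topological by blast
        next
          case False
          have "open (T - {a})" using T(1) by (simp add: open_Diff)
          then show ?thesis using that False unfolding eventually_at_topological by blast
        qed
        with r have "\<forall>\<^sub>F z in at x. False" by eventually_elim (use T(3) in blast)
        then show False using chart_at_neq_bot[OF surface] by simp
      qed
      then show ?thesis using T(1,2) by (intro exI[of _ T]) auto
    qed
  qed auto
qed

lemma quadratic_nonzero_near:
  assumes "c \<in> A" "x \<in> fst c"
  shows "\<forall>\<^sub>F z in at (snd c x). q c z \<noteq> 0"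
proof -
  have "\<forall>\<^sub>F y in at x. y \<in> fst c"
    using riemann_surface_chart(1)[OF surface assms(1)] assms(2) eventually_at_topological by blast
  with regular_near[of x] have "\<forall>\<^sub>F y in at x. q c (snd c y) \<noteq> 0"
    by eventually_elim (use regular_iff assms in blast)
  then show ?thesis using eventually_chart_at[OF surface assms, of "\<lambda>z. q c z \<noteq> 0"] by simp
qed

text \<open>\<open>zorder\<close> reflects zeros and poles only where the function does not vanish
  identically nearby, which \<open>quadratic_nonzero_near\<close> guarantees. Poles are not regular
  because of the normalised value 0.\<close>

lemma critical_point_iff: "critical_point A q x \<longleftrightarrow> \<not> regular x"
  and order_nonneg_analytic: "order_at A q x \<ge> 0 \<Longrightarrow> q (chart_at A x) analytic_on {snd (chart_at A x) x}"
proof -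
  define c where "c = chart_at A x"
  have c: "c \<in> A" "x \<in> fst c" unfolding c_def using chart_at_in[OF surface] by auto
  have nz: "\<forall>\<^sub>F z in at (snd c x). q c z \<noteq> 0" using quadratic_nonzero_near[OF c] .
  have fr: "\<exists>\<^sub>F z in at (snd c x). q c z \<noteq> 0" using nz by (simp add: eventually_frequently)
  have mer: "q c nicely_meromorphic_on (snd c ` fst c)"
    using quadratic c(1) unfolding meromorphic_differential_def by blast
  have pole: "zorder (q c) (snd c x) < 0 \<and> q c (snd c x) = 0" if "is_pole (q c) (snd c x)"
  proof
    have "q c meromorphic_on {snd c x}"
      using mer c(2) unfolding nicely_meromorphic_on_def
      by (metis imageI meromorphic_on_subset empty_subsetI insert_subset)
    then show "zorder (q c) (snd c x) < 0"
      using that isolated_pole_imp_neg_zorder meromorphic_on_isolated_singularity by blast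
    show "q c (snd c x) = 0"
      using mer c(2) that unfolding nicely_meromorphic_on_def is_pole_def
      by (metis imageI at_neq_bot not_tendsto_and_filterlim_at_infinity)
  qed
  have ana: "zorder (q c) (snd c x) = 0 \<longleftrightarrow> q c (snd c x) \<noteq> 0" if "\<not> is_pole (q c) (snd c x)"
    using zorder_eq_0_iff[OF quadratic_analytic[OF c that] fr] .
  show "critical_point A q x \<longleftrightarrow> \<not> regular x"
    unfolding critical_point_def order_at_def regular_iff[OF c] c_def[symmetric]
    using pole ana by (cases "is_pole (q c) (snd c x)") auto
  show "q (chart_at A x) analytic_on {snd (chart_at A x) x}" if "order_at A q x \<ge> 0"
    using that pole quadratic_analytic[OF c] unfolding order_at_def c_def[symmetric] by fastforce
qed

text \<open>
  Near a zero, \<open>z = w\<^sup>2\<close> turns \<open>q\<close> into the square of the holomorphic form \<open>dH\<close>.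
\<close>

lemma zero_chart:
  assumes c: "c \<in> A" "p \<in> fst c" and p: "\<not> regular p" and an: "q c analytic_on {snd c p}"
  obtains \<rho> H where "0 < \<rho>" "H holomorphic_on ball 0 \<rho>" "H 0 = 0"
    "\<And>w. w \<in> ball 0 \<rho> \<Longrightarrow> snd c p + w\<^sup>2 \<in> snd c ` fst c"
    "\<And>w. w \<in> ball 0 \<rho> \<Longrightarrow> w \<noteq> 0 \<Longrightarrow> deriv H w \<noteq> 0"
    "\<And>w. w \<in> ball 0 \<rho> \<Longrightarrow> (deriv H w)\<^sup>2 = q c (snd c p + w\<^sup>2) * (2 * w)\<^sup>2"
proof -
  define z0 where "z0 = snd c p"
  obtain e1 where e1: "0 < e1" "q c holomorphic_on ball z0 e1"
    using an unfolding z0_def by (metis analytic_at_ball)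
  have "z0 \<in> snd c ` fst c" unfolding z0_def using c by blast
  then obtain e2 where e2: "0 < e2" "ball z0 e2 \<subseteq> snd c ` fst c"
    using riemann_surface_chart(2)[OF surface c(1)] open_contains_ball by metis
  define e where "e = min e1 e2"
  have e: "0 < e" "q c holomorphic_on ball z0 e" "ball z0 e \<subseteq> snd c ` fst c"
    using e1 e2 unfolding e_def by (auto intro: holomorphic_on_subset)
  have "q c z0 = 0" using p regular_iff[OF c] unfolding z0_def by simp
  moreover have nc: "\<not> q c constant_on ball z0 e"
  proof
    assume "q c constant_on ball z0 e"
    then have "\<And>z. z \<in> ball z0 e \<Longrightarrow> q c z = 0"
      using \<open>q c z0 = 0\<close> e(1) unfolding constant_on_def by (metis centre_in_ball)
    then have "\<forall>\<^sub>F z in at z0. q c z = 0"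
      using e(1) unfolding eventually_at by (intro exI[of _ e]) (auto simp: dist_commute)
    with quadratic_nonzero_near[OF c] have "\<forall>\<^sub>F z in at z0. False"
      unfolding z0_def by eventually_elim auto
    then show False by simp
  qed
  ultimately obtain g r n where g: "0 < n" "0 < r" "ball z0 r \<subseteq> ball z0 e" "g holomorphic_on ball z0 r"
      "\<And>w. w \<in> ball z0 r \<Longrightarrow> q c w = (w - z0) ^ n * g w" "\<And>w. w \<in> ball z0 r \<Longrightarrow> g w \<noteq> 0"
    by (rule_tac holomorphic_factor_zero_nonconstant[OF e(2) open_ball connected_ball, of z0]) (use e(1) in auto)
  obtain s where s: "s holomorphic_on ball z0 r" "\<And>z. z \<in> ball z0 r \<Longrightarrow> g z = (s z)\<^sup>2"
    using contractible_imp_holomorphic_sqrt[OF g(4) convex_imp_contractible[OF convex_ball] g(6)] by metis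
  define \<rho> where "\<rho> = sqrt r"
  have sq: "z0 + w\<^sup>2 \<in> ball z0 r" if "w \<in> ball 0 \<rho>" for w :: complex
  proof -
    have "(norm w)\<^sup>2 < (sqrt r)\<^sup>2" using that unfolding \<rho>_def by (intro power_strict_mono) auto
    then show ?thesis using g(2) by (simp add: dist_norm norm_power)
  qed
  \<comment> \<open>With \<open>z - z0 = w\<^sup>2\<close> the local function becomes
    \<open>w ^ (2 * n) * g\<close>, and \<open>dz\<close> becomes \<open>2 * w\<close> times
    \<open>dw\<close>, so this is a square root of the pulled-back differential. For odd
    \<open>n\<close> it exists because only even powers of \<open>w\<close> occur under the
    root.\<close>
  define k where "k w = 2 * w ^ (n + 1) * s (z0 + w\<^sup>2)" for w
  have "(\<lambda>w. z0 + w\<^sup>2) holomorphic_on ball 0 \<rho>" by (intro holomorphic_intros)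
  then have "s \<circ> (\<lambda>w. z0 + w\<^sup>2) holomorphic_on ball 0 \<rho>"
    by (rule holomorphic_on_compose_gen[OF _ s(1)]) (use sq in blast)
  then have "(\<lambda>w. s (z0 + w\<^sup>2)) holomorphic_on ball 0 \<rho>" unfolding o_def .
  then have "k holomorphic_on ball 0 \<rho>" unfolding k_def by (intro holomorphic_intros)
  then obtain H0 where H0: "\<And>w. w \<in> ball 0 \<rho> \<Longrightarrow> (H0 has_field_derivative k w) (at w)"
    using holomorphic_convex_primitive'[OF convex_ball open_ball] at_within_open[OF _ open_ball] by metis
  define H where "H w = H0 w - H0 0" for w
  have dH: "(H has_field_derivative k w) (at w)" if "w \<in> ball 0 \<rho>" for w
    unfolding H_def using H0[OF that] by (auto intro!: derivative_eq_intros)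
  then have dH': "deriv H w = k w" if "w \<in> ball 0 \<rho>" for w using that DERIV_imp_deriv by blast
  show ?thesis
  proof
    show "0 < \<rho>" unfolding \<rho>_def using g(2) by simp
    show "H holomorphic_on ball 0 \<rho>" using dH holomorphic_on_open by blast
    show "H 0 = 0" unfolding H_def by simp
    fix w :: complex assume w: "w \<in> ball 0 \<rho>"
    show "snd c p + w\<^sup>2 \<in> snd c ` fst c" using sq[OF w] g(3) e(3) unfolding z0_def by blast
    show "deriv H w \<noteq> 0" if "w \<noteq> 0"
    proof -
      have "s (z0 + w\<^sup>2) \<noteq> 0" using s(2)[OF sq[OF w]] g(6)[OF sq[OF w]] by auto
      then show ?thesis using that unfolding dH'[OF w] k_def by simp
    qed
    show "(deriv H w)\<^sup>2 = q c (snd c p + w\<^sup>2) * (2 * w)\<^sup>2"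
      using g(5)[OF sq[OF w]] s(2)[OF sq[OF w]] unfolding dH'[OF w] k_def z0_def
      by (simp add: power_mult_distrib power_mult[symmetric] mult.commute power2_eq_square power_add)
  qed
qed

text \<open>Away from \<open>w = 0\<close> the branched parameter is a local coordinate, and the
  chart coordinate has derivative \<open>2 * w\<close> in it.\<close>

lemma zero_chart_flat:
  assumes c: "c \<in> A" and H: "H holomorphic_on ball 0 \<rho>"
    "\<And>w. w \<in> ball 0 \<rho> \<Longrightarrow> z0 + w\<^sup>2 \<in> snd c ` fst c"
    "\<And>w. w \<in> ball 0 \<rho> \<Longrightarrow> w \<noteq> 0 \<Longrightarrow> deriv H w \<noteq> 0"
    "\<And>w. w \<in> ball 0 \<rho> \<Longrightarrow> (deriv H w)\<^sup>2 = q c (z0 + w\<^sup>2) * (2 * w)\<^sup>2"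
    and w0: "w0 \<in> ball 0 \<rho>" "w0 \<noteq> 0"
  shows "\<exists>r \<Psi>. 0 < r \<and> (\<forall>\<zeta>\<in>ball 0 r. flat_at \<Psi> \<zeta>) \<and>
    (\<forall>\<^sub>F w in nhds w0. H w - H w0 \<in> ball 0 r \<and> \<Psi> (H w - H w0) = chart_inv c (z0 + w\<^sup>2))"
proof -
  let ?S = "ball (0::complex) \<rho> - {0}"
  note inv = chart_inv_simps[OF surface c]
  show ?thesis
  proof (rule flat_of_primitive[of ?S w0 H c "\<lambda>w. chart_inv c (z0 + w\<^sup>2)" "\<lambda>w. 2 * w"])
    show "open ?S" by (intro open_Diff) auto
    show "H holomorphic_on ?S" using H(1) by (rule holomorphic_on_subset) auto
    fix w assume w: "w \<in> ?S"
    then have im: "z0 + w\<^sup>2 \<in> snd c ` fst c" using H(2) by auto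
    have dw: "((\<lambda>w::complex. z0 + w\<^sup>2) has_field_derivative 2 * w) (at w)" by (auto intro!: derivative_eq_intros)
    show "isCont (\<lambda>w. chart_inv c (z0 + w\<^sup>2)) w"
      using isCont_o2[OF DERIV_isCont[OF dw], of "chart_inv c"] chart_isCont(2)[OF surface c inv(3)[OF im]] inv(2)[OF im] by simp
    show "chart_inv c (z0 + w\<^sup>2) \<in> fst c" using inv(3)[OF im] .
    have "\<forall>\<^sub>F v in nhds w. v \<in> ball 0 \<rho>" using w by (intro eventually_nhds_in_open) auto
    then have "\<forall>\<^sub>F v in nhds w. z0 + v\<^sup>2 = (snd c \<circ> (\<lambda>w. chart_inv c (z0 + w\<^sup>2))) v"
      by eventually_elim (use inv(2)[OF H(2)] in simp)
    then show "(snd c \<circ> (\<lambda>w. chart_inv c (z0 + w\<^sup>2)) has_field_derivative 2 * w) (at w)"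
      using dw by (subst (asm) DERIV_cong_ev[OF refl _ refl])
    show "(deriv H w)\<^sup>2 = q c (snd c (chart_inv c (z0 + w\<^sup>2))) * (2 * w)\<^sup>2"
      using H(4) w inv(2)[OF im] by simp
  next
    fix r \<Psi>
    assume "0 < r" "\<And>\<zeta>. \<zeta> \<in> ball 0 r \<Longrightarrow> flat_at \<Psi> \<zeta>"
      "\<forall>\<^sub>F w in nhds w0. H w - H w0 \<in> ball 0 r \<and> \<Psi> (H w - H w0) = chart_inv c (z0 + w\<^sup>2)"
    then show "\<exists>r \<Psi>. 0 < r \<and> (\<forall>\<zeta>\<in>ball 0 r. flat_at \<Psi> \<zeta>) \<and>
      (\<forall>\<^sub>F w in nhds w0. H w - H w0 \<in> ball 0 r \<and> \<Psi> (H w - H w0) = chart_inv c (z0 + w\<^sup>2))" by blast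
  qed (use c H(3) w0 in auto)
qed

text \<open>Writing \<open>H = \<phi> ^ n\<close> with a local coordinate \<open>\<phi>\<close>, the
  equation \<open>H w = t\<close> is solved for small positive \<open>t\<close> by a curve starting
  at \<open>w = 0\<close>. As \<open>H\<close> is a flat parameter, the image is a horizontal curve
  of unit speed issuing from \<open>p\<close>.\<close>

lemma zero_ray:
  assumes c: "c \<in> A" "p \<in> fst c" and p: "\<not> regular p" and an: "q c analytic_on {snd c p}"
  obtains \<epsilon> \<delta> where "0 < \<epsilon>" "\<And>t. t \<in> {0<..<\<epsilon>} \<Longrightarrow> flat_along complex_of_real \<delta> t" "(\<delta> \<longlongrightarrow> p) (at_right 0)"
proof -
  define z0 where "z0 = snd c p"
  obtain \<rho> H where H: "0 < \<rho>" "H holomorphic_on ball 0 \<rho>" "H 0 = 0"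
    "\<And>w. w \<in> ball 0 \<rho> \<Longrightarrow> z0 + w\<^sup>2 \<in> snd c ` fst c"
    "\<And>w. w \<in> ball 0 \<rho> \<Longrightarrow> w \<noteq> 0 \<Longrightarrow> deriv H w \<noteq> 0"
    "\<And>w. w \<in> ball 0 \<rho> \<Longrightarrow> (deriv H w)\<^sup>2 = q c (z0 + w\<^sup>2) * (2 * w)\<^sup>2"
    using zero_chart[OF assms] unfolding z0_def by metis
  have nc: "\<not> H constant_on ball 0 \<rho>"
  proof
    assume "H constant_on ball 0 \<rho>"
    then obtain C where C: "\<And>w. w \<in> ball 0 \<rho> \<Longrightarrow> H w = C" unfolding constant_on_def by blast
    define w where "w = complex_of_real (\<rho> / 2)"
    have w: "w \<in> ball 0 \<rho>" "w \<noteq> 0" using H(1) unfolding w_def by auto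
    have "deriv H w = deriv (\<lambda>_. C) w"
      using C w(1) by (intro deriv_cong_ev) (auto intro!: eventually_mono[OF eventually_nhds_in_open[OF open_ball w(1)]])
    then show False using H(5)[OF w] by simp
  qed
  obtain g r n where g: "0 < n" "0 < r" "ball 0 r \<subseteq> ball (0::complex) \<rho>" "g holomorphic_on ball 0 r"
      "\<And>w. w \<in> ball 0 r \<Longrightarrow> H w = (w - 0) ^ n * g w" "\<And>w. w \<in> ball 0 r \<Longrightarrow> g w \<noteq> 0"
    by (rule holomorphic_factor_zero_nonconstant[OF H(2) open_ball connected_ball _ H(3) nc]) (use H(1) in simp, rule that)
  obtain L where L: "L holomorphic_on ball 0 r" "\<And>w. w \<in> ball 0 r \<Longrightarrow> g w = exp (L w)"
    using contractible_imp_holomorphic_log[OF g(4) convex_imp_contractible[OF convex_ball] g(6)] by metis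
  \<comment> \<open>An \<open>n\<close>-th root of \<open>H\<close>: here \<open>n\<close> is the
    order of its zero at 0, and \<open>exp (L w)\<close> is the non-vanishing cofactor.\<close>
  define \<phi> where "\<phi> w = w * exp (L w / of_nat n)" for w
  have hol: "\<phi> holomorphic_on ball 0 r" unfolding \<phi>_def using L(1) g(1) by (auto intro!: holomorphic_intros)
  have pow: "\<phi> w ^ n = H w" if "w \<in> ball 0 r" for w
  proof -
    have "exp (L w / of_nat n) ^ n = exp (L w)" using g(1) by (simp flip: exp_of_nat_mult)
    then show ?thesis using g(5)[OF that] L(2)[OF that] unfolding \<phi>_def by (simp add: power_mult_distrib)
  qed
  have r0: "0 \<in> ball (0::complex) r" using g(2) by simp
  have "((\<lambda>w. exp (L w / of_nat n)) holomorphic_on ball 0 r)" using L(1) g(1) by (auto intro!: holomorphic_intros)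
  then have "((\<lambda>w. exp (L w / of_nat n)) has_field_derivative deriv (\<lambda>w. exp (L w / of_nat n)) 0) (at 0)"
    using r0 by (intro holomorphic_derivI) auto
  then have "(\<phi> has_field_derivative 1 * exp (L 0 / of_nat n) + deriv (\<lambda>w. exp (L w / of_nat n)) 0 * 0) (at 0)"
    unfolding \<phi>_def by (intro DERIV_mult DERIV_ident)
  then have "deriv \<phi> 0 \<noteq> 0" using DERIV_imp_deriv by fastforce
  then obtain r' where r': "0 < r'" "ball 0 r' \<subseteq> ball (0::complex) r" "open (\<phi> ` ball 0 r')" "inj_on \<phi> (ball 0 r')"
    using has_complex_derivative_locally_invertible[OF hol r0 open_ball] by metis
  obtain \<psi> where \<psi>: "\<psi> holomorphic_on \<phi> ` ball 0 r'" "\<And>w. w \<in> ball 0 r' \<Longrightarrow> \<psi> (\<phi> w) = w"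
    using holomorphic_has_inverse[OF holomorphic_on_subset[OF hol r'(2)] open_ball r'(4)] by metis
  have \<phi>0: "\<phi> 0 = 0" unfolding \<phi>_def by simp
  then have "0 \<in> \<phi> ` ball 0 r'" using r'(1) by (metis centre_in_ball imageI)
  then obtain e where e: "0 < e" "ball 0 e \<subseteq> \<phi> ` ball 0 r'" using r'(3) open_contains_ball by metis
  have \<psi>H: "H (\<psi> \<xi>) = \<xi> ^ n" "\<psi> \<xi> \<in> ball 0 \<rho>" "\<xi> \<noteq> 0 \<Longrightarrow> \<psi> \<xi> \<noteq> 0" if \<xi>: "\<xi> \<in> ball 0 e" for \<xi>
  proof -
    obtain w where w: "w \<in> ball 0 r'" "\<xi> = \<phi> w" using \<xi> e(2) by blast
    then have "w \<in> ball 0 r" "w \<in> ball 0 \<rho>" using r'(2) g(3) by blast+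
    with w show "H (\<psi> \<xi>) = \<xi> ^ n" "\<psi> \<xi> \<in> ball 0 \<rho>" "\<xi> \<noteq> 0 \<Longrightarrow> \<psi> \<xi> \<noteq> 0"
      using \<psi>(2)[OF w(1)] pow[of w] \<phi>0 by auto
  qed
  have \<psi>c: "isCont \<psi> \<xi>" if "\<xi> \<in> ball 0 e" for \<xi>
    using \<psi>(1) r'(3) e(2) that by (meson DERIV_isCont holomorphic_derivI subsetD)
  define w where "w t = \<psi> (of_real (root n t))" for t
  define \<delta> where "\<delta> t = chart_inv c (z0 + (w t)\<^sup>2)" for t
  \<comment> \<open>For positive \<open>t\<close> below \<open>e ^ n\<close> the root
    \<open>root n t\<close> stays in the disc on which \<open>\<psi>\<close> is controlled.\<close>
  define \<epsilon> where "\<epsilon> = e ^ n"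
  have rt: "complex_of_real (root n t) \<in> ball 0 e" "of_real (root n t) \<noteq> (0::complex)" "complex_of_real (root n t) ^ n = of_real t"
    if "t \<in> {0<..<\<epsilon>}" for t
  proof -
    have "root n t < root n \<epsilon>" "0 < root n t" using that g(1) by auto
    then show "complex_of_real (root n t) \<in> ball 0 e" "of_real (root n t) \<noteq> (0::complex)"
      using e(1) g(1) unfolding \<epsilon>_def by (auto simp: real_root_power_cancel)
    show "complex_of_real (root n t) ^ n = of_real t"
      using that g(1) by (simp flip: of_real_power)
  qed
  have rc: "isCont (\<lambda>t. complex_of_real (root n t)) t" for t
    by (intro continuous_intros isCont_real_root)
  have wc: "isCont w t" if "complex_of_real (root n t) \<in> ball 0 e" for t
    unfolding w_def using isCont_o2[OF rc \<psi>c[OF that]] .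
  have Hw: "H (w t) = of_real t" "w t \<in> ball 0 \<rho>" "w t \<noteq> 0" if "t \<in> {0<..<\<epsilon>}" for t
    using \<psi>H[OF rt(1)[OF that]] rt(2,3)[OF that] unfolding w_def by auto
  show ?thesis
  proof
    show "0 < \<epsilon>" unfolding \<epsilon>_def using e(1) by simp
    fix t assume t: "t \<in> {0<..<\<epsilon>}"
    obtain r1 \<Psi> where \<Psi>: "0 < r1" "\<And>\<zeta>. \<zeta> \<in> ball 0 r1 \<Longrightarrow> flat_at \<Psi> \<zeta>"
      "\<forall>\<^sub>F v in nhds (w t). H v - H (w t) \<in> ball 0 r1 \<and> \<Psi> (H v - H (w t)) = chart_inv c (z0 + v\<^sup>2)"
      using zero_chart_flat[OF c(1) H(2,4-6) Hw(2,3)[OF t]] by blast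
    have "\<forall>\<^sub>F s in nhds t. H (w s) - H (w t) \<in> ball 0 r1 \<and> \<Psi> (H (w s) - H (w t)) = chart_inv c (z0 + (w s)\<^sup>2)"
      using isCont_eventually[OF wc[OF rt(1)[OF t]] \<Psi>(3)] .
    moreover have "\<forall>\<^sub>F s in nhds t. s \<in> {0<..<\<epsilon>}" using t by (intro eventually_nhds_in_open) auto
    ultimately have "\<forall>\<^sub>F s in nhds t. \<Psi> (of_real s + - of_real t) = \<delta> s"
      by eventually_elim (use Hw(1) t in \<open>auto simp: \<delta>_def\<close>)
    moreover have "flat_along complex_of_real (\<lambda>s. \<Psi> (of_real s + - of_real t)) t"
      by (rule flat_along_I[of "ball 0 r1"]) (use \<Psi>(1,2) in auto)
    ultimately show "flat_along complex_of_real \<delta> t" by (rule flat_along_cong)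
  next
    have \<psi>0: "\<psi> 0 = 0" using \<psi>(2)[of 0] r'(1) \<phi>0 by simp
    have "isCont (\<lambda>t. z0 + (w t)\<^sup>2) 0"
      using wc[of 0] e(1) by (intro continuous_intros) auto
    moreover have "z0 + (w 0)\<^sup>2 = z0" unfolding w_def using \<psi>0 by simp
    moreover have "isCont (chart_inv c) z0" unfolding z0_def using chart_isCont(2)[OF surface c] .
    ultimately have "isCont \<delta> 0" unfolding \<delta>_def using isCont_o2[where f = "\<lambda>t. z0 + (w t)\<^sup>2" and a = 0 and g = "chart_inv c"] by simp
    moreover have "\<delta> 0 = p" unfolding \<delta>_def w_def using \<psi>0 chart_inv_simps(1)[OF surface c] by (simp add: z0_def)
    ultimately show "(\<delta> \<longlongrightarrow> p) (at_right 0)"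
      unfolding isCont_def by (metis at_le filterlim_mono order_refl subset_UNIV)
  qed
qed

text \<open>A trajectory starting at \<open>p\<close> is lifted through
  \<open>z0 + w\<^sup>2\<close>. Along the lift \<open>Im (H w)\<close> is constant and tends to
  \<open>Im (H 0) = 0\<close>, so the trajectory passes through \<open>P w\<close> for some
  \<open>w\<close> in the real locus \<open>S\<close>. On \<open>S\<close> the trajectory through
  \<open>P w\<close> depends on \<open>w\<close> in a locally constant way, so only countably many
  arise.\<close>

lemma zero_ends_countable:
  assumes c: "c \<in> A" "p \<in> fst c" and p: "\<not> regular p" and an: "q c analytic_on {snd c p}"
  shows "countable {T. trajectory A q T \<and> (\<exists>a b \<delta>. a < b \<and> horizontal_geodesic A q {a<..<b} \<delta> \<and>
      T = \<delta> ` {a<..<b} \<and> (\<delta> \<longlongrightarrow> p) (at_right a))}" (is "countable ?C")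
proof -
  define z0 where "z0 = snd c p"
  obtain \<rho> H where H: "0 < \<rho>" "H holomorphic_on ball 0 \<rho>" "H 0 = 0"
    "\<And>w. w \<in> ball 0 \<rho> \<Longrightarrow> z0 + w\<^sup>2 \<in> snd c ` fst c"
    "\<And>w. w \<in> ball 0 \<rho> \<Longrightarrow> w \<noteq> 0 \<Longrightarrow> deriv H w \<noteq> 0"
    "\<And>w. w \<in> ball 0 \<rho> \<Longrightarrow> (deriv H w)\<^sup>2 = q c (z0 + w\<^sup>2) * (2 * w)\<^sup>2"
    using zero_chart[OF assms] unfolding z0_def by metis
  have Hc: "isCont H w" if "w \<in> ball 0 \<rho>" for w
    using H(2) that by (meson DERIV_isCont holomorphic_derivI open_ball)
  define P where "P w = chart_inv c (z0 + w\<^sup>2)" for w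
  define S where "S = {w \<in> ball 0 \<rho> - {0}. Im (H w) = 0}"
  \<comment> \<open>The trajectory through \<open>P w\<close> is recorded as a singleton set, which
    \<open>the_elem\<close> unpacks at the end.\<close>
  define F where "F w = {T. trajectory A q T \<and> P w \<in> T}" for w
  have flat: "\<exists>r \<Psi>. 0 < r \<and> (\<forall>\<zeta>\<in>ball 0 r. flat_at \<Psi> \<zeta>) \<and>
    (\<forall>\<^sub>F w in nhds w0. H w - H w0 \<in> ball 0 r \<and> \<Psi> (H w - H w0) = P w)" if "w0 \<in> ball 0 \<rho> - {0}" for w0
    unfolding P_def by (rule zero_chart_flat[OF c(1) H(2,4-6)]) (use that in auto)
  have "countable (F ` S)"
  proof (rule countable_locally_constant)
    fix w0 assume w0: "w0 \<in> S"
    then obtain r \<Psi> where \<Psi>: "0 < r" "\<And>\<zeta>. \<zeta> \<in> ball 0 r \<Longrightarrow> flat_at \<Psi> \<zeta>"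
      "\<forall>\<^sub>F w in nhds w0. H w - H w0 \<in> ball 0 r \<and> \<Psi> (H w - H w0) = P w"
      using flat[of w0] unfolding S_def by blast
    have "\<Psi> 0 = P w0" using eventually_nhds_x_imp_x[OF \<Psi>(3)] by simp
    moreover have "regular (\<Psi> 0)" using flat_at_regular[OF \<Psi>(2)] \<Psi>(1) by simp
    ultimately have "regular (P w0)" by simp
    then obtain I \<gamma> where \<gamma>: "maximal_curve I \<gamma>" "0 \<in> I" "\<gamma> 0 = P w0" using maximal_curve_at by blast
    have "\<Psi> 0 = \<gamma> 0" using \<gamma>(3) \<open>\<Psi> 0 = P w0\<close> by simp
    then obtain \<sigma> where \<sigma>: "\<sigma> \<in> {1, -1::real}" "\<And>s. \<bar>s\<bar> < r \<Longrightarrow> 0 + s \<in> I \<and> \<gamma> (0 + s) = \<Psi> (of_real (\<sigma> * s))"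
      using maximal_curve_extend[OF \<gamma>(1,2) \<Psi>(1,2)] by metis
    obtain U where U: "open U" "w0 \<in> U" "\<And>w. w \<in> U \<Longrightarrow> H w - H w0 \<in> ball 0 r \<and> \<Psi> (H w - H w0) = P w"
      using \<Psi>(3) unfolding eventually_nhds by blast
    \<comment> \<open>On \<open>S\<close> the increment of \<open>H\<close> is real, so
      \<open>P w\<close> lies on the horizontal diameter covered by the maximal curve.\<close>
    have "P w \<in> \<gamma> ` I" if w: "w \<in> U \<inter> S" for w
    proof -
      define s where "s = Re (H w)"
      have Hw: "H w - H w0 = of_real (s - Re (H w0))" using w w0 unfolding S_def s_def by (auto simp: complex_eq_iff)
      have "\<bar>\<sigma> * (s - Re (H w0))\<bar> < r"
        using U(3)[of w] w \<sigma>(1) unfolding Hw by (auto simp del: of_real_diff simp: abs_minus_commute)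
      from \<sigma>(2)[OF this] have "\<sigma> * (s - Re (H w0)) \<in> I" "\<gamma> (\<sigma> * (s - Re (H w0))) = \<Psi> (of_real (\<sigma> * (\<sigma> * (s - Re (H w0)))))"
        by simp_all
      moreover have "\<sigma> * (\<sigma> * (s - Re (H w0))) = s - Re (H w0)" using \<sigma>(1) by auto
      moreover have "\<Psi> (of_real (s - Re (H w0))) = P w" using U(3)[of w] w unfolding Hw by simp
      ultimately show ?thesis by (metis image_eqI)
    qed
    then have *: "F w = {\<gamma> ` I}" if "w \<in> U \<inter> S" for w
      using that trajectory_eq_maximal_curve[OF \<gamma>(1)] maximal_curve_trajectory[OF \<gamma>(1)] unfolding F_def by blast
    then have "F w = F w0" if "w \<in> U \<inter> S" for w using that w0 U(2) by blast
    then show "\<exists>U. open U \<and> w0 \<in> U \<and> (\<forall>w\<in>U \<inter> S. F w = F w0)" using U(1,2) by blast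
  qed
  then have "countable (the_elem ` F ` S)" by simp
  moreover have "?C \<subseteq> the_elem ` F ` S"
  proof
    fix T assume "T \<in> ?C"
    then obtain a b \<delta> where T: "trajectory A q T" "a < b" "horizontal_geodesic A q {a<..<b} \<delta>"
      "T = \<delta> ` {a<..<b}" "(\<delta> \<longlongrightarrow> p) (at_right a)" by blast
    have "open {x \<in> fst c. dist (snd c x) z0 < \<rho>\<^sup>2}"
    proof -
      have "continuous_on (fst c) (snd c)" using riemann_surface_chart(3)[OF surface c(1)] unfolding homeomorphism_def by blast
      then have "open (fst c \<inter> snd c -` ball z0 (\<rho>\<^sup>2))"
        using riemann_surface_chart(1)[OF surface c(1)] by (intro continuous_open_preimage) auto
      moreover have "fst c \<inter> snd c -` ball z0 (\<rho>\<^sup>2) = {x \<in> fst c. dist (snd c x) z0 < \<rho>\<^sup>2}"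
        by (auto simp: dist_commute)
      ultimately show ?thesis by simp
    qed
    moreover have "p \<in> {x \<in> fst c. dist (snd c x) z0 < \<rho>\<^sup>2}" using c(2) H(1) unfolding z0_def by simp
    ultimately have "\<forall>\<^sub>F t in at_right a. \<delta> t \<in> {x \<in> fst c. dist (snd c x) z0 < \<rho>\<^sup>2}"
      by (rule topological_tendstoD[OF T(5)])
    then obtain b' where b': "a < b'" "\<And>t. a < t \<Longrightarrow> t < b' \<Longrightarrow> \<delta> t \<in> fst c \<and> dist (snd c (\<delta> t)) z0 < \<rho>\<^sup>2"
      unfolding eventually_at_right_field by auto
    define I where "I = {a<..<min b b'}"
    have I: "\<delta> t \<in> fst c" "dist (snd c (\<delta> t)) z0 < \<rho>\<^sup>2" "t \<in> {a<..<b}" if "t \<in> I" for t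
      using b'(2) that unfolding I_def by auto
    define z where "z t = snd c (\<delta> t) - z0" for t
    have "continuous_on {a<..<b} \<delta>" using T(3) unfolding horizontal_geodesic_def by blast
    then have \<delta>c: "isCont \<delta> t" if "t \<in> I" for t using I(3)[OF that] by (simp add: continuous_on_eq_continuous_at)
    have zc: "continuous_on I z"
    proof (intro continuous_at_imp_continuous_on ballI)
      fix t assume t: "t \<in> I"
      have "isCont (\<lambda>t. snd c (\<delta> t)) t"
        using isCont_o2[OF \<delta>c[OF t] chart_isCont(1)[OF surface c(1) I(1)[OF t]]] .
      then show "isCont z t" unfolding z_def by (intro continuous_intros)
    qed
    have z0ne: "z t \<noteq> 0" if "t \<in> I" for t
    proof
      assume "z t = 0"
      then have "\<delta> t = p" using chart_inj[OF surface c(1) I(1)[OF that] c(2)] unfolding z_def z0_def by simp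
      then show False using p horizontal_geodesic_regular[OF T(3) I(3)[OF that]] by simp
    qed
    have "convex I" unfolding I_def by (rule convex_real_interval)
    \<comment> \<open>The lift to the \<open>w\<close>-plane: a continuous square root exists along
      the whole interval, which is contractible and on which \<open>z\<close> has no zero.\<close>
    obtain g where g: "continuous_on I g" "\<And>t. t \<in> I \<Longrightarrow> z t = (g t)\<^sup>2"
      using continuous_sqrt_on_contractible[OF zc convex_imp_contractible[OF \<open>convex I\<close>] z0ne] by metis
    have gc: "isCont g t" if "t \<in> I" for t using g(1) that unfolding I_def by (simp add: continuous_on_eq_continuous_at)
    have gb: "g t \<in> ball 0 \<rho> - {0}" if "t \<in> I" for t
    proof -
      have "(norm (g t))\<^sup>2 = norm (z t)" using g(2)[OF that] by (simp add: norm_power)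
      then have "(norm (g t))\<^sup>2 < \<rho>\<^sup>2" using I(2)[OF that] unfolding z_def by (simp add: dist_norm)
      then have "norm (g t) < \<rho>" using H(1) by (simp add: power_less_imp_less_base)
      then show ?thesis using z0ne[OF that] g(2)[OF that] by auto
    qed
    have Pg: "P (g t) = \<delta> t" if "t \<in> I" for t
    proof -
      have "z0 + (g t)\<^sup>2 = snd c (\<delta> t)" using g(2)[OF that] unfolding z_def by (simp add: algebra_simps)
      then show ?thesis using chart_inv_simps(1)[OF surface c(1) I(1)[OF that]] unfolding P_def by simp
    qed
    \<comment> \<open>In the flat map \<open>\<Psi>\<close> the increment of \<open>H\<close> along
      the lift and the real position \<open>x\<close> of the geodesic describe the same point, so
      they are equal by local injectivity.\<close>
    have const: "Im (H (g t)) = Im (H (g s))" if "s \<in> I" "t \<in> I" for s t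
    proof (rule connected_equivalence_relation[of I t s "\<lambda>t s. Im (H (g t)) = Im (H (g s))"])
      show "connected I" using \<open>convex I\<close> by (rule convex_connected)
      fix t assume t: "t \<in> I"
      obtain r \<Psi> where \<Psi>: "0 < r" "\<And>\<zeta>. \<zeta> \<in> ball 0 r \<Longrightarrow> flat_at \<Psi> \<zeta>"
        "\<forall>\<^sub>F w in nhds (g t). H w - H (g t) \<in> ball 0 r \<and> \<Psi> (H w - H (g t)) = P w"
        using flat[OF gb[OF t]] by blast
      have r0: "0 \<in> ball (0::complex) r" using \<Psi>(1) by simp
      have "\<Psi> 0 = \<delta> t" using eventually_nhds_x_imp_x[OF \<Psi>(3)] Pg[OF t] by simp
      then obtain x where x: "isCont x t" "x t = 0"
        "\<forall>\<^sub>F s in nhds t. s \<in> {a<..<b} \<and> 0 + complex_of_real (x s) \<in> ball 0 r \<and> \<delta> s = \<Psi> (0 + of_real (x s))"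
        using horizontal_geodesic_flat[OF T(3) I(3)[OF t] open_ball \<Psi>(2) r0] by blast
      obtain e where e: "0 < e" "inj_on \<Psi> (ball 0 e)" using flat_locally_inj[OF open_ball \<Psi>(2) r0] by metis
      have "\<forall>\<^sub>F s in nhds t. s \<in> I" using t unfolding I_def by (intro eventually_nhds_in_open) auto
      moreover have "\<forall>\<^sub>F s in nhds t. H (g s) - H (g t) \<in> ball 0 r \<and> \<Psi> (H (g s) - H (g t)) = P (g s)"
        using isCont_eventually[OF gc[OF t] \<Psi>(3)] .
      moreover have "isCont (\<lambda>s. H (g s)) t" using isCont_o2[OF gc[OF t] Hc] gb[OF t] by simp
      then have "\<forall>\<^sub>F s in nhds t. H (g s) \<in> ball (H (g t)) e" using e(1) by (intro isCont_eventually_in) auto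
      moreover have "\<forall>\<^sub>F s in nhds t. x s \<in> {-e<..<e}" using x(1,2) e(1) by (intro isCont_eventually_in) auto
      ultimately have "\<forall>\<^sub>F s in nhds t. Im (H (g t)) = Im (H (g s))"
        using x(3)
      proof eventually_elim
        case (elim s)
        have "\<Psi> (H (g s) - H (g t)) = \<Psi> (of_real (x s))" using elim Pg by simp
        then have "H (g s) - H (g t) = of_real (x s)"
          by (rule inj_onD[OF e(2)]) (use elim in \<open>auto simp: dist_norm norm_minus_commute\<close>)
        then show ?case by (simp add: complex_eq_iff)
      qed
      then show "\<exists>U. openin (top_of_set I) U \<and> t \<in> U \<and> (\<forall>s\<in>U. Im (H (g t)) = Im (H (g s)))"
        using t by (rule eventually_nhds_openin)
    qed (use that in auto)
    define t1 where "t1 = (a + min b b') / 2"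
    have t1: "t1 \<in> I" using T(2) b'(1) unfolding I_def t1_def by auto
    have evI: "\<forall>\<^sub>F t in at_right a. t \<in> I"
      unfolding eventually_at_right_field I_def using T(2) b'(1) by (intro exI[of _ "min b b'"]) auto
    have "((\<lambda>t. snd c (\<delta> t)) \<longlongrightarrow> z0) (at_right a)"
      using isCont_tendsto_compose[OF chart_isCont(1)[OF surface c] T(5)] unfolding z0_def .
    then have "((\<lambda>t. snd c (\<delta> t) - z0) \<longlongrightarrow> z0 - z0) (at_right a)" by (intro tendsto_intros)
    then have "(z \<longlongrightarrow> 0) (at_right a)" unfolding z_def by simp
    then have "((\<lambda>t. sqrt (norm (z t))) \<longlongrightarrow> sqrt (norm (0::complex))) (at_right a)" by (intro tendsto_intros)
    moreover have "\<forall>\<^sub>F t in at_right a. sqrt (norm (z t)) = norm (g t)"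
      using evI by eventually_elim (use g(2) in \<open>simp add: norm_power\<close>)
    ultimately have "((\<lambda>t. norm (g t)) \<longlongrightarrow> 0) (at_right a)" using tendsto_cong by force
    then have "(g \<longlongrightarrow> 0) (at_right a)" by (rule tendsto_norm_zero_cancel)
    then have "((\<lambda>t. H (g t)) \<longlongrightarrow> H 0) (at_right a)" by (rule isCont_tendsto_compose[OF Hc, rotated]) (use H(1) in simp)
    then have "((\<lambda>t. Im (H (g t))) \<longlongrightarrow> Im (H 0)) (at_right a)" by (rule tendsto_Im)
    moreover have "\<forall>\<^sub>F t in at_right a. Im (H (g t)) = Im (H (g t1))"
      using evI by eventually_elim (use const t1 in blast)
    ultimately have "((\<lambda>t. Im (H (g t1))) \<longlongrightarrow> Im (H 0)) (at_right a)" using tendsto_cong by force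
    then have "Im (H (g t1)) = 0" using H(3) by (simp add: tendsto_const_iff)
    then have "g t1 \<in> S" using gb[OF t1] unfolding S_def by blast
    moreover have "F (g t1) = {T}"
    proof -
      have "\<delta> t1 \<in> T" unfolding T(4) using I(3)[OF t1] by blast
      then show ?thesis using Pg[OF t1] T(1) trajectories_eq unfolding F_def by auto
    qed
    ultimately show "T \<in> the_elem ` F ` S" by (metis image_eqI the_elem_eq)
  qed
  ultimately show ?thesis using countable_subset by blast
qed

lemma finite_critical_points:
  assumes "compact (UNIV :: 'a set)"
  shows "finite {x. \<not> regular x}"
proof -
  have "\<exists>U. open U \<and> x \<in> U \<and> (\<forall>y\<in>U. y \<noteq> x \<longrightarrow> regular y)" for x
    using regular_near[of x] unfolding eventually_at_topological by blast
  then obtain U where U: "\<And>x. open (U x)" "\<And>x. x \<in> U x" "\<And>x y. y \<in> U x \<Longrightarrow> y \<noteq> x \<Longrightarrow> regular y" by metis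
  obtain C where "finite C" "UNIV \<subseteq> (\<Union>x\<in>C. U x)"
    using compactE_image[OF assms, of UNIV U] U(1,2) by (metis UNIV_I UN_I subsetI)
  then have "{x. \<not> regular x} \<subseteq> C" using U(3) by blast
  then show ?thesis using \<open>finite C\<close> finite_subset by blast
qed

end

subsection \<open>The complement of the critical graph\<close>

locale strebel =
  fixes A :: "'a::t2_space chart set" and q :: "'a differential"
  assumes surf: "riemann_surface A" and compact_surface: "compact (UNIV :: 'a set)"
    and conn: "connected (UNIV :: 'a set)" and strebel: "strebel_differential A q"
begin

sublocale nonzero_quadratic_differential A q
proof
  show "riemann_surface A" by (rule surf)
  have JS: "JS_differential A q" using strebel unfolding strebel_differential_def by blast
  then show md: "meromorphic_differential 2 A q" unfolding JS_differential_def by blast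
  show "connected (UNIV :: 'a set)" by (rule conn)
  obtain c x where "c \<in> A" "x \<in> fst c" "q c (snd c x) \<noteq> 0"
    using JS unfolding JS_differential_def by blast
  then show "\<exists>x. quadratic_differential.regular A q x"
    using quadratic_differential.regular_def[OF quadratic_differential.intro[OF surf md]] by blast
qed

abbreviation "G \<equiv> critical_graph A q"

lemma orders: "order_at A q x \<ge> -2" "order_at A q x \<noteq> -1"
  using strebel unfolding strebel_differential_def JS_differential_def simple_poles_def by auto

lemma component_facts:
  assumes "D \<in> components (- G)"
  shows "open D" "D homeomorphic ball (0::complex) 1" "\<exists>!p. p \<in> D \<inter> double_poles A q"
    "connected D" "D \<subseteq> - G" "D \<noteq> {}"
  using assms strebel in_components_connected in_components_subset in_components_nonempty
  unfolding strebel_differential_def by blast+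

text \<open>Openness of the components belongs to the notion of a Strebel differential, and their
  union is the complement.\<close>

lemma closed_graph: "closed G"
proof -
  have "- G = \<Union>(components (- G))" by simp
  then have "open (- G)" using component_facts(1) by (metis open_Union)
  then show ?thesis by (simp add: closed_def)
qed

text \<open>A counting argument: the components contain pairwise distinct double poles and are
  equally many, so every double pole lies in a component.\<close>

lemma double_poles_not_in_graph:
  assumes "p \<in> double_poles A q"
  shows "p \<notin> G"
proof -
  let ?C = "components (- G)"
  have fin: "finite (double_poles A q)" "card ?C = card (double_poles A q)" "card (double_poles A q) \<ge> 1"
    using strebel unfolding strebel_differential_def by auto
  define f where "f D = (THE p. p \<in> D \<inter> double_poles A q)" for D
  have f: "f D \<in> D \<inter> double_poles A q" if "D \<in> ?C" for D
    unfolding f_def using theI'[OF component_facts(3)[OF that]] .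
  have "inj_on f ?C"
  proof (rule inj_onI)
    fix D E assume D: "D \<in> ?C" "E \<in> ?C" "f D = f E"
    then have "f D \<in> D \<inter> E" using f[of D] f[of E] by auto
    then show "D = E" using components_nonoverlap[OF D(1,2)] by blast
  qed
  then have "card (f ` ?C) = card (double_poles A q)" using fin(2) card_image by metis
  moreover have "f ` ?C \<subseteq> double_poles A q" using f by blast
  ultimately have "f ` ?C = double_poles A q" using fin(1) card_subset_eq by blast
  then obtain D where "D \<in> ?C" "p = f D" using assms by blast
  then have "D \<in> ?C" "p \<in> D" using f by auto
  then show ?thesis using component_facts(5) by blast
qed

text \<open>No pole lies on the graph: simple poles do not exist, and double poles lie in the
  complement.\<close>

lemma graph_analytic:
  assumes "p \<in> G"
  shows "q (chart_at A p) analytic_on {snd (chart_at A p) p}"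
proof (rule order_nonneg_analytic)
  have "order_at A q p \<noteq> -2" using double_poles_not_in_graph assms unfolding double_poles_def by blast
  then show "order_at A q p \<ge> 0" using orders[of p] by linarith
qed

text \<open>A critical trajectory starts at one of the finitely many critical points; this point is
  a vertex of the graph, where \<open>q\<close> is analytic, so \<open>zero_ends_countable\<close>
  applies to it.\<close>

lemma countable_critical_trajectories: "countable {T. critical_trajectory A q T}"
proof -
  define E where "E p = {T. trajectory A q T \<and> (\<exists>a b \<delta>. a < b \<and> horizontal_geodesic A q {a<..<b} \<delta> \<and>
      T = \<delta> ` {a<..<b} \<and> (\<delta> \<longlongrightarrow> p) (at_right a))}" for p
  have "{T. critical_trajectory A q T} \<subseteq> (\<Union>p\<in>{p \<in> G. \<not> regular p}. E p)"
  proof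
    fix T assume "T \<in> {T. critical_trajectory A q T}"
    then obtain p p' where p: "critical_point A q p" "critical_point A q p'" "trajectory_connects A q T p p'"
      unfolding critical_trajectory_def by blast
    then have "p \<in> G" unfolding critical_graph_def by blast
    moreover have "T \<in> E p" using p(3) unfolding trajectory_connects_def E_def by blast
    ultimately show "T \<in> (\<Union>p\<in>{p \<in> G. \<not> regular p}. E p)" using p(1) critical_point_iff by blast
  qed
  moreover have "countable (\<Union>p\<in>{p \<in> G. \<not> regular p}. E p)"
  proof (rule countable_UN)
    have "finite {p \<in> G. \<not> regular p}" using finite_critical_points[OF compact_surface] by (rule rev_finite_subset) blast
    then show "countable {p \<in> G. \<not> regular p}" by (rule countable_finite)
    show "countable (E p)" if "p \<in> {p \<in> G. \<not> regular p}" for p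
      unfolding E_def using zero_ends_countable[OF chart_at_in[OF surface]] graph_analytic that by blast
  qed
  ultimately show ?thesis by (rule countable_subset)
qed

lemma graph_cases:
  assumes "x \<in> G" "regular x"
  obtains T where "critical_trajectory A q T" "x \<in> T"
  using assms critical_point_iff unfolding critical_graph_def critical_trajectory_def by blast

lemma critical_trajectory_subset_graph: "critical_trajectory A q T \<Longrightarrow> T \<subseteq> G"
  unfolding critical_graph_def critical_trajectory_def by blast

text \<open>Critical trajectories lie in the graph and recurrent ones do not exist, so only a closed
  one is left. A common point with the graph would be regular, hence on a critical trajectory, which
  would have to coincide with \<open>T\<close>.\<close>

lemma trajectory_off_graph:
  assumes "trajectory A q T" "x \<in> T" "x \<notin> G"
  shows "closed_trajectory A q T" "T \<inter> G = {}"
proof -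
  have T: "\<not> critical_trajectory A q T" using critical_trajectory_subset_graph assms(2,3) by blast
  have "\<not> recurrent_trajectory A q T" using strebel unfolding strebel_differential_def JS_differential_def by blast
  then show "closed_trajectory A q T" using T assms(1) unfolding recurrent_trajectory_def by blast
  show "T \<inter> G = {}"
  proof (rule ccontr)
    assume "T \<inter> G \<noteq> {}"
    then obtain y where y: "y \<in> T" "y \<in> G" by blast
    then obtain T' where T': "critical_trajectory A q T'" "y \<in> T'"
      using graph_cases[OF y(2) regular_trajectory[OF assms(1) y(1)]] by blast
    then have "trajectory A q T'" unfolding critical_trajectory_def trajectory_connects_def by blast
    then show False using trajectories_eq[OF assms(1) _ y(1) T'(2)] T T'(1) by blast
  qed
qed

lemma trajectory_in_component:
  assumes D: "D \<in> components (- G)" and T: "trajectory A q T" "x \<in> T" "x \<in> D"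
  shows "closed_trajectory A q T" "T \<subseteq> D"
proof -
  have x: "x \<notin> G" using component_facts(5)[OF D] T(3) by blast
  show "closed_trajectory A q T" using trajectory_off_graph(1)[OF T(1,2) x] .
  obtain I \<gamma> where I: "horizontal_geodesic A q I \<gamma>" "T = \<gamma> ` I" using T(1) unfolding trajectory_def by blast
  then have "connected I" "continuous_on I \<gamma>" unfolding horizontal_geodesic_def is_interval_connected_1 by blast+
  then have "connected T" unfolding I(2) by (intro connected_continuous_image)
  moreover have "T \<subseteq> - G" using trajectory_off_graph(2)[OF T(1,2) x] by blast
  ultimately show "T \<subseteq> D" using components_maximal[OF D] T(2,3) by blast
qed

text \<open>A ray issuing from a zero in \<open>D\<close> extends to a trajectory that enters
  \<open>D\<close> and hence is closed, whatever happens at its other end. A closed trajectory is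
  compact, so it contains the zero as a limit of its points; but trajectories consist of regular
  points.\<close>

lemma component_regular:
  assumes D: "D \<in> components (- G)" and p: "p \<in> D" "p \<in> double_poles A q" and x: "x \<in> D" "x \<noteq> p"
  shows "regular x"
proof (rule ccontr)
  assume nr: "\<not> regular x"
  have "x \<notin> double_poles A q" using component_facts(3)[OF D] p x by blast
  then have "order_at A q x \<ge> 0" using orders[of x] unfolding double_poles_def by fastforce
  then have an: "q (chart_at A x) analytic_on {snd (chart_at A x) x}" by (rule order_nonneg_analytic)
  obtain \<epsilon> \<delta> where \<delta>: "0 < \<epsilon>" "\<And>t. t \<in> {0<..<\<epsilon>} \<Longrightarrow> flat_along complex_of_real \<delta> t" "(\<delta> \<longlongrightarrow> x) (at_right 0)"
    using zero_ray[OF chart_at_in[OF surface] nr an] by metis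
  have "\<epsilon> / 2 \<in> {0<..<\<epsilon>}" using \<delta>(1) by simp
  then obtain I \<gamma> where \<gamma>: "maximal_curve I \<gamma>" "{0<..<\<epsilon>} \<subseteq> I" "\<And>t. t \<in> {0<..<\<epsilon>} \<Longrightarrow> \<gamma> t = \<delta> t"
    using maximal_curve_exists[OF open_greaterThanLessThan connected_Ioo _ \<delta>(2)] by blast
  define T where "T = \<gamma> ` I"
  have T: "trajectory A q T" unfolding T_def by (rule maximal_curve_trajectory[OF \<gamma>(1)])
  have in_T: "\<delta> t \<in> T" if "t \<in> {0<..<\<epsilon>}" for t
    unfolding T_def using \<gamma>(2) \<gamma>(3)[OF that] that by (metis image_eqI subsetD)
  have ev: "\<forall>\<^sub>F t in at_right 0. \<delta> t \<in> T"
    unfolding eventually_at_right_field using \<delta>(1) in_T by (intro exI[of _ \<epsilon>]) auto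
  have "\<forall>\<^sub>F t in at_right 0. \<delta> t \<in> D"
    using topological_tendstoD[OF \<delta>(3) component_facts(1)[OF D] x(1)] .
  with ev have "\<forall>\<^sub>F t in at_right 0. \<delta> t \<in> T \<and> \<delta> t \<in> D" by eventually_elim auto
  then obtain t where "\<delta> t \<in> T" "\<delta> t \<in> D"
    using eventually_happens[of _ "at_right (0::real)"] by auto
  then have "closed_trajectory A q T" using trajectory_in_component(1)[OF D T] by blast
  then obtain "compact T" using closed_trajectory_periodic[OF _ \<open>\<delta> t \<in> T\<close>] by blast
  then have "x \<in> T"
    using Lim_in_closed_set[OF compact_imp_closed ev _ \<delta>(3)] by simp
  then show False using regular_trajectory[OF T] nr by blast
qed

lemma component_cylinder:
  assumes D: "D \<in> components (- G)"
  obtains p J \<Phi> \<l> where "p \<in> D" "p \<in> double_poles A q" "cylinder (D - {p}) J \<Phi> \<l>" "\<not> compact (D - {p})"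
    "\<And>\<alpha>. \<alpha> \<in> J \<Longrightarrow> \<exists>K. compact K \<and> K \<subseteq> D \<and> (\<forall>\<zeta>. Im \<zeta> \<in> J \<longrightarrow> \<Phi> \<zeta> \<notin> K \<longrightarrow> Im \<zeta> < \<alpha>)"
proof -
  obtain p where p: "p \<in> D" "p \<in> double_poles A q" using component_facts(3)[OF D] by blast
  have iso: "\<not> open {p}"
  proof
    assume "open {p}"
    then have "\<forall>\<^sub>F y in at p. False" unfolding eventually_at_topological by blast
    then show False using chart_at_neq_bot[OF surface] by simp
  qed
  have oD: "open D" using component_facts(1)[OF D] .
  \<comment> \<open>Otherwise \<open>p\<close> would be an isolated point, as \<open>D\<close> is
    open.\<close>
  have nc: "\<not> compact (D - {p})"
  proof
    assume "compact (D - {p})"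
    then have "open (D \<inter> - (D - {p}))" using oD compact_imp_closed by blast
    moreover have "D \<inter> - (D - {p}) = {p}" using p(1) by blast
    ultimately show False using iso by simp
  qed
  have "D \<noteq> {p}" using iso oD by metis
  \<comment> \<open>A plane disc stays connected when a point is removed, and \<open>D\<close> is
    homeomorphic to one.\<close>
  have "connected (D - {p})"
  proof -
    obtain f g where fg: "homeomorphism D (ball (0::complex) 1) f g"
      using component_facts(2)[OF D] unfolding homeomorphic_def by blast
    have "g ` (ball 0 1 - {f p}) = D - {p}"
    proof (intro equalityI subsetI)
      fix y assume "y \<in> g ` (ball 0 1 - {f p})"
      then show "y \<in> D - {p}" using fg unfolding homeomorphism_def by fastforce
    next
      fix y assume y: "y \<in> D - {p}"
      then have "f y \<noteq> f p" using fg p(1) unfolding homeomorphism_def by (metis DiffD1 DiffD2 singletonI)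
      then show "y \<in> g ` (ball 0 1 - {f p})" using fg y unfolding homeomorphism_def
        by (intro image_eqI[of _ _ "f y"]) auto
    qed
    moreover have "connected (ball 0 1 - {f p})" by (intro connected_punctured_convex) (auto simp: aff_dim_open)
    moreover have "continuous_on (ball 0 1 - {f p}) g"
      using fg unfolding homeomorphism_def by (blast intro: continuous_on_subset)
    ultimately show ?thesis using connected_continuous_image by metis
  qed
  moreover have "\<exists>T. closed_trajectory A q T \<and> x \<in> T \<and> T \<subseteq> D - {p}" if x: "x \<in> D - {p}" for x
  proof -
    have "regular x" using component_regular[OF D p] x by blast
    then obtain I \<gamma> where \<gamma>: "maximal_curve I \<gamma>" "0 \<in> I" "\<gamma> 0 = x" using maximal_curve_at by blast
    have T: "trajectory A q (\<gamma> ` I)" "x \<in> \<gamma> ` I" using maximal_curve_trajectory[OF \<gamma>(1)] \<gamma>(2,3) by auto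
    have "\<not> regular p" using p(2) critical_point_iff unfolding double_poles_def critical_point_def by fastforce
    then have "p \<notin> \<gamma> ` I" using regular_trajectory[OF T(1)] by blast
    then show ?thesis using trajectory_in_component[OF D T] x T(2) by blast
  qed
  ultimately obtain J \<Phi> \<l> where "cylinder (D - {p}) J \<Phi> \<l>"
    "\<And>\<alpha>. \<alpha> \<in> J \<Longrightarrow> \<exists>K. compact K \<and> K \<subseteq> D \<and> (\<forall>\<zeta>. Im \<zeta> \<in> J \<longrightarrow> \<Phi> \<zeta> \<notin> K \<longrightarrow> Im \<zeta> < \<alpha>)"
    using punctured_disc_cylinder[OF oD p(1) _ \<open>D \<noteq> {p}\<close> nc] by blast
  then show ?thesis using that p nc by blast
qed

end

subsection \<open>Primitives on the spectral cover\<close>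

context nonzero_quadratic_differential
begin

text \<open>\<open>L\<close> is the leading Laurent coefficient; that it is non-zero will obstruct
  local primitives of \<open>\<omega>\<close> over \<open>p\<close>.\<close>

lemma double_pole_limit:
  assumes "p \<in> double_poles A q" "c = chart_at A p"
  obtains L where "L \<noteq> 0" "((\<lambda>w. q c w * (w - snd c p)\<^sup>2) \<longlongrightarrow> L) (at (snd c p))"
proof -
  define c0 where "c0 = snd c p"
  have c: "c \<in> A" "p \<in> fst c" using chart_at_in[OF surface] assms(2) by auto
  have zo: "zorder (q c) c0 = -2" using assms unfolding double_poles_def order_at_def c0_def by simp
  have "q c meromorphic_on (snd c ` fst c)"
    using quadratic c(1) unfolding meromorphic_differential_def nicely_meromorphic_on_def by blast
  then have "q c meromorphic_on {c0}"
    by (rule meromorphic_on_subset) (use c(2) in \<open>auto simp: c0_def\<close>)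
  then have iso: "isolated_singularity_at (q c) c0" "not_essential (q c) c0"
    using meromorphic_on_isolated_singularity meromorphic_on_not_essential by auto
  have "\<exists>\<^sub>F z in at c0. q c z \<noteq> 0"
    using quadratic_nonzero_near[OF c] unfolding c0_def by (simp add: eventually_frequently)
  from zorder_exist[OF iso this] obtain r where r: "zor_poly (q c) c0 c0 \<noteq> 0" "0 < r"
    "zor_poly (q c) c0 holomorphic_on cball c0 r"
    "\<And>w. w \<in> cball c0 r - {c0} \<Longrightarrow> q c w = zor_poly (q c) c0 w * (w - c0) powi (-2)"
    unfolding zo by blast
  let ?h = "zor_poly (q c) c0"
  have "isCont ?h c0"
    using holomorphic_on_subset[OF r(3) ball_subset_cball] r(2)
    by (meson DERIV_isCont centre_in_ball holomorphic_derivI open_ball)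
  then have "(?h \<longlongrightarrow> ?h c0) (at c0)" by (simp add: isCont_def)
  moreover have "\<forall>\<^sub>F w in at c0. ?h w = q c w * (w - c0)\<^sup>2"
    unfolding eventually_at
  proof (intro exI[of _ r] conjI ballI impI)
    fix w assume w: "w \<noteq> c0 \<and> dist w c0 < r"
    then have "q c w = ?h w * (w - c0) powi (-2)" by (intro r(4)) (auto simp: dist_commute)
    then show "?h w = q c w * (w - c0)\<^sup>2" using w by (simp add: power_int_minus)
  qed (fact r(2))
  ultimately have "((\<lambda>w. q c w * (w - c0)\<^sup>2) \<longlongrightarrow> ?h c0) (at c0)" by (rule Lim_transform_eventually)
  then show ?thesis using that r(1) unfolding c0_def by blast
qed

end

text \<open>With \<open>f z - f z0 = (z - z0) ^ n * g z\<close> the quotient is \<open>n\<close>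
  plus a term that vanishes at \<open>z0\<close>. Here \<open>n\<close> is the multiplicity of
  \<open>f\<close> at \<open>z0\<close>; for the covering map in charts it is the ramification
  index.\<close>

lemma log_derivative_limit:
  assumes "f holomorphic_on S" "open S" "connected S" "z0 \<in> S" "\<not> f constant_on S"
  obtains n :: nat where "0 < n" "((\<lambda>z. deriv f z * (z - z0) / (f z - f z0)) \<longlongrightarrow> of_nat n) (at z0)"
    "\<forall>\<^sub>F z in at z0. f z \<noteq> f z0"
proof -
  have h: "(\<lambda>z. f z - f z0) holomorphic_on S" using assms(1) by (intro holomorphic_intros)
  have nc: "\<not> (\<lambda>z. f z - f z0) constant_on S"
    using assms(5) unfolding constant_on_def by (metis diff_add_cancel)
  obtain g r n where g: "0 < n" "0 < r" "ball z0 r \<subseteq> S" "g holomorphic_on ball z0 r"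
      "\<And>w. w \<in> ball z0 r \<Longrightarrow> f w - f z0 = (w - z0) ^ n * g w" "\<And>w. w \<in> ball z0 r \<Longrightarrow> g w \<noteq> 0"
    by (rule holomorphic_factor_zero_nonconstant[OF h assms(2,3,4) _ nc]) (simp, rule that)
  have ev: "\<forall>\<^sub>F z in at z0. z \<in> ball z0 r \<and> z \<noteq> z0"
    unfolding eventually_at using g(2) by (intro exI[of _ r]) (auto simp: dist_commute)
  have "isCont (\<lambda>z. of_nat n + (z - z0) * deriv g z / g z) z0"
  proof (intro continuous_intros)
    show "isCont g z0" "isCont (deriv g) z0"
      using g(2,4) holomorphic_deriv[OF g(4)] by (auto intro!: DERIV_isCont holomorphic_derivI[of _ "ball z0 r"])
    show "g z0 \<noteq> 0" using g(2,6) by simp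
  qed
  then have "((\<lambda>z. of_nat n + (z - z0) * deriv g z / g z) \<longlongrightarrow> of_nat n) (at z0)" by (simp add: isCont_def)
  moreover have "\<forall>\<^sub>F z in at z0. of_nat n + (z - z0) * deriv g z / g z = deriv f z * (z - z0) / (f z - f z0)"
    using ev
  proof eventually_elim
    case (elim z)
    have dg: "(g has_field_derivative deriv g z) (at z)" using g(4) elim by (intro holomorphic_derivI) auto
    have "((\<lambda>w. f z0 + (w - z0) ^ n * g w) has_field_derivative
        of_nat n * (z - z0) ^ (n - 1) * g z + (z - z0) ^ n * deriv g z) (at z)"
      by (rule derivative_eq_intros dg refl | simp)+
    moreover have "\<forall>\<^sub>F w in nhds z. f z0 + (w - z0) ^ n * g w = f w"
    proof -
      have "\<forall>\<^sub>F w in nhds z. w \<in> ball z0 r" using elim by (intro eventually_nhds_in_open) auto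
      then show ?thesis by eventually_elim (use g(5) in \<open>metis add.commute diff_add_cancel\<close>)
    qed
    ultimately have "(f has_field_derivative of_nat n * (z - z0) ^ (n - 1) * g z + (z - z0) ^ n * deriv g z) (at z)"
      by (subst (asm) DERIV_cong_ev[OF refl _ refl])
    then have d: "deriv f z = of_nat n * (z - z0) ^ (n - 1) * g z + (z - z0) ^ n * deriv g z" by (rule DERIV_imp_deriv)
    define P where "P = (z - z0) ^ (n - 1)"
    have eq: "(z - z0) ^ n = P * (z - z0)" unfolding P_def using g(1) by (metis power_minus_mult)
    have "deriv f z * (z - z0) = (z - z0) ^ n * (of_nat n * g z + (z - z0) * deriv g z)"
      unfolding d eq P_def[symmetric] by (simp add: algebra_simps)
    moreover have "f z - f z0 = (z - z0) ^ n * g z" "g z \<noteq> 0" "(z - z0) ^ n \<noteq> 0" using g(5,6)[of z] elim by auto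
    ultimately show ?case by (simp add: add_divide_distrib)
  qed
  ultimately have "((\<lambda>z. deriv f z * (z - z0) / (f z - f z0)) \<longlongrightarrow> of_nat n) (at z0)" by (rule Lim_transform_eventually)
  moreover have "\<forall>\<^sub>F z in at z0. f z \<noteq> f z0"
    using ev
  proof eventually_elim
    case (elim z)
    then have "f z - f z0 \<noteq> 0" using g(5,6)[of z] by simp
    then show ?case by simp
  qed
  ultimately show ?thesis using that g(1) by blast
qed

section \<open>Local primitives of \<open>\<omega>\<close> and their comparison with flat
  coordinates\<close>

locale spectral = strebel +
  fixes B :: "'b::t2_space chart set" and \<pi> :: "'b \<Rightarrow> 'a" and \<omega> :: "'b differential"
  assumes cover: "spectral_cover A q B \<pi> \<omega>"
begin

lemma surfB: "riemann_surface B" and holo_\<pi>: "holomorphic_map B A \<pi>"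
  and form: "meromorphic_differential 1 B \<omega>" and order_\<omega>: "order_at B \<omega> y \<ge> -1"
  and pullback: "is_pullback 2 B A \<pi> q (\<lambda>d z. \<omega> d z * \<omega> d z)"
  using cover unfolding spectral_cover_def by auto

lemma fibre: "finite (\<pi> -` {x})" "\<pi> -` {x} \<noteq> {}"
proof -
  \<comment> \<open>An infinite set has \<open>card\<close> 0, whereas the fibres have 1 or 2, so
    this settles finiteness as well.\<close>
  have "card (\<pi> -` {x}) \<noteq> 0" using cover unfolding spectral_cover_def Let_def by (metis one_neq_zero zero_neq_numeral)
  then show "finite (\<pi> -` {x})" "\<pi> -` {x} \<noteq> {}" by (auto intro: card_ge_0_finite)
qed

lemma \<pi>_isCont: "isCont \<pi> y"
  using holo_\<pi> unfolding holomorphic_map_def by (simp add: continuous_on_eq_continuous_at)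

text \<open>Fibres are finite, while the covering surface has no isolated points.\<close>

lemma \<pi>_not_locally_constant:
  assumes "\<forall>\<^sub>F y' in nhds y. \<pi> y' = x"
  shows False
proof -
  obtain V where V: "open V" "y \<in> V" "\<And>y'. y' \<in> V \<Longrightarrow> \<pi> y' = x" using assms unfolding eventually_nhds by blast
  have "finite V" using fibre(1)[of x] V(3) by (rule_tac finite_subset) auto
  then have "open (V - (V - {y}))" using V(1) finite_imp_closed[of "V - {y}"] by (intro open_Diff) auto
  moreover have "V - (V - {y}) = {y}" using V(2) by blast
  ultimately have "\<forall>\<^sub>F y' in at y. False" unfolding eventually_at_topological by (metis singletonD singletonI)
  then show False using chart_at_neq_bot[OF surfB] by simp
qed

text \<open>A condition at one point; a local primitive is expressed by requiring it throughout a
  neighbourhood. By \<open>primitive_chart\<close> this makes \<open>\<omega>\<close> holomorphic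
  there, so it cannot hold around a pole.\<close>

definition primitive_at :: "('b \<Rightarrow> complex) \<Rightarrow> 'b \<Rightarrow> bool" where
  "primitive_at W y \<longleftrightarrow> (\<forall>d\<in>B. y \<in> fst d \<longrightarrow> ((W \<circ> chart_inv d) has_field_derivative \<omega> d (snd d y)) (at (snd d y)))"

lemma primitive_atI:
  assumes "c \<in> B" "y \<in> fst c" "((W \<circ> chart_inv c) has_field_derivative \<omega> c (snd c y)) (at (snd c y))"
  shows "primitive_at W y"
  unfolding primitive_at_def
proof (intro ballI impI)
  fix d assume d: "d \<in> B" "y \<in> fst d"
  show "((W \<circ> chart_inv d) has_field_derivative \<omega> d (snd d y)) (at (snd d y))"
    using chart_change_from[OF surfB assms(1) d(1) assms(2) d(2) assms(3)]
      differential_change[OF surfB form d(1) assms(1) d(2) assms(2)] by simp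
qed

text \<open>Near \<open>y\<close> the form is the derivative of a holomorphic function, and hence
  holomorphic itself.\<close>

lemma primitive_chart:
  assumes "\<forall>\<^sub>F y' in nhds y. primitive_at W y'" "d \<in> B" "y \<in> fst d"
  obtains e where "0 < e" "ball (snd d y) e \<subseteq> snd d ` fst d" "\<omega> d holomorphic_on ball (snd d y) e"
    "\<And>z. z \<in> ball (snd d y) e \<Longrightarrow> ((W \<circ> chart_inv d) has_field_derivative \<omega> d z) (at z)"
proof -
  have "\<forall>\<^sub>F y' in nhds y. primitive_at W y' \<and> y' \<in> fst d"
    using assms(1,3) riemann_surface_chart(1)[OF surfB assms(2)] by (intro eventually_conj eventually_nhds_in_open)
  then have "\<forall>\<^sub>F z in nhds (snd d y). primitive_at W (chart_inv d z) \<and> chart_inv d z \<in> fst d"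
    by (rule chart_inv_eventually[OF surfB assms(2,3)])
  moreover have "\<forall>\<^sub>F z in nhds (snd d y). z \<in> snd d ` fst d"
    using riemann_surface_chart(2)[OF surfB assms(2)] assms(3) by (intro eventually_nhds_in_open) auto
  ultimately have "\<forall>\<^sub>F z in nhds (snd d y). z \<in> snd d ` fst d \<and> ((W \<circ> chart_inv d) has_field_derivative \<omega> d z) (at z)"
  proof eventually_elim
    case (elim z)
    then show ?case using chart_inv_simps(2)[OF surfB assms(2), of z] assms(2) unfolding primitive_at_def by metis
  qed
  then obtain e where e: "0 < e" "\<And>z. dist z (snd d y) < e \<Longrightarrow> z \<in> snd d ` fst d \<and> ((W \<circ> chart_inv d) has_field_derivative \<omega> d z) (at z)"
    unfolding eventually_nhds_metric by blast
  have der: "((W \<circ> chart_inv d) has_field_derivative \<omega> d z) (at z)" if "z \<in> ball (snd d y) e" for z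
    using e(2)[of z] that by (simp add: dist_commute)
  show ?thesis
  proof
    have "(W \<circ> chart_inv d) holomorphic_on ball (snd d y) e" using der holomorphic_on_open by blast
    then have "deriv (W \<circ> chart_inv d) holomorphic_on ball (snd d y) e" by (rule holomorphic_deriv) auto
    then show "\<omega> d holomorphic_on ball (snd d y) e"
      by (rule holomorphic_transform) (use DERIV_imp_deriv[OF der] in auto)
    show "ball (snd d y) e \<subseteq> snd d ` fst d" using e(2) by (auto simp: dist_commute)
  qed (use e der in auto)
qed

text \<open>A pole of \<open>\<omega>\<close> must have order -1, so off the simple poles the form
  is holomorphic and can be integrated in a coordinate disc.\<close>

lemma primitive_exists:
  assumes "y \<notin> simple_poles B \<omega>"
  obtains W where "\<forall>\<^sub>F y' in nhds y. primitive_at W y'"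
proof -
  define d where "d = chart_at B y"
  have d: "d \<in> B" "y \<in> fst d" unfolding d_def using chart_at_in[OF surfB] by auto
  have mer: "\<omega> d nicely_meromorphic_on (snd d ` fst d)"
    using form d(1) unfolding meromorphic_differential_def by blast
  have np: "\<not> is_pole (\<omega> d) (snd d y)"
  proof
    assume pole: "is_pole (\<omega> d) (snd d y)"
    have "\<omega> d meromorphic_on (snd d ` fst d)" using mer unfolding nicely_meromorphic_on_def by blast
    then have "\<omega> d meromorphic_on {snd d y}" by (rule meromorphic_on_subset) (use d(2) in auto)
    then have "zorder (\<omega> d) (snd d y) < 0"
      using pole isolated_pole_imp_neg_zorder meromorphic_on_isolated_singularity by blast
    then have "order_at B \<omega> y = -1" using order_\<omega>[of y] unfolding order_at_def d_def by linarith
    then show False using assms unfolding simple_poles_def by blast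
  qed
  then have "\<omega> d analytic_on {snd d y}"
    using nicely_meromorphic_on_imp_analytic_at[OF mer] d(2) by blast
  then obtain e where e: "0 < e" "\<omega> d holomorphic_on ball (snd d y) e" by (metis analytic_at_ball)
  then obtain W0 where W0: "\<And>z. z \<in> ball (snd d y) e \<Longrightarrow> (W0 has_field_derivative \<omega> d z) (at z)"
    using holomorphic_convex_primitive'[OF convex_ball open_ball e(2)] at_within_open[OF _ open_ball] by metis
  have "\<forall>\<^sub>F z in nhds (snd d y). z \<in> ball (snd d y) e" using e(1) by (intro eventually_nhds_in_open) auto
  then have "\<forall>\<^sub>F y' in nhds y. snd d y' \<in> ball (snd d y) e"
    using eventually_chart[OF surfB d, of "\<lambda>z. z \<in> ball (snd d y) e"] by simp
  moreover have "\<forall>\<^sub>F y' in nhds y. y' \<in> fst d"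
    using d riemann_surface_chart(1)[OF surfB d(1)] by (intro eventually_nhds_in_open) auto
  ultimately have "\<forall>\<^sub>F y' in nhds y. primitive_at (W0 \<circ> snd d) y'"
  proof eventually_elim
    case (elim y')
    have "\<forall>\<^sub>F z in nhds (snd d y'). z \<in> snd d ` fst d"
      using riemann_surface_chart(2)[OF surfB d(1)] elim by (intro eventually_nhds_in_open) auto
    then have "\<forall>\<^sub>F z in nhds (snd d y'). W0 z = (W0 \<circ> snd d \<circ> chart_inv d) z"
      by eventually_elim (use chart_inv_simps(2)[OF surfB d(1)] in auto)
    then have "((W0 \<circ> snd d \<circ> chart_inv d) has_field_derivative \<omega> d (snd d y')) (at (snd d y'))"
      using W0[OF elim(1)] by (subst (asm) DERIV_cong_ev[OF refl _ refl])
    then show ?case by (rule primitive_atI[OF d(1) elim(2)])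
  qed
  then show ?thesis by (rule that)
qed

lemma primitive_unique:
  assumes "\<forall>\<^sub>F y' in nhds y. primitive_at W1 y'" "\<forall>\<^sub>F y' in nhds y. primitive_at W2 y'"
  shows "\<forall>\<^sub>F y' in nhds y. W1 y' - W1 y = W2 y' - W2 y"
proof -
  obtain d where d: "d \<in> B" "y \<in> fst d" using chart_exists[OF surfB] .
  obtain e1 where e1: "0 < e1" "\<And>z. z \<in> ball (snd d y) e1 \<Longrightarrow> ((W1 \<circ> chart_inv d) has_field_derivative \<omega> d z) (at z)"
    using primitive_chart[OF assms(1) d] by metis
  obtain e2 where e2: "0 < e2" "\<And>z. z \<in> ball (snd d y) e2 \<Longrightarrow> ((W2 \<circ> chart_inv d) has_field_derivative \<omega> d z) (at z)"
    using primitive_chart[OF assms(2) d] by metis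
  define e where "e = min e1 e2"
  have "(\<lambda>z. (W1 \<circ> chart_inv d) z - (W2 \<circ> chart_inv d) z) constant_on ball (snd d y) e"
  proof (rule has_field_derivative_0_imp_constant_on)
    fix z assume "z \<in> ball (snd d y) e"
    then have "((\<lambda>z. (W1 \<circ> chart_inv d) z - (W2 \<circ> chart_inv d) z) has_field_derivative \<omega> d z - \<omega> d z) (at z)"
      by (intro DERIV_diff e1(2) e2(2)) (auto simp: e_def)
    then show "((\<lambda>z. (W1 \<circ> chart_inv d) z - (W2 \<circ> chart_inv d) z) has_field_derivative 0) (at z)" by simp
  qed auto
  then obtain C where C: "\<And>z. z \<in> ball (snd d y) e \<Longrightarrow> W1 (chart_inv d z) - W2 (chart_inv d z) = C"
    unfolding constant_on_def by auto
  have "0 < e" unfolding e_def using e1(1) e2(1) by simp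
  then have "\<forall>\<^sub>F z in nhds (snd d y). z \<in> ball (snd d y) e" by (intro eventually_nhds_in_open) auto
  then have "\<forall>\<^sub>F y' in nhds y. snd d y' \<in> ball (snd d y) e"
    using eventually_chart[OF surfB d, of "\<lambda>z. z \<in> ball (snd d y) e"] by simp
  moreover have "\<forall>\<^sub>F y' in nhds y. y' \<in> fst d"
    using d riemann_surface_chart(1)[OF surfB d(1)] by (intro eventually_nhds_in_open) auto
  ultimately show ?thesis
  proof eventually_elim
    case (elim y')
    then have "W1 y' - W2 y' = C" using C[of "snd d y'"] chart_inv_simps(1)[OF surfB d(1)] by simp
    moreover have "W1 y - W2 y = C" using C[of "snd d y"] chart_inv_simps(1)[OF surfB d] \<open>0 < e\<close> by simp
    ultimately show ?case by (simp add: algebra_simps)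
  qed
qed

text \<open>The relation between \<open>\<omega>\<close> and \<open>q\<close> is asserted off the
  centre, because pullbacks are compared on punctured neighbourhoods.\<close>

lemma \<pi>_chart:
  assumes "d \<in> B" "y \<in> fst d" "c \<in> A" "\<pi> y \<in> fst c"
  obtains e where "0 < e" "ball (snd d y) e \<subseteq> snd d ` (fst d \<inter> \<pi> -` fst c)"
    "(snd c \<circ> \<pi> \<circ> chart_inv d) holomorphic_on ball (snd d y) e"
    "\<And>z. z \<in> ball (snd d y) e \<Longrightarrow> z \<noteq> snd d y \<Longrightarrow>
       \<omega> d z * \<omega> d z = q c ((snd c \<circ> \<pi> \<circ> chart_inv d) z) * (deriv (snd c \<circ> \<pi> \<circ> chart_inv d) z)\<^sup>2"
proof -
  let ?S = "snd d ` (fst d \<inter> \<pi> -` fst c)"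
  have "open (fst d \<inter> \<pi> -` fst c)"
    using riemann_surface_chart(1)[OF surfB assms(1)] riemann_surface_chart(1)[OF surface assms(3)] holo_\<pi>
    unfolding holomorphic_map_def by (auto intro!: open_Int open_vimage)
  then have "open ?S" by (intro chart_open_image[OF surfB assms(1)]) auto
  moreover have "snd d y \<in> ?S" using assms by blast
  ultimately obtain e1 where e1: "0 < e1" "ball (snd d y) e1 \<subseteq> ?S" using open_contains_ball by metis
  have hol: "(snd c \<circ> \<pi> \<circ> chart_inv d) holomorphic_on ?S"
    using holo_\<pi> assms unfolding holomorphic_map_def by blast
  have "\<forall>\<^sub>F z in at (snd d y). \<omega> d z * \<omega> d z = q c ((snd c \<circ> \<pi> \<circ> chart_inv d) z) * deriv (snd c \<circ> \<pi> \<circ> chart_inv d) z ^ 2"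
    using pullback assms unfolding is_pullback_def by blast
  then obtain e2 where e2: "0 < e2" "\<And>z. z \<noteq> snd d y \<Longrightarrow> dist z (snd d y) < e2 \<Longrightarrow>
     \<omega> d z * \<omega> d z = q c ((snd c \<circ> \<pi> \<circ> chart_inv d) z) * deriv (snd c \<circ> \<pi> \<circ> chart_inv d) z ^ 2"
    unfolding eventually_at by blast
  show ?thesis
  proof (rule that[of "min e1 e2"])
    show "ball (snd d y) (min e1 e2) \<subseteq> ?S" using e1(2) by auto
    then show "(snd c \<circ> \<pi> \<circ> chart_inv d) holomorphic_on ball (snd d y) (min e1 e2)"
      by (rule holomorphic_on_subset[OF hol])
  qed (use e1 e2 in \<open>auto simp: dist_commute\<close>)
qed

lemma \<pi>_chart_nonconstant:
  assumes "d \<in> B" "y \<in> fst d" "c \<in> A" "\<pi> y \<in> fst c"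
    and "0 < e" "ball (snd d y) e \<subseteq> snd d ` (fst d \<inter> \<pi> -` fst c)"
  shows "\<not> (snd c \<circ> \<pi> \<circ> chart_inv d) constant_on ball (snd d y) e"
proof
  assume "(snd c \<circ> \<pi> \<circ> chart_inv d) constant_on ball (snd d y) e"
  then obtain C where C: "\<And>z. z \<in> ball (snd d y) e \<Longrightarrow> snd c (\<pi> (chart_inv d z)) = C" unfolding constant_on_def by auto
  have Cy: "snd c (\<pi> y) = C" using C[of "snd d y"] assms(5) chart_inv_simps(1)[OF surfB assms(1,2)] by simp
  have "\<forall>\<^sub>F z in nhds (snd d y). z \<in> ball (snd d y) e" using assms(5) by (intro eventually_nhds_in_open) auto
  then have "\<forall>\<^sub>F y' in nhds y. snd d y' \<in> ball (snd d y) e"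
    using eventually_chart[OF surfB assms(1,2), of "\<lambda>z. z \<in> ball (snd d y) e"] by simp
  moreover have "\<forall>\<^sub>F y' in nhds y. y' \<in> fst d"
    using assms riemann_surface_chart(1)[OF surfB assms(1)] by (intro eventually_nhds_in_open) auto
  moreover have "\<forall>\<^sub>F y' in nhds y. \<pi> y' \<in> fst c"
    using isCont_eventually_in[OF \<pi>_isCont riemann_surface_chart(1)[OF surface assms(3)] assms(4)] .
  ultimately have "\<forall>\<^sub>F y' in nhds y. \<pi> y' = \<pi> y"
  proof eventually_elim
    case (elim y')
    then have "snd c (\<pi> y') = snd c (\<pi> y)" using C[of "snd d y'"] Cy chart_inv_simps(1)[OF surfB assms(1)] by simp
    then show ?case using chart_inj[OF surface assms(3) elim(3) assms(4)] by simp
  qed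
  then show False by (rule \<pi>_not_locally_constant)
qed

text \<open>In coordinates \<open>(\<omega> d z * (z - z0))\<^sup>2\<close> tends to
  \<open>L * n\<^sup>2\<close>, where \<open>L\<close> is the non-zero leading coefficient of
  \<open>q\<close> and \<open>n\<close> the ramification index, whereas a holomorphic form gives the
  limit 0. Consequently a path that avoids the simple poles of \<open>\<omega>\<close> never passes
  over a double pole of \<open>q\<close>.\<close>

lemma primitive_not_over_double_pole:
  assumes W: "\<forall>\<^sub>F y' in nhds y. primitive_at W y'"
  shows "\<pi> y \<notin> double_poles A q"
proof
  assume p: "\<pi> y \<in> double_poles A q"
  define c where "c = chart_at A (\<pi> y)"
  have c: "c \<in> A" "\<pi> y \<in> fst c" unfolding c_def using chart_at_in[OF surface] by auto
  obtain d where d: "d \<in> B" "y \<in> fst d" using chart_exists[OF surfB] .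
  define z0 where "z0 = snd d y"
  define f where "f = snd c \<circ> \<pi> \<circ> chart_inv d"
  obtain e where e: "0 < e" "ball z0 e \<subseteq> snd d ` (fst d \<inter> \<pi> -` fst c)" "f holomorphic_on ball z0 e"
    "\<And>z. z \<in> ball z0 e \<Longrightarrow> z \<noteq> z0 \<Longrightarrow> \<omega> d z * \<omega> d z = q c (f z) * (deriv f z)\<^sup>2"
    using \<pi>_chart[OF d c] unfolding z0_def f_def by metis
  obtain e' where e': "0 < e'" "\<omega> d holomorphic_on ball z0 e'" using primitive_chart[OF W d] unfolding z0_def by metis
  have fz0: "f z0 = snd c (\<pi> y)" unfolding f_def z0_def using chart_inv_simps(1)[OF surfB d] by simp
  have nc: "\<not> f constant_on ball z0 e"
    using \<pi>_chart_nonconstant[OF d c e(1)] e(2) unfolding f_def z0_def by blast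
  have z0e: "z0 \<in> ball z0 e" using e(1) by simp
  obtain n :: nat where n: "0 < n" "((\<lambda>z. deriv f z * (z - z0) / (f z - f z0)) \<longlongrightarrow> of_nat n) (at z0)"
    "\<forall>\<^sub>F z in at z0. f z \<noteq> f z0"
    using log_derivative_limit[OF e(3) open_ball connected_ball z0e nc] .
  obtain L where L: "L \<noteq> 0" "((\<lambda>w. q c w * (w - f z0)\<^sup>2) \<longlongrightarrow> L) (at (f z0))"
    using double_pole_limit[OF p c_def] unfolding fz0 .
  have "isCont f z0" using e(1,3) by (meson DERIV_isCont centre_in_ball holomorphic_derivI open_ball)
  then have "filterlim f (at (f z0)) (at z0)"
    using n(3) unfolding filterlim_at isCont_def by simp
  then have "((\<lambda>z. q c (f z) * (f z - f z0)\<^sup>2) \<longlongrightarrow> L) (at z0)" by (rule filterlim_compose[OF L(2)])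
  then have "((\<lambda>z. q c (f z) * (f z - f z0)\<^sup>2 * (deriv f z * (z - z0) / (f z - f z0))\<^sup>2) \<longlongrightarrow> L * (of_nat n)\<^sup>2) (at z0)"
    using n(2) by (intro tendsto_intros)
  moreover have "\<forall>\<^sub>F z in at z0. q c (f z) * (f z - f z0)\<^sup>2 * (deriv f z * (z - z0) / (f z - f z0))\<^sup>2 = (\<omega> d z * (z - z0))\<^sup>2"
  proof -
    have "\<forall>\<^sub>F z in at z0. z \<in> ball z0 e \<and> z \<noteq> z0"
      unfolding eventually_at using e(1) by (intro exI[of _ e]) (auto simp: dist_commute)
    with n(3) show ?thesis
    proof eventually_elim
      case (elim z)
      have eq: "\<omega> d z * \<omega> d z = q c (f z) * (deriv f z)\<^sup>2" using e(4) elim(2) by blast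
      have "f z - f z0 \<noteq> 0" using elim(1) by simp
      then have "q c (f z) * (f z - f z0)\<^sup>2 * (deriv f z * (z - z0) / (f z - f z0))\<^sup>2 = q c (f z) * (deriv f z)\<^sup>2 * (z - z0)\<^sup>2"
        by (simp add: power_divide power_mult_distrib)
      then show ?case unfolding eq[symmetric] by (simp add: power2_eq_square mult_ac)
    qed
  qed
  ultimately have lim: "((\<lambda>z. (\<omega> d z * (z - z0))\<^sup>2) \<longlongrightarrow> L * (of_nat n)\<^sup>2) (at z0)" by (rule Lim_transform_eventually)
  have "isCont (\<omega> d) z0" using e' by (meson DERIV_isCont centre_in_ball holomorphic_derivI open_ball)
  then have "isCont (\<lambda>z. (\<omega> d z * (z - z0))\<^sup>2) z0" by (intro continuous_intros)
  then have "((\<lambda>z. (\<omega> d z * (z - z0))\<^sup>2) \<longlongrightarrow> 0) (at z0)" by (simp add: isCont_def)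
  then have "L * (of_nat n)\<^sup>2 = 0" using lim LIM_unique by blast
  then show False using L(1) n(1) by simp
qed

text \<open>
  \<open>\<Psi>\<^sup>-\<^sup>1 \<circ> \<pi>\<close> is a primitive of one of the two square roots \<open>\<plusminus>\<omega>\<close> of \<open>\<pi>\<^sup>*q\<close>.
\<close>

lemma flat_lift:
  assumes W: "\<forall>\<^sub>F y' in nhds y. primitive_at W y'"
    and \<Psi>: "open U" "\<And>\<zeta>. \<zeta> \<in> U \<Longrightarrow> flat_at \<Psi> \<zeta>" "\<zeta>0 \<in> U" "\<Psi> \<zeta>0 = \<pi> y"
  obtains g \<sigma> where "\<sigma> \<in> {1, -1::real}" "g y = \<zeta>0" "isCont g y"
    "\<forall>\<^sub>F y' in nhds y. isCont g y' \<and> g y' \<in> U \<and> \<Psi> (g y') = \<pi> y' \<and> W y' - W y = of_real \<sigma> * (g y' - \<zeta>0)"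
proof -
  obtain r g0 where g0: "0 < r" "ball \<zeta>0 r \<subseteq> U" "open (\<Psi> ` ball \<zeta>0 r)"
    "\<And>\<zeta>. \<zeta> \<in> ball \<zeta>0 r \<Longrightarrow> g0 (\<Psi> \<zeta>) = \<zeta>" "continuous_on (\<Psi> ` ball \<zeta>0 r) g0"
    "\<And>c x. c \<in> A \<Longrightarrow> x \<in> fst c \<Longrightarrow> x \<in> \<Psi> ` ball \<zeta>0 r \<Longrightarrow>
       \<exists>D. ((g0 \<circ> chart_inv c) has_field_derivative D) (at (snd c x)) \<and> D\<^sup>2 = q c (snd c x)"
    using flat_inverse[OF \<Psi>(1-3)] by metis
  define N where "N = \<Psi> ` ball \<zeta>0 r"
  have yN: "\<pi> y \<in> N" unfolding N_def using \<Psi>(4) g0(1) by (metis centre_in_ball imageI)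
  obtain d where d: "d \<in> B" "y \<in> fst d" using chart_exists[OF surfB] .
  obtain c where c: "c \<in> A" "\<pi> y \<in> fst c" using chart_exists[OF surface] .
  define z0 where "z0 = snd d y"
  define f where "f = snd c \<circ> \<pi> \<circ> chart_inv d"
  obtain e1 where e1: "0 < e1" "ball z0 e1 \<subseteq> snd d ` (fst d \<inter> \<pi> -` fst c)" "f holomorphic_on ball z0 e1"
    "\<And>z. z \<in> ball z0 e1 \<Longrightarrow> z \<noteq> z0 \<Longrightarrow> \<omega> d z * \<omega> d z = q c (f z) * (deriv f z)\<^sup>2"
    using \<pi>_chart[OF d c] unfolding z0_def f_def by metis
  obtain e2 where e2: "0 < e2" "ball z0 e2 \<subseteq> snd d ` fst d" "\<omega> d holomorphic_on ball z0 e2"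
    "\<And>z. z \<in> ball z0 e2 \<Longrightarrow> ((W \<circ> chart_inv d) has_field_derivative \<omega> d z) (at z)"
    using primitive_chart[OF W d] unfolding z0_def by metis
  have evN: "\<forall>\<^sub>F y' in nhds y. \<pi> y' \<in> N"
    using isCont_eventually_in[OF \<pi>_isCont _ yN] g0(3) unfolding N_def by blast
  then have "\<forall>\<^sub>F z in nhds z0. \<pi> (chart_inv d z) \<in> N"
    unfolding z0_def by (rule chart_inv_eventually[OF surfB d])
  then obtain e3 where e3: "0 < e3" "\<And>z. dist z z0 < e3 \<Longrightarrow> \<pi> (chart_inv d z) \<in> N"
    unfolding eventually_nhds_metric by blast
  define e where "e = min e1 (min e2 e3)"
  have e: "0 < e" unfolding e_def using e1(1) e2(1) e3(1) by simp
  define g where "g = g0 \<circ> \<pi>"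
  define k where "k = g \<circ> chart_inv d"
  have kd: "\<exists>D. (k has_field_derivative D) (at z) \<and> (z \<noteq> z0 \<longrightarrow> D\<^sup>2 = (\<omega> d z)\<^sup>2)" if z: "z \<in> ball z0 e" for z
  proof -
    have z1: "z \<in> ball z0 e1" "\<pi> (chart_inv d z) \<in> N" using z e3(2)[of z] unfolding e_def by (auto simp: dist_commute)
    then obtain x where x: "x \<in> fst d" "\<pi> x \<in> fst c" "z = snd d x" using e1(2) by blast
    have xz: "chart_inv d z = x" using chart_inv_simps(1)[OF surfB d(1) x(1)] x(3) by simp
    have fz: "f z = snd c (\<pi> x)" unfolding f_def by (simp add: xz)
    obtain D where D: "((g0 \<circ> chart_inv c) has_field_derivative D) (at (f z))" "D\<^sup>2 = q c (f z)"
      using g0(6)[OF c(1) x(2)] z1(2) xz unfolding fz N_def by blast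
    have df: "(f has_field_derivative deriv f z) (at z)" using e1(3) z1(1) by (intro holomorphic_derivI) auto
    have "((g0 \<circ> chart_inv c) \<circ> f has_field_derivative D * deriv f z) (at z)" by (rule DERIV_chain[OF D(1) df])
    moreover have "\<forall>\<^sub>F v in nhds z. v \<in> ball z0 e1" using z1(1) by (intro eventually_nhds_in_open) auto
    then have "\<forall>\<^sub>F v in nhds z. ((g0 \<circ> chart_inv c) \<circ> f) v = k v"
    proof eventually_elim
      case (elim v)
      then obtain x' where x': "x' \<in> fst d" "\<pi> x' \<in> fst c" "v = snd d x'" using e1(2) by blast
      then show ?case unfolding k_def g_def f_def
        using chart_inv_simps(1)[OF surfB d(1) x'(1)] chart_inv_simps(1)[OF surface c(1) x'(2)] by simp
    qed
    ultimately have "(k has_field_derivative D * deriv f z) (at z)" by (subst (asm) DERIV_cong_ev[OF refl _ refl])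
    moreover have "(D * deriv f z)\<^sup>2 = (\<omega> d z)\<^sup>2" if "z \<noteq> z0"
      using e1(4)[OF z1(1) that] D(2) by (simp add: power_mult_distrib power2_eq_square)
    ultimately show ?thesis by blast
  qed
  have khol: "k holomorphic_on ball z0 e" using kd holomorphic_on_open by blast
  have dk: "(k has_field_derivative deriv k z) (at z)" if "z \<in> ball z0 e" for z
    using khol that by (intro holomorphic_derivI) auto
  have sq: "(deriv k z)\<^sup>2 = (\<omega> d z)\<^sup>2" if "z \<in> ball z0 e" "z \<noteq> z0" for z
    using kd[OF that(1)] that(2) DERIV_imp_deriv by blast
  have z0e: "z0 \<in> ball z0 e" using e by simp
  have h1: "\<omega> d holomorphic_on ball z0 e" by (rule holomorphic_on_subset[OF e2(3)]) (auto simp: e_def)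
  have h2: "deriv k holomorphic_on ball z0 e" using khol open_ball by (rule holomorphic_deriv)
  have ev: "\<forall>\<^sub>F z in at z0. z \<in> ball z0 e \<and> z \<noteq> z0"
    unfolding eventually_at using e by (intro exI[of _ e]) (auto simp: dist_commute)
  \<comment> \<open>Two holomorphic functions have equal squares off \<open>z0\<close>, so at each
    such point they agree up to sign. One of the signs occurs frequently near \<open>z0\<close>, and
    the identity theorem makes it valid on the whole ball, also at \<open>z0\<close>.\<close>
  obtain \<sigma> where \<sigma>: "\<sigma> \<in> {1, -1::real}" "\<exists>\<^sub>F z in at z0. \<omega> d z - of_real \<sigma> * deriv k z = 0"
  proof (cases "\<exists>\<^sub>F z in at z0. \<omega> d z - deriv k z = 0")
    case True
    then show ?thesis by (intro that[of 1]) auto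
  next
    case False
    then have "\<forall>\<^sub>F z in at z0. \<omega> d z - deriv k z \<noteq> 0" unfolding frequently_def by simp
    then have "\<forall>\<^sub>F z in at z0. \<omega> d z - of_real (-1) * deriv k z = 0"
      using ev
    proof eventually_elim
      case (elim z)
      then have "(deriv k z)\<^sup>2 = (\<omega> d z)\<^sup>2" using sq by blast
      then show ?case using elim(1) by (auto simp: power2_eq_iff)
    qed
    then show ?thesis by (intro that[of "-1"]) (auto intro: eventually_frequently)
  qed
  have eq\<omega>: "\<omega> d z = of_real \<sigma> * deriv k z" if "z \<in> ball z0 e" for z
  proof -
    have "(\<lambda>z. \<omega> d z - of_real \<sigma> * deriv k z) holomorphic_on ball z0 e" by (intro holomorphic_on_diff holomorphic_on_mult holomorphic_on_const h1 h2)
    then have "(\<lambda>z. \<omega> d z - of_real \<sigma> * deriv k z) nicely_meromorphic_on ball z0 e"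
      by (simp add: analytic_on_imp_nicely_meromorphic_on analytic_on_open)
    from frequently_eq_meromorphic_imp_constant[OF \<sigma>(2) this open_ball connected_ball z0e that]
    show ?thesis by simp
  qed
  have "(\<lambda>z. (W \<circ> chart_inv d) z - of_real \<sigma> * k z) constant_on ball z0 e"
  proof (rule has_field_derivative_0_imp_constant_on)
    fix z assume z: "z \<in> ball z0 e"
    have "((\<lambda>z. (W \<circ> chart_inv d) z - of_real \<sigma> * k z) has_field_derivative \<omega> d z - of_real \<sigma> * deriv k z) (at z)"
      using z by (intro DERIV_diff DERIV_cmult e2(4) dk) (auto simp: e_def)
    then show "((\<lambda>z. (W \<circ> chart_inv d) z - of_real \<sigma> * k z) has_field_derivative 0) (at z)" using eq\<omega>[OF z] by simp
  qed auto
  then obtain C where C: "\<And>z. z \<in> ball z0 e \<Longrightarrow> W (chart_inv d z) - of_real \<sigma> * k z = C"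
    unfolding constant_on_def by auto
  have gy: "g y = \<zeta>0" unfolding g_def using g0(4)[of \<zeta>0] g0(1) \<Psi>(4) by simp
  have kz0: "k z0 = \<zeta>0" "chart_inv d z0 = y" unfolding k_def z0_def using chart_inv_simps(1)[OF surfB d] gy by auto
  have gc: "isCont g y'" if "\<pi> y' \<in> N" for y'
    unfolding g_def o_def
  proof (rule isCont_o2[OF \<pi>_isCont])
    show "isCont g0 (\<pi> y')" using g0(3,5) that unfolding N_def by (metis continuous_on_eq_continuous_at)
  qed
  have "\<forall>\<^sub>F z in nhds z0. z \<in> ball z0 e" using e by (intro eventually_nhds_in_open) auto
  then have "\<forall>\<^sub>F y' in nhds y. snd d y' \<in> ball z0 e"
    using eventually_chart[OF surfB d, of "\<lambda>z. z \<in> ball z0 e"] unfolding z0_def by simp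
  moreover have "\<forall>\<^sub>F y' in nhds y. y' \<in> fst d"
    using d riemann_surface_chart(1)[OF surfB d(1)] by (intro eventually_nhds_in_open) auto
  ultimately have ev: "\<forall>\<^sub>F y' in nhds y. isCont g y' \<and> g y' \<in> U \<and> \<Psi> (g y') = \<pi> y' \<and> W y' - W y = of_real \<sigma> * (g y' - \<zeta>0)"
    using evN
  proof eventually_elim
    case (elim y')
    obtain \<zeta> where \<zeta>: "\<zeta> \<in> ball \<zeta>0 r" "\<pi> y' = \<Psi> \<zeta>" using elim(3) unfolding N_def by blast
    then have "g y' = \<zeta>" unfolding g_def using g0(4) by simp
    moreover have "W y' - of_real \<sigma> * g y' = C"
      using C[OF elim(1)] chart_inv_simps(1)[OF surfB d(1) elim(2)] unfolding k_def by simp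
    moreover have "W y - of_real \<sigma> * \<zeta>0 = C" using C[OF z0e] kz0 by simp
    ultimately show ?case using gc[OF elim(3)] \<zeta> g0(2) by (auto simp: algebra_simps)
  qed
  show ?thesis by (rule that[OF \<sigma>(1) gy gc[OF yN] ev])
qed

text \<open>Only finitely many points lie over the critical points. Over each critical trajectory
  \<open>Im (W y)\<close> is locally constant, provided that the parameter of the trajectory is
  recorded with the point; then the Lindelof argument applies.\<close>

lemma countable_graph_values:
  assumes W: "\<forall>\<^sub>F y' in nhds y. primitive_at W y'"
  obtains V where "open V" "y \<in> V" "countable ((\<lambda>y. Im (W y)) ` (V \<inter> \<pi> -` G))"
proof -
  obtain d where d: "d \<in> B" "y \<in> fst d" using chart_exists[OF surfB] .
  have "\<forall>\<^sub>F y' in nhds y. primitive_at W y' \<and> y' \<in> fst d"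
    using W d riemann_surface_chart(1)[OF surfB d(1)] by (intro eventually_conj eventually_nhds_in_open)
  then obtain V where V: "open V" "y \<in> V" "\<And>y'. y' \<in> V \<Longrightarrow> primitive_at W y' \<and> y' \<in> fst d"
    unfolding eventually_nhds by blast
  have VW: "\<forall>\<^sub>F y'' in nhds y'. primitive_at W y''" if "y' \<in> V" for y'
    using V that unfolding eventually_nhds by blast
  have crit: "countable (V \<inter> \<pi> -` {x. \<not> regular x})"
  proof -
    have "\<pi> -` {x. \<not> regular x} = (\<Union>x\<in>{x. \<not> regular x}. \<pi> -` {x})" by blast
    then have "finite (\<pi> -` {x. \<not> regular x})"
      using finite_critical_points[OF compact_surface] fibre(1) by simp
    then show ?thesis by (intro countable_finite) blast
  qed
  have traj: "countable ((\<lambda>y. Im (W y)) ` (V \<inter> \<pi> -` T))" if T: "critical_trajectory A q T" for T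
  proof -
    obtain a b \<delta> where \<delta>: "horizontal_geodesic A q {a<..<b} \<delta>" "T = \<delta> ` {a<..<b}"
      using T unfolding critical_trajectory_def trajectory_connects_def by blast
    \<comment> \<open>The chart coordinate \<open>z\<close> stands for the point of the cover, so
      that the argument takes place in a second countable space. The parameter \<open>t\<close>
      singles out the arc of \<open>T\<close> on which the image of the point lies.\<close>
    define S where "S = {(t, z). t \<in> {a<..<b} \<and> z \<in> snd d ` V \<and> \<pi> (chart_inv d z) = \<delta> t}"
    define F where "F = (\<lambda>(t::real, z). Im (W (chart_inv d z)))"
    have "countable (F ` S)"
    proof (rule countable_locally_constant)
      fix p assume "p \<in> S"
      then obtain t0 y0 where p': "p = (t0, snd d y0)" "t0 \<in> {a<..<b}" "y0 \<in> V" "\<pi> (chart_inv d (snd d y0)) = \<delta> t0"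
        unfolding S_def by blast
      moreover have "chart_inv d (snd d y0) = y0" using chart_inv_simps(1)[OF surfB d(1)] V(3)[OF p'(3)] by blast
      ultimately have p: "p = (t0, snd d y0)" "t0 \<in> {a<..<b}" "y0 \<in> V" "\<pi> y0 = \<delta> t0" by auto
      obtain r \<Psi> where \<Psi>: "0 < r" "\<And>\<zeta>. \<zeta> \<in> ball 0 r \<Longrightarrow> flat_at \<Psi> \<zeta>" "\<Psi> 0 = \<delta> t0"
        using flat_exists[OF horizontal_geodesic_regular[OF \<delta>(1) p(2)]] by metis
      have r0: "0 \<in> ball (0::complex) r" using \<Psi>(1) by simp
      have \<Psi>y: "\<Psi> 0 = \<pi> y0" using \<Psi>(3) p(4) by simp
      obtain g \<sigma> where g: "\<sigma> \<in> {1, -1::real}" "g y0 = 0" "isCont g y0"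
        "\<forall>\<^sub>F y' in nhds y0. isCont g y' \<and> g y' \<in> ball 0 r \<and> \<Psi> (g y') = \<pi> y' \<and> W y' - W y0 = of_real \<sigma> * (g y' - 0)"
        by (rule flat_lift[OF VW[OF p(3)] open_ball \<Psi>(2) r0 \<Psi>y])
      obtain x where x: "isCont x t0" "x t0 = 0"
        "\<forall>\<^sub>F s in nhds t0. s \<in> {a<..<b} \<and> 0 + complex_of_real (x s) \<in> ball 0 r \<and> \<delta> s = \<Psi> (0 + of_real (x s))"
        using horizontal_geodesic_flat[OF \<delta>(1) p(2) open_ball \<Psi>(2) r0 \<Psi>(3)] by blast
      obtain e where e: "0 < e" "inj_on \<Psi> (ball 0 e)" using flat_locally_inj[OF open_ball \<Psi>(2) r0] by metis
      have "\<forall>\<^sub>F s in nhds t0. x s \<in> {-e<..<e}" using x(1,2) e(1) by (intro isCont_eventually_in) auto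
      with x(3) have "\<forall>\<^sub>F s in nhds t0. \<bar>x s\<bar> < e \<and> \<delta> s = \<Psi> (of_real (x s))" by eventually_elim auto
      then obtain T0 where T0: "open T0" "t0 \<in> T0" "\<And>s. s \<in> T0 \<Longrightarrow> \<bar>x s\<bar> < e \<and> \<delta> s = \<Psi> (of_real (x s))"
        unfolding eventually_nhds by blast
      have "\<forall>\<^sub>F y' in nhds y0. g y' \<in> ball 0 e" using g(2,3) e(1) by (intro isCont_eventually_in) auto
      with g(4) have "\<forall>\<^sub>F y' in nhds y0. norm (g y') < e \<and> \<Psi> (g y') = \<pi> y' \<and> W y' - W y0 = of_real \<sigma> * g y'"
        by eventually_elim auto
      then obtain Y where Y: "open Y" "y0 \<in> Y" "\<And>y'. y' \<in> Y \<Longrightarrow> norm (g y') < e \<and> \<Psi> (g y') = \<pi> y' \<and> W y' - W y0 = of_real \<sigma> * g y'"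
        unfolding eventually_nhds by blast
      have fst: "Y \<inter> V \<subseteq> fst d" using V(3) by blast
      have "open (snd d ` (Y \<inter> V))" using Y(1) V(1) by (intro chart_open_image[OF surfB d(1) _ fst]) auto
      then have "open (T0 \<times> snd d ` (Y \<inter> V))" using T0(1) by (rule_tac open_Times)
      moreover have "p \<in> T0 \<times> snd d ` (Y \<inter> V)" using p T0(2) Y(2) by blast
      moreover have "F p' = F p" if p'S: "p' \<in> (T0 \<times> snd d ` (Y \<inter> V)) \<inter> S" for p'
      proof -
        obtain t y' where p': "p' = (t, snd d y')" "t \<in> T0" "y' \<in> Y" "y' \<in> V" using p'S by blast
        have inv: "chart_inv d (snd d y') = y'" "chart_inv d (snd d y0) = y0"
          using chart_inv_simps(1)[OF surfB d(1)] p'(4) p(3) V(3) by auto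
        have "\<pi> y' = \<delta> t" using p'S inv unfolding p'(1) S_def by auto
        then have "\<Psi> (g y') = \<Psi> (of_real (x t))" using Y(3)[OF p'(3)] T0(3)[OF p'(2)] by simp
        then have "g y' = of_real (x t)"
          by (rule inj_onD[OF e(2)]) (use Y(3)[OF p'(3)] T0(3)[OF p'(2)] in auto)
        \<comment> \<open>The lift has the real value \<open>x t\<close> in the flat coordinate, so
          only the real part of \<open>W\<close> moves along the trajectory.\<close>
        then have "W y' - W y0 = of_real (\<sigma> * x t)" using Y(3)[OF p'(3)] by simp
        then have "Im (W y') - Im (W y0) = 0" by (metis Im_complex_of_real minus_complex.simps(2))
        then show ?thesis unfolding F_def p'(1) p(1) using inv by simp
      qed
      ultimately show "\<exists>U. open U \<and> p \<in> U \<and> (\<forall>p'\<in>U \<inter> S. F p' = F p)" by blast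
    qed
    moreover have "(\<lambda>y. Im (W y)) ` (V \<inter> \<pi> -` T) \<subseteq> F ` S"
    proof
      fix u assume "u \<in> (\<lambda>y. Im (W y)) ` (V \<inter> \<pi> -` T)"
      then obtain y' where y': "y' \<in> V" "\<pi> y' \<in> T" "u = Im (W y')" by blast
      then obtain t where t: "t \<in> {a<..<b}" "\<pi> y' = \<delta> t" unfolding \<delta>(2) by blast
      have "chart_inv d (snd d y') = y'" using chart_inv_simps(1)[OF surfB d(1)] V(3) y'(1) by blast
      then have "(t, snd d y') \<in> S" "u = F (t, snd d y')" using t y' unfolding S_def F_def by auto
      then show "u \<in> F ` S" by blast
    qed
    ultimately show ?thesis using countable_subset by blast
  qed
  have "(\<lambda>y. Im (W y)) ` (V \<inter> \<pi> -` G) \<subseteq> (\<lambda>y. Im (W y)) ` (V \<inter> \<pi> -` {x. \<not> regular x}) \<union>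
    (\<Union>T\<in>{T. critical_trajectory A q T}. (\<lambda>y. Im (W y)) ` (V \<inter> \<pi> -` T))" (is "_ \<subseteq> ?R")
  proof (rule image_subsetI)
    fix y' assume y': "y' \<in> V \<inter> \<pi> -` G"
    show "Im (W y') \<in> ?R"
    proof (cases "regular (\<pi> y')")
      case True
      obtain T where "critical_trajectory A q T" "\<pi> y' \<in> T" by (rule graph_cases[OF _ True]) (use y' in auto)
      then have "T \<in> {T. critical_trajectory A q T}" "y' \<in> V \<inter> \<pi> -` T" using y' by auto
      then show ?thesis by (intro UnI2 UN_I imageI)
    next
      case False
      then have "y' \<in> V \<inter> \<pi> -` {x. \<not> regular x}" using y' by simp
      then show ?thesis by (intro UnI1 imageI)
    qed
  qed
  moreover have "countable ((\<lambda>y. Im (W y)) ` (V \<inter> \<pi> -` {x. \<not> regular x}) \<union>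
    (\<Union>T\<in>{T. critical_trajectory A q T}. (\<lambda>y. Im (W y)) ` (V \<inter> \<pi> -` T)))"
    by (intro countable_Un countable_UN countable_image crit countable_critical_trajectories traj) simp
  ultimately have "countable ((\<lambda>y. Im (W y)) ` (V \<inter> \<pi> -` G))" by (rule countable_subset)
  then show ?thesis using that V(1,2) by blast
qed

text \<open>
  Over a component of the complement of the critical graph, \<open>\<integral> Im \<omega>\<close> is up to sign the height
  in the cylinder above the end at the boundary of the component.
\<close>

lemma signed_height:
  assumes D: "D \<in> components (- G)"
  obtains \<eta> :: "'b \<Rightarrow> real" where
    "\<And>y W. \<lbrakk>\<pi> y \<in> D; \<forall>\<^sub>F y' in nhds y. primitive_at W y'\<rbrakk> \<Longrightarrow> \<forall>\<^sub>F y' in nhds y. \<eta> y' - \<eta> y = Im (W y' - W y)"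
    "\<And>(f::real \<Rightarrow> 'b) F x L. \<lbrakk>F \<noteq> bot; \<forall>\<^sub>F i in F. \<pi> (f i) \<in> D \<and> f i \<notin> simple_poles B \<omega>;
       ((\<lambda>i. \<pi> (f i)) \<longlongrightarrow> x) F; x \<notin> D; ((\<lambda>i. \<eta> (f i)) \<longlongrightarrow> L) F\<rbrakk> \<Longrightarrow> L = 0"
proof -
  obtain p J \<Phi> \<l> where p: "p \<in> D" "p \<in> double_poles A q" and cyl: "cylinder (D - {p}) J \<Phi> \<l>"
    and nc: "\<not> compact (D - {p})"
    and ends: "\<And>\<alpha>. \<alpha> \<in> J \<Longrightarrow> \<exists>K. compact K \<and> K \<subseteq> D \<and> (\<forall>\<zeta>. Im \<zeta> \<in> J \<longrightarrow> \<Phi> \<zeta> \<notin> K \<longrightarrow> Im \<zeta> < \<alpha>)"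
    using component_cylinder[OF D] by metis
  have J: "open J" "connected J" "J \<noteq> {}" "\<And>\<zeta>. Im \<zeta> \<in> J \<Longrightarrow> flat_at \<Phi> \<zeta>" "\<Phi> ` (Im -` J) = D - {p}"
    using cyl unfolding cylinder_def by auto
  let ?S = "Im -` J"
  have oS: "open ?S" using J(1) by (rule strip_open)
  have flS: "\<And>\<zeta>. \<zeta> \<in> ?S \<Longrightarrow> flat_at \<Phi> \<zeta>" using J(4) by auto
  let ?h = "height J \<Phi>"
  \<comment> \<open>\<open>pos \<sigma> y\<close> says that near \<open>y\<close> some primitive of
    \<open>\<omega>\<close> is, up to a constant, \<open>\<sigma>\<close> times a lift
    \<open>g\<close> of \<open>\<pi>\<close> through \<open>\<Phi>\<close>. The sign is thus
    attached to points of the cover, not of the surface.\<close>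
  define pos where "pos \<sigma> y \<longleftrightarrow> (\<exists>g W. Im (g y) \<in> J \<and> Im (g y) = ?h (\<pi> y) \<and> \<Phi> (g y) = \<pi> y \<and> isCont g y \<and> (\<forall>\<^sub>F y' in nhds y. primitive_at W y') \<and>
    (\<forall>\<^sub>F y' in nhds y. \<Phi> (g y') = \<pi> y' \<and> W y' - W y = of_real \<sigma> * (g y' - g y)))" for \<sigma> :: real and y
  \<comment> \<open>By the second part of \<open>cylinder_injective\<close> the two lifts have the
    same increments, without a half-turn. Different signs would then make the lifts constant near
    \<open>y\<close>, and with them \<open>\<pi>\<close>.\<close>
  have excl: "\<sigma>1 = \<sigma>2" if pos1: "pos \<sigma>1 y" and pos2: "pos \<sigma>2 y" for \<sigma>1 \<sigma>2 y
  proof (rule ccontr)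
    assume ne: "\<sigma>1 \<noteq> \<sigma>2"
    obtain g1 W1 where 1: "Im (g1 y) \<in> J" "\<Phi> (g1 y) = \<pi> y" "isCont g1 y" "\<forall>\<^sub>F y' in nhds y. primitive_at W1 y'"
      "\<forall>\<^sub>F y' in nhds y. \<Phi> (g1 y') = \<pi> y' \<and> W1 y' - W1 y = of_real \<sigma>1 * (g1 y' - g1 y)"
      using pos1 unfolding pos_def by blast
    obtain g2 W2 where 2: "Im (g2 y) \<in> J" "\<Phi> (g2 y) = \<pi> y" "isCont g2 y" "\<forall>\<^sub>F y' in nhds y. primitive_at W2 y'"
      "\<forall>\<^sub>F y' in nhds y. \<Phi> (g2 y') = \<pi> y' \<and> W2 y' - W2 y = of_real \<sigma>2 * (g2 y' - g2 y)"
      using pos2 unfolding pos_def by blast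
    have "\<Phi> (g1 y) = \<Phi> (g2 y)" using 1(2) 2(2) by simp
    from cylinder_injective(2)[OF cyl nc 1(1) 2(1) this]
    obtain r where r: "0 < r" "\<And>u. norm u < r \<Longrightarrow> \<Phi> (g2 y + u) = \<Phi> (g1 y + u)" by blast
    have "g1 y \<in> ?S" using 1(1) by simp
    then obtain e where e: "0 < e" "inj_on \<Phi> (ball (g1 y) e)" using flat_locally_inj[OF oS flS] by metis
    have "\<forall>\<^sub>F y' in nhds y. g1 y' \<in> ball (g1 y) e" using 1(3) e(1) by (intro isCont_eventually_in) auto
    moreover have "\<forall>\<^sub>F y' in nhds y. g2 y' \<in> ball (g2 y) (min r e)" using 2(3) e(1) r(1) by (intro isCont_eventually_in) auto
    moreover note primitive_unique[OF 1(4) 2(4)] 1(5) 2(5)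
    ultimately have "\<forall>\<^sub>F y' in nhds y. \<pi> y' = \<pi> y"
    proof eventually_elim
      case (elim y')
      have n: "norm (g2 y' - g2 y) < r" "norm (g2 y' - g2 y) < e"
        using elim(2) by (auto simp: dist_norm norm_minus_commute)
      have "\<Phi> (g1 y + (g2 y' - g2 y)) = \<Phi> (g1 y')" using r(2)[OF n(1)] elim by simp
      then have "g1 y + (g2 y' - g2 y) = g1 y'"
        by (rule inj_onD[OF e(2)]) (use elim(1) n(2) in \<open>auto simp: dist_norm\<close>, metis n(2) norm_minus_commute)
      then have "g2 y' - g2 y = g1 y' - g1 y" by (simp add: algebra_simps)
      then have "of_real \<sigma>1 * (g1 y' - g1 y) = of_real \<sigma>2 * (g1 y' - g1 y)" using elim by simp
      then have "g1 y' = g1 y" using ne by simp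
      then show ?case using elim(4) 1(2) by simp
    qed
    then show False by (rule \<pi>_not_locally_constant)
  qed
  \<comment> \<open>The value -1 is also the default where neither sign is realised; the absolute
    value of \<open>\<eta>\<close> does not depend on it.\<close>
  define sgn where "sgn y = (if pos 1 y then 1 else -1 :: real)" for y
  have sgn: "sgn y = \<sigma>" if "pos \<sigma> y" "\<sigma> \<in> {1, -1}" for y \<sigma>
    using that excl[OF that(1), of 1] unfolding sgn_def by auto
  \<comment> \<open>The height of the boundary end. If \<open>J\<close> is unbounded below, the
    infimum has no such meaning; this case is settled separately at the end.\<close>
  define a where "a = Inf J"
  define \<eta> where "\<eta> y = sgn y * (?h (\<pi> y) - a)" for y
  have hJ: "?h x \<in> J \<and> (\<exists>\<zeta>. Im \<zeta> = ?h x \<and> \<Phi> \<zeta> = x)" if "x \<in> D - {p}" for x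
    using that height_eq[OF cyl nc] J(5) by (metis (no_types, lifting) image_iff vimage_eq)
  show ?thesis
  proof (rule that[of \<eta>])
    fix y W assume y: "\<pi> y \<in> D" and W: "\<forall>\<^sub>F y' in nhds y. primitive_at W y'"
    have "\<pi> y \<noteq> p" using p(2) primitive_not_over_double_pole[OF W] by metis
    then have "\<pi> y \<in> \<Phi> ` ?S" unfolding J(5) using y by simp
    then obtain \<zeta>0 where \<zeta>0: "\<zeta>0 \<in> ?S" "\<Phi> \<zeta>0 = \<pi> y" by (metis imageE)
    obtain g \<sigma> where g: "\<sigma> \<in> {1, -1::real}" "g y = \<zeta>0" "isCont g y"
      "\<forall>\<^sub>F y' in nhds y. isCont g y' \<and> g y' \<in> ?S \<and> \<Phi> (g y') = \<pi> y' \<and> W y' - W y = of_real \<sigma> * (g y' - \<zeta>0)"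
      by (rule flat_lift[OF W oS flS \<zeta>0])
    have "\<forall>\<^sub>F y' in nhds y. (\<forall>\<^sub>F y'' in nhds y'. primitive_at W y'') \<and>
      (\<forall>\<^sub>F y'' in nhds y'. isCont g y'' \<and> g y'' \<in> ?S \<and> \<Phi> (g y'') = \<pi> y'' \<and> W y'' - W y = of_real \<sigma> * (g y'' - \<zeta>0))"
      by (intro eventually_conj eventually_eventually[THEN iffD2] W g(4))
    then have main: "\<forall>\<^sub>F y' in nhds y. sgn y' = \<sigma> \<and> ?h (\<pi> y') = Im (g y') \<and> W y' - W y = of_real \<sigma> * (g y' - \<zeta>0)"
    proof eventually_elim
      case (elim y')
      from eventually_nhds_x_imp_x[OF conjunct2[OF elim]]
      have y': "isCont g y'" "Im (g y') \<in> J" "\<Phi> (g y') = \<pi> y'" "W y' - W y = of_real \<sigma> * (g y' - \<zeta>0)" by auto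
      have h: "Im (g y') = ?h (\<pi> y')" using height_eq[OF cyl nc y'(2)] y'(3) by simp
      have "\<forall>\<^sub>F y'' in nhds y'. \<Phi> (g y'') = \<pi> y'' \<and> W y'' - W y' = of_real \<sigma> * (g y'' - g y')"
        using conjunct2[OF elim]
      proof eventually_elim
        case (elim y'')
        then have "W y'' - W y' = of_real \<sigma> * (g y'' - \<zeta>0) - of_real \<sigma> * (g y' - \<zeta>0)"
          using y'(4) by (metis diff_diff_eq2 diff_add_cancel add_diff_cancel_right')
        then show ?case using elim by (simp add: algebra_simps)
      qed
      then have "pos \<sigma> y'" unfolding pos_def using y' h conjunct1[OF elim] by blast
      then show ?case using sgn g(1) h y'(4) by simp
    qed
    have y0: "sgn y = \<sigma>" "?h (\<pi> y) = Im \<zeta>0" using eventually_nhds_x_imp_x[OF main] g(2) by auto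
    show "\<forall>\<^sub>F y' in nhds y. \<eta> y' - \<eta> y = Im (W y' - W y)"
      using main
    proof eventually_elim
      case (elim y')
      then have "\<eta> y' - \<eta> y = \<sigma> * (Im (g y') - Im \<zeta>0)" unfolding \<eta>_def y0 by (simp add: algebra_simps)
      then show ?case using elim by simp
    qed
  next
    fix f :: "real \<Rightarrow> 'b" and F x L
    assume F: "F \<noteq> bot" and ev: "\<forall>\<^sub>F i in F. \<pi> (f i) \<in> D \<and> f i \<notin> simple_poles B \<omega>"
      and lim: "((\<lambda>i. \<pi> (f i)) \<longlongrightarrow> x) F" and x: "x \<notin> D" and L: "((\<lambda>i. \<eta> (f i)) \<longlongrightarrow> L) F"
    \<comment> \<open>Converging to a point outside \<open>D\<close>, the points leave every compact
      subset of \<open>D\<close>, so their heights drop below every \<open>\<alpha>\<close> in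
      \<open>J\<close>.\<close>
    have low: "\<forall>\<^sub>F i in F. ?h (\<pi> (f i)) \<in> J \<and> ?h (\<pi> (f i)) < \<alpha>" if \<alpha>J: "\<alpha> \<in> J" for \<alpha>
    proof -
      obtain K where K: "compact K" "K \<subseteq> D" "\<And>\<zeta>. Im \<zeta> \<in> J \<Longrightarrow> \<Phi> \<zeta> \<notin> K \<Longrightarrow> Im \<zeta> < \<alpha>" using ends[OF \<alpha>J] by blast
      have "\<forall>\<^sub>F i in F. \<pi> (f i) \<in> - K"
        using topological_tendstoD[OF lim, of "- K"] K(1,2) x by (auto simp: compact_imp_closed open_Compl)
      with ev show ?thesis
      proof eventually_elim
        case (elim i)
        obtain W where "\<forall>\<^sub>F y' in nhds (f i). primitive_at W y'" using primitive_exists elim(1) by metis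
        then have "\<pi> (f i) \<noteq> p" using primitive_not_over_double_pole p(2) by metis
        then have "\<pi> (f i) \<in> D - {p}" using elim by blast
        from hJ[OF this] obtain \<zeta> where "Im \<zeta> = ?h (\<pi> (f i))" "\<Phi> \<zeta> = \<pi> (f i)" "?h (\<pi> (f i)) \<in> J" by blast
        then show ?case using K(3)[of \<zeta>] elim(2) by auto
      qed
    qed
    have abs: "\<bar>\<eta> y\<bar> = \<bar>?h (\<pi> y) - a\<bar>" for y unfolding \<eta>_def sgn_def by (auto simp: abs_mult)
    show "L = 0"
    proof (cases "bdd_below J")
      case True
      have "((\<lambda>i. \<eta> (f i)) \<longlongrightarrow> 0) F"
      proof (rule tendstoI)
        fix e :: real assume "0 < e"
        then obtain \<alpha> where \<alpha>: "\<alpha> \<in> J" "\<alpha> < a + e"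
          using cInf_lessD[of J "a + e"] J(3) unfolding a_def by auto
        from low[OF \<alpha>(1)] show "\<forall>\<^sub>F i in F. dist (\<eta> (f i)) 0 < e"
        proof eventually_elim
          case (elim i)
          then have "a \<le> ?h (\<pi> (f i))" unfolding a_def using True by (intro cInf_lower) auto
          then show ?case using elim \<alpha>(2) by (simp add: abs)
        qed
      qed
      then show ?thesis using L F tendsto_unique by blast
    next
      case False
      \<comment> \<open>An end of infinite height cannot be approached here: \<open>\<eta>\<close>
        would exceed \<open>\<bar>L\<bar> + 1\<close> in absolute value and yet come within 1 of its
        limit \<open>L\<close>.\<close>
      then obtain \<alpha> where \<alpha>: "\<alpha> \<in> J" "\<alpha> < a - (\<bar>L\<bar> + 1)" unfolding bdd_below_def by (meson not_le)
      have "\<forall>\<^sub>F i in F. dist (\<eta> (f i)) L < 1" using tendstoD[OF L] by simp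
      with low[OF \<alpha>(1)] have "\<forall>\<^sub>F i in F. False"
      proof eventually_elim
        case (elim i)
        have "\<bar>L\<bar> + 1 < \<bar>\<eta> (f i)\<bar>" unfolding abs using elim(1) \<alpha>(2) by linarith
        then show ?case using elim(2) by (simp add: dist_real_def)
      qed
      then show ?thesis using F by simp
    qed
  qed
qed

subsection \<open>Integration along the path\<close>

text \<open>\<open>V\<close> is the indefinite integral of the integrand along the path. Near each
  parameter the fundamental theorem identifies its increments with those of any local primitive,
  whichever charts \<open>chart_at\<close> selects on the way.\<close>

lemma path_primitive:
  assumes \<gamma>: "piecewise_smooth_path B \<gamma>" and avoid: "path_image \<gamma> \<inter> simple_poles B \<omega> = {}"
  obtains V :: "real \<Rightarrow> complex" where "continuous_on {0..1} V" "form_has_integral B \<omega> \<gamma> (V 1 - V 0)"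
    "\<And>t W. \<lbrakk>t \<in> {0..1}; \<forall>\<^sub>F y' in nhds (\<gamma> t). primitive_at W y'\<rbrakk> \<Longrightarrow>
       \<exists>e>0. \<forall>s\<in>{0..1}. \<bar>s - t\<bar> < e \<longrightarrow> V s - V t = W (\<gamma> s) - W (\<gamma> t)"
proof -
  have cont: "continuous_on {0..1} \<gamma>" using \<gamma> unfolding piecewise_smooth_path_def path_def by blast
  have pw: "(snd d \<circ> \<gamma>) piecewise_C1_differentiable_on {a..b}"
    if "d \<in> B" "{a..b} \<subseteq> {0..1}" "\<gamma> ` {a..b} \<subseteq> fst d" for d a b
    using \<gamma> that unfolding piecewise_smooth_path_def by blast
  define f where "f t = (let d = chart_at B (\<gamma> t) in
         \<omega> d (snd d (\<gamma> t)) * vector_derivative (snd d \<circ> \<gamma>) (at t within {0..1}))" for t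
  have loc: "\<exists>e>0. \<forall>a b. 0 \<le> a \<longrightarrow> a \<le> b \<longrightarrow> b \<le> 1 \<longrightarrow> {a..b} \<subseteq> ball t e \<longrightarrow> (f has_integral W (\<gamma> b) - W (\<gamma> a)) {a..b}"
    if t: "t \<in> {0..1}" and W: "\<forall>\<^sub>F y' in nhds (\<gamma> t). primitive_at W y'" for t W
  proof -
    obtain d where d: "d \<in> B" "\<gamma> t \<in> fst d" using chart_exists[OF surfB] .
    obtain e0 where e0: "0 < e0" "ball (snd d (\<gamma> t)) e0 \<subseteq> snd d ` fst d"
      "\<And>z. z \<in> ball (snd d (\<gamma> t)) e0 \<Longrightarrow> ((W \<circ> chart_inv d) has_field_derivative \<omega> d z) (at z)"
      using primitive_chart[OF W d] by metis
    have "\<forall>\<^sub>F z in nhds (snd d (\<gamma> t)). z \<in> ball (snd d (\<gamma> t)) e0" using e0(1) by (intro eventually_nhds_in_open) auto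
    then have "\<forall>\<^sub>F y' in nhds (\<gamma> t). snd d y' \<in> ball (snd d (\<gamma> t)) e0"
      using eventually_chart[OF surfB d, of "\<lambda>z. z \<in> ball (snd d (\<gamma> t)) e0"] by simp
    moreover have "\<forall>\<^sub>F y' in nhds (\<gamma> t). y' \<in> fst d"
      using d riemann_surface_chart(1)[OF surfB d(1)] by (intro eventually_nhds_in_open) auto
    ultimately have "\<forall>\<^sub>F y' in nhds (\<gamma> t). snd d y' \<in> ball (snd d (\<gamma> t)) e0 \<and> y' \<in> fst d" by eventually_elim auto
    then obtain U where U: "open U" "\<gamma> t \<in> U" "\<And>y. y \<in> U \<Longrightarrow> snd d y \<in> ball (snd d (\<gamma> t)) e0 \<and> y \<in> fst d"
      unfolding eventually_nhds by blast
    obtain Q where Q: "open Q" "{0..1} \<inter> \<gamma> -` U = Q \<inter> {0..1}"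
      using cont U(1) unfolding continuous_on_open_invariant by (metis Int_commute)
    have "t \<in> Q" using Q(2) t U(2) by blast
    then obtain e where e: "0 < e" "ball t e \<subseteq> Q" using Q(1) open_contains_ball by blast
    show ?thesis
    proof (intro exI[of _ e] conjI allI impI)
      fix a b :: real assume ab: "0 \<le> a" "a \<le> b" "b \<le> 1" "{a..b} \<subseteq> ball t e"
      have sub: "{a..b} \<subseteq> {0..1}" using ab by auto
      have \<gamma>U: "\<gamma> s \<in> U" if "s \<in> {a..b}" for s using that ab(4) sub e(2) Q(2) by blast
      have "\<gamma> ` {a..b} \<subseteq> fst d" using \<gamma>U U(3) by blast
      from pw[OF d(1) sub this] obtain S where S: "continuous_on {a..b} (snd d \<circ> \<gamma>)" "finite S"
        "(snd d \<circ> \<gamma>) C1_differentiable_on ({a..b} - S)"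
        unfolding piecewise_C1_differentiable_on_def by blast
      have "((f has_integral (W \<circ> \<gamma>) b - (W \<circ> \<gamma>) a)) {a..b}"
      \<comment> \<open>Derivatives are required only off the end points and the finite set
        \<open>S\<close> of break points, where the integrand may depend on the selected
        chart.\<close>
      proof (rule fundamental_theorem_of_calculus_interior_strong[OF S(2) ab(2)])
        have "continuous_on (ball (snd d (\<gamma> t)) e0) (W \<circ> chart_inv d)"
          by (intro continuous_at_imp_continuous_on ballI DERIV_isCont[OF e0(3)])
        then have "continuous_on ((snd d \<circ> \<gamma>) ` {a..b}) (W \<circ> chart_inv d)"
          by (rule continuous_on_subset) (use \<gamma>U U(3) in auto)
        then have "continuous_on {a..b} ((W \<circ> chart_inv d) \<circ> (snd d \<circ> \<gamma>))"
          by (rule continuous_on_compose[OF S(1)])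
        then show "continuous_on {a..b} (W \<circ> \<gamma>)"
          by (rule continuous_on_eq) (use \<gamma>U U(3) chart_inv_simps(1)[OF surfB d(1)] in auto)
        fix s assume s: "s \<in> {a<..<b} - S"
        then have sab: "s \<in> {a..b}" and s01: "s \<in> {0<..<1}" using ab by auto
        obtain v where v: "((snd d \<circ> \<gamma>) has_vector_derivative v) (at s)"
          using S(3) s sab unfolding C1_differentiable_on_def by blast
        have "continuous_on {0<..<1} \<gamma>" by (rule continuous_on_subset[OF cont]) auto
        then have \<gamma>s: "isCont \<gamma> s" using s01 by (simp add: continuous_on_eq_continuous_at)
        have "\<gamma> s \<in> fst d" and zs: "snd d (\<gamma> s) \<in> ball (snd d (\<gamma> t)) e0" using \<gamma>U[OF sab] U(3) by auto
        define d' where "d' = chart_at B (\<gamma> s)"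
        have d': "d' \<in> B" "\<gamma> s \<in> fst d'" unfolding d'_def using chart_at_in[OF surfB] by auto
        let ?\<tau> = "deriv (snd d' \<circ> chart_inv d) (snd d (\<gamma> s))"
        have "((snd d' \<circ> \<gamma>) has_vector_derivative ?\<tau> * v) (at s)"
          by (rule chart_change_to_vector[OF surfB d(1) d'(1) \<open>\<gamma> s \<in> fst d\<close> d'(2) \<gamma>s v])
        then have "vector_derivative (snd d' \<circ> \<gamma>) (at s within {0..1}) = ?\<tau> * v"
          using s01 by (simp add: at_within_Icc_at vector_derivative_at)
        then have fs: "f s = v * \<omega> d (snd d (\<gamma> s))"
          using differential_change[OF surfB form d(1) d'(1) \<open>\<gamma> s \<in> fst d\<close> d'(2)]
          unfolding f_def Let_def d'_def[symmetric] by simp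
        have "((W \<circ> chart_inv d) \<circ> (snd d \<circ> \<gamma>) has_vector_derivative v * \<omega> d (snd d (\<gamma> s))) (at s)"
          using e0(3)[OF zs] by (intro field_vector_diff_chain_at v) simp
        moreover have ev: "\<forall>\<^sub>F u in nhds s. ((W \<circ> chart_inv d) \<circ> (snd d \<circ> \<gamma>)) u = (W \<circ> \<gamma>) u"
          using isCont_eventually_in[OF \<gamma>s riemann_surface_chart(1)[OF surfB d(1)] \<open>\<gamma> s \<in> fst d\<close>]
          by eventually_elim (use chart_inv_simps(1)[OF surfB d(1)] in auto)
        ultimately show "((W \<circ> \<gamma>) has_vector_derivative f s) (at s)"
          unfolding fs
          using has_vector_derivative_cong_ev[where f = "(W \<circ> chart_inv d) \<circ> (snd d \<circ> \<gamma>)" and g = "W \<circ> \<gamma>" and x = s and S = UNIV]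
            eventually_nhds_x_imp_x[OF ev] by (auto elim!: eventually_mono)
      qed
      then show "(f has_integral W (\<gamma> b) - W (\<gamma> a)) {a..b}" by simp
    qed (fact e(1))
  qed
  have "f integrable_on cbox 0 1"
  \<comment> \<open>Integrability on small intervals around each parameter suffices, by compactness
    of the unit interval.\<close>
  proof (rule integrable_on_little_subintervals, intro ballI)
    fix t :: real assume t: "t \<in> cbox 0 1"
    then have "\<gamma> t \<in> path_image \<gamma>" unfolding path_image_def by simp
    then have "\<gamma> t \<notin> simple_poles B \<omega>" using avoid by blast
    then obtain W where W: "\<forall>\<^sub>F y' in nhds (\<gamma> t). primitive_at W y'" using primitive_exists by metis
    obtain e where e: "e > 0" "\<And>a b. 0 \<le> a \<Longrightarrow> a \<le> b \<Longrightarrow> b \<le> 1 \<Longrightarrow> {a..b} \<subseteq> ball t e \<Longrightarrow> (f has_integral W (\<gamma> b) - W (\<gamma> a)) {a..b}"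
      using loc[OF _ W] t by auto
    have "f integrable_on cbox u v" if "t \<in> cbox u v" "cbox u v \<subseteq> ball t e" "cbox u v \<subseteq> cbox 0 1" for u v
    proof -
      have "u \<le> v" "0 \<le> u" "v \<le> 1" using that(1,3) by auto
      then show ?thesis using e(2)[of u v] that(2) by (auto simp: integrable_on_def)
    qed
    then show "\<exists>e>0. \<forall>u v. t \<in> cbox u v \<and> cbox u v \<subseteq> ball t e \<and> cbox u v \<subseteq> cbox 0 1 \<longrightarrow> f integrable_on cbox u v"
      using e(1) by blast
  qed
  then have int: "f integrable_on {0..1}" by simp
  define V where "V s = integral {0..s} f" for s
  show ?thesis
  proof (rule that[of V])
    show "continuous_on {0..1} V" unfolding V_def by (rule indefinite_integral_continuous_1[OF int])
    show "form_has_integral B \<omega> \<gamma> (V 1 - V 0)"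
      unfolding form_has_integral_def f_def[symmetric] using integrable_integral[OF int] by (simp add: V_def)
    fix t W assume t: "t \<in> {0..1}" and W: "\<forall>\<^sub>F y' in nhds (\<gamma> t). primitive_at W y'"
    obtain e where e: "e > 0" "\<And>a b. 0 \<le> a \<Longrightarrow> a \<le> b \<Longrightarrow> b \<le> 1 \<Longrightarrow> {a..b} \<subseteq> ball t e \<Longrightarrow> (f has_integral W (\<gamma> b) - W (\<gamma> a)) {a..b}"
      using loc[OF t W] by auto
    have V: "V b - V a = W (\<gamma> b) - W (\<gamma> a)" if "0 \<le> a" "a \<le> b" "b \<le> 1" "{a..b} \<subseteq> ball t e" for a b
    proof -
      have "f integrable_on {0..b}" using int by (rule integrable_on_subinterval) (use that in auto)
      then have "V a + integral {a..b} f = V b" unfolding V_def using that by (intro Henstock_Kurzweil_Integration.integral_combine) auto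
      then show ?thesis using integral_unique[OF e(2)[OF that]] by (simp add: algebra_simps)
    qed
    show "\<exists>e>0. \<forall>s\<in>{0..1}. \<bar>s - t\<bar> < e \<longrightarrow> V s - V t = W (\<gamma> s) - W (\<gamma> t)"
    proof (intro exI[of _ e] conjI ballI impI)
      fix s assume s: "s \<in> {0..1}" "\<bar>s - t\<bar> < e"
      show "V s - V t = W (\<gamma> s) - W (\<gamma> t)"
      proof (cases "s \<le> t")
        case True
        have "V t - V s = W (\<gamma> t) - W (\<gamma> s)" using True s t by (intro V) (auto simp: dist_real_def)
        then show ?thesis by (simp add: algebra_simps)
      next
        case False
        then show ?thesis using s t by (intro V) (auto simp: dist_real_def)
      qed
    qed (fact e(1))
  qed
qed

text \<open>With \<open>v\<close> the imaginary part of \<open>V\<close> the aim is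
  \<open>v 1 = v 0\<close>. The signed height takes the same value at both ends of the loop, so this
  amounts to \<open>u 0 = u 1\<close>.\<close>

lemma real_period:
  assumes \<gamma>: "piecewise_smooth_path B \<gamma>" and loop: "pathfinish \<gamma> = pathstart \<gamma>"
    and avoid: "path_image \<gamma> \<inter> simple_poles B \<omega> = {}"
  shows "\<exists>r::real. form_has_integral B \<omega> \<gamma> (of_real r)"
proof (rule path_primitive[OF \<gamma> avoid])
  fix V :: "real \<Rightarrow> complex"
  assume V: "continuous_on {0..1} V" "form_has_integral B \<omega> \<gamma> (V 1 - V 0)"
    "\<And>t W. \<lbrakk>t \<in> {0..1}; \<forall>\<^sub>F y' in nhds (\<gamma> t). primitive_at W y'\<rbrakk> \<Longrightarrow>
       \<exists>e>0. \<forall>s\<in>{0..1}. \<bar>s - t\<bar> < e \<longrightarrow> V s - V t = W (\<gamma> s) - W (\<gamma> t)"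
  have cont: "continuous_on {0..1} \<gamma>" using \<gamma> unfolding piecewise_smooth_path_def path_def by blast
  have np: "\<gamma> t \<notin> simple_poles B \<omega>" if "t \<in> {0..1}" for t
    using avoid that unfolding path_image_def by blast
  have prim: "\<exists>W. \<forall>\<^sub>F y' in nhds (\<gamma> t). primitive_at W y'" if "t \<in> {0..1}" for t
    using primitive_exists[OF np[OF that]] by metis
  define v where "v t = Im (V t)" for t
  have vc: "continuous_on {0..1} v" unfolding v_def using V(1) by (intro continuous_intros)
  have "\<forall>D\<in>components (- G). \<exists>\<eta>::'b \<Rightarrow> real.
    (\<forall>y W. \<pi> y \<in> D \<longrightarrow> (\<forall>\<^sub>F y' in nhds y. primitive_at W y') \<longrightarrow> (\<forall>\<^sub>F y' in nhds y. \<eta> y' - \<eta> y = Im (W y' - W y))) \<and>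
    (\<forall>(f::real \<Rightarrow> 'b) F x L. F \<noteq> bot \<longrightarrow> (\<forall>\<^sub>F i in F. \<pi> (f i) \<in> D \<and> f i \<notin> simple_poles B \<omega>) \<longrightarrow>
       ((\<lambda>i. \<pi> (f i)) \<longlongrightarrow> x) F \<longrightarrow> x \<notin> D \<longrightarrow> ((\<lambda>i. \<eta> (f i)) \<longlongrightarrow> L) F \<longrightarrow> L = 0)"
    (is "\<forall>D\<in>_. \<exists>\<eta>. ?P D \<eta>")
  proof
    fix D assume D: "D \<in> components (- G)"
    show "\<exists>\<eta>. ?P D \<eta>"
    proof (rule signed_height[OF D])
      fix \<eta> :: "'b \<Rightarrow> real"
      assume 1: "\<And>y W. \<lbrakk>\<pi> y \<in> D; \<forall>\<^sub>F y' in nhds y. primitive_at W y'\<rbrakk> \<Longrightarrow> \<forall>\<^sub>F y' in nhds y. \<eta> y' - \<eta> y = Im (W y' - W y)"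
        and 2: "\<And>(f::real \<Rightarrow> 'b) F x L. \<lbrakk>F \<noteq> bot; \<forall>\<^sub>F i in F. \<pi> (f i) \<in> D \<and> f i \<notin> simple_poles B \<omega>;
          ((\<lambda>i. \<pi> (f i)) \<longlongrightarrow> x) F; x \<notin> D; ((\<lambda>i. \<eta> (f i)) \<longlongrightarrow> L) F\<rbrakk> \<Longrightarrow> L = 0"
      show "\<exists>\<eta>. ?P D \<eta>"
        by (intro exI[of _ \<eta>] conjI allI impI) (rule 1, assumption+, rule 2)
    qed
  qed
  from bchoice[OF this] obtain H where H: "\<forall>D\<in>components (- G). ?P D (H D)" ..
  note H = bspec[OF H]
  \<comment> \<open>The value 0 over the graph is the boundary value of every signed height; with it
    \<open>u\<close> coincides with \<open>v\<close> on \<open>E\<close>.\<close>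
  define \<eta> where "\<eta> y = (if \<pi> y \<in> G then 0 else H (connected_component_set (- G) (\<pi> y)) y)" for y
  have comp: "connected_component_set (- G) x = D" if "D \<in> components (- G)" "x \<in> D" for x D
    using that by (metis components_iff connected_component_eq)
  have \<eta>D: "\<eta> y = H D y" if "D \<in> components (- G)" "\<pi> y \<in> D" for y D
    using comp[OF that] component_facts(5)[OF that(1)] that(2) unfolding \<eta>_def by auto
  have inD: "\<exists>D\<in>components (- G). x \<in> D" if "x \<notin> G" for x
    using that Union_components[of "- G"] by blast
  have \<eta>: "\<forall>\<^sub>F y' in nhds y. \<eta> y' - \<eta> y = Im (W y' - W y)"
    if y: "\<pi> y \<notin> G" and W: "\<forall>\<^sub>F y' in nhds y. primitive_at W y'" for y W
  proof -
    obtain D where D: "D \<in> components (- G)" "\<pi> y \<in> D" using inD[OF y] by blast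
    have "\<forall>\<^sub>F y' in nhds y. H D y' - H D y = Im (W y' - W y)" using H[OF D(1)] D(2) W by blast
    moreover have "\<forall>\<^sub>F y' in nhds y. \<pi> y' \<in> D"
      using isCont_eventually_in[OF \<pi>_isCont component_facts(1)[OF D(1)] D(2)] .
    ultimately show ?thesis by eventually_elim (use \<eta>D[OF D(1)] D(2) in simp)
  qed
  define E where "E = {t \<in> {0..1}. \<pi> (\<gamma> t) \<in> G}"
  have "closed E"
  proof -
    have "continuous_on {0..1} (\<lambda>t. \<pi> (\<gamma> t))"
      using holo_\<pi> continuous_on_compose2[OF _ cont, of UNIV \<pi>] unfolding holomorphic_map_def by auto
    from continuous_closed_preimage[OF this _ closed_graph]
    show ?thesis unfolding E_def vimage_def by (simp add: Int_def)
  qed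
  define u where "u t = v t - \<eta> (\<gamma> t)" for t
  have uE: "u t = v t" if "t \<in> E" for t using that unfolding u_def E_def \<eta>_def by simp
  have evt: "\<exists>e>0. \<forall>s\<in>{0..1}. \<bar>s - t\<bar> < e \<longrightarrow> P (\<gamma> s)"
    if t: "t \<in> {0..1}" and P: "\<forall>\<^sub>F y' in nhds (\<gamma> t). P y'" for t P
  proof -
    obtain U where U: "open U" "\<gamma> t \<in> U" "\<And>y. y \<in> U \<Longrightarrow> P y" using P unfolding eventually_nhds by blast
    have "(\<gamma> \<longlongrightarrow> \<gamma> t) (at t within {0..1})" using cont t unfolding continuous_on_def by blast
    then have "\<forall>\<^sub>F s in at t within {0..1}. \<gamma> s \<in> U" using U(1,2) by (rule topological_tendstoD)
    then obtain e where e: "0 < e" "\<And>s. s \<in> {0..1} \<Longrightarrow> s \<noteq> t \<Longrightarrow> dist s t < e \<Longrightarrow> \<gamma> s \<in> U"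
      unfolding eventually_at by blast
    have "P (\<gamma> s)" if "s \<in> {0..1}" "\<bar>s - t\<bar> < e" for s
      using e(2)[of s] U(2,3) that by (cases "s = t") (auto simp: dist_real_def)
    then show ?thesis using e(1) by blast
  qed
  have uloc: "\<exists>e>0. \<forall>s\<in>{0..1}. \<bar>s - t\<bar> < e \<longrightarrow> u s = u t" if t: "t \<in> {0..1} - E" for t
  proof -
    have t': "t \<in> {0..1}" "\<pi> (\<gamma> t) \<notin> G" using t unfolding E_def by auto
    obtain W where W: "\<forall>\<^sub>F y' in nhds (\<gamma> t). primitive_at W y'" using prim[OF t'(1)] by blast
    obtain e1 where e1: "0 < e1" "\<forall>s\<in>{0..1}. \<bar>s - t\<bar> < e1 \<longrightarrow> V s - V t = W (\<gamma> s) - W (\<gamma> t)"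
      using V(3)[OF t'(1) W] by blast
    obtain e2 where e2: "0 < e2" "\<forall>s\<in>{0..1}. \<bar>s - t\<bar> < e2 \<longrightarrow> \<eta> (\<gamma> s) - \<eta> (\<gamma> t) = Im (W (\<gamma> s) - W (\<gamma> t))"
      using evt[OF t'(1) \<eta>[OF t'(2) W]] by blast
    have "u s = u t" if s: "s \<in> {0..1}" "\<bar>s - t\<bar> < min e1 e2" for s
    proof -
      have "V s - V t = W (\<gamma> s) - W (\<gamma> t)" using e1(2) s by simp
      then have "v s - v t = Im (W (\<gamma> s) - W (\<gamma> t))" unfolding v_def by (metis minus_complex.simps(2))
      moreover have "\<eta> (\<gamma> s) - \<eta> (\<gamma> t) = Im (W (\<gamma> s) - W (\<gamma> t))" using e2(2) s by simp
      ultimately show ?thesis unfolding u_def by linarith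
    qed
    then show ?thesis using e1(1) e2(1) by (intro exI[of _ "min e1 e2"]) auto
  qed
  \<comment> \<open>On a gap of \<open>E\<close> the function \<open>u\<close> is constant, so at an
    end \<open>s\<close> of the gap the signed height has the limit \<open>v s - u t\<close>, which
    \<open>signed_height\<close> forces to be 0. The affine parameter from \<open>s\<close> to
    \<open>t\<close> treats gaps on either side of \<open>s\<close> alike.\<close>
  have uv: "u t = v s"
    if s: "s \<in> E" and t: "t \<in> {0..1}" and off: "\<And>x. 0 < x \<Longrightarrow> x \<le> 1 \<Longrightarrow> s + x * (t - s) \<notin> E" for s t
  proof -
    define \<rho> where "\<rho> x = s + x * (t - s)" for x :: real
    have s01: "s \<in> {0..1}" using s unfolding E_def by auto
    have \<rho>01: "\<rho> x \<in> {0..1}" if "0 \<le> x" "x \<le> 1" for x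
    proof -
      have "(1 - x) *\<^sub>R s + x *\<^sub>R t \<in> {0..1}"
        using that s01 t by (intro convexD[OF convex_real_interval(5)]) auto
      moreover have "(1 - x) *\<^sub>R s + x *\<^sub>R t = \<rho> x" unfolding \<rho>_def by (simp add: algebra_simps)
      ultimately show ?thesis by simp
    qed
    have \<rho>off: "\<rho> x \<in> {0..1} - E" if "x \<in> {0<..1}" for x
      using off \<rho>01 that unfolding \<rho>_def by auto
    have \<rho>c: "isCont \<rho> x" for x unfolding \<rho>_def by (intro continuous_intros)
    have const: "u (\<rho> x) = u (\<rho> 1)" if "x \<in> {0<..1}" for x
    proof (rule connected_equivalence_relation[of "{0<..1}" x 1 "\<lambda>x y. u (\<rho> x) = u (\<rho> y)"])
      fix x :: real assume x: "x \<in> {0<..1}"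
      obtain e where e: "0 < e" "\<forall>s\<in>{0..1}. \<bar>s - \<rho> x\<bar> < e \<longrightarrow> u s = u (\<rho> x)" using uloc[OF \<rho>off[OF x]] by blast
      have "\<forall>\<^sub>F y in nhds x. \<rho> y \<in> ball (\<rho> x) e" using e(1) by (intro isCont_eventually_in[OF \<rho>c]) auto
      moreover have "\<forall>\<^sub>F y in nhds x. True" by simp
      ultimately have ev: "\<forall>\<^sub>F y in nhds x. y \<in> {0<..1} \<longrightarrow> u (\<rho> x) = u (\<rho> y)"
      proof eventually_elim
        case (elim y)
        have "\<bar>\<rho> y - \<rho> x\<bar> < e" using elim(1) by (simp add: dist_real_def abs_minus_commute)
        then show ?case using e(2) \<rho>off[of y] by simp
      qed
      obtain U where U: "openin (top_of_set {0<..1}) U" "x \<in> U" "\<forall>y\<in>U. y \<in> {0<..1} \<longrightarrow> u (\<rho> x) = u (\<rho> y)"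
        using eventually_nhds_openin[OF ev x] by blast
      then have "\<forall>y\<in>U. u (\<rho> x) = u (\<rho> y)" using openin_imp_subset[OF U(1)] by blast
      then show "\<exists>U. openin (top_of_set {0<..1}) U \<and> x \<in> U \<and> (\<forall>y\<in>U. u (\<rho> x) = u (\<rho> y))" using U(1,2) by blast
    qed (use that in auto)
    have "\<rho> 1 = t" unfolding \<rho>_def by simp
    have "\<pi> (\<gamma> t) \<notin> G" using \<rho>off[of 1] t \<open>\<rho> 1 = t\<close> unfolding E_def by auto
    then obtain D where D: "D \<in> components (- G)" "\<pi> (\<gamma> t) \<in> D" using inD by blast
    have \<pi>\<gamma>: "continuous_on {0..1} (\<pi> \<circ> \<gamma>)"
      using holo_\<pi> unfolding holomorphic_map_def by (intro continuous_on_compose cont) (auto intro: continuous_on_subset)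
    have \<rho>cont: "continuous_on {0..1} \<rho>" "\<rho> ` {0..1} \<subseteq> {0..1}"
      using \<rho>c \<rho>01 by (auto intro: continuous_at_imp_continuous_on)
    have \<pi>c: "continuous_on {0..1} (\<lambda>x. \<pi> (\<gamma> (\<rho> x)))"
      using continuous_on_compose2[OF \<pi>\<gamma> \<rho>cont] by simp
    have img: "(\<lambda>x. \<pi> (\<gamma> (\<rho> x))) ` {0<..1} \<subseteq> D"
    proof (rule components_maximal[OF D(1)])
      show "connected ((\<lambda>x. \<pi> (\<gamma> (\<rho> x))) ` {0<..1})"
        by (rule connected_continuous_image[OF continuous_on_subset[OF \<pi>c]]) auto
      show "(\<lambda>x. \<pi> (\<gamma> (\<rho> x))) ` {0<..1} \<subseteq> - G" using \<rho>off unfolding E_def by blast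
      have "\<pi> (\<gamma> t) \<in> (\<lambda>x. \<pi> (\<gamma> (\<rho> x))) ` {0<..1}" using \<open>\<rho> 1 = t\<close> by (intro image_eqI[of _ _ 1]) auto
      then show "D \<inter> (\<lambda>x. \<pi> (\<gamma> (\<rho> x))) ` {0<..1} \<noteq> {}" using D(2) by blast
    qed
    have evI: "\<forall>\<^sub>F x in at_right 0. x \<in> {0<..1::real}"
      unfolding eventually_at_right_field by (intro exI[of _ 1]) auto
    have atr: "at_right (0::real) \<le> at 0 within {0..1}"
    proof -
      have "at (0::real) within {0..1} = at_right 0" by (rule at_within_Icc_at_right) simp
      then show ?thesis by simp
    qed
    have lim\<pi>: "((\<lambda>x. \<pi> (\<gamma> (\<rho> x))) \<longlongrightarrow> \<pi> (\<gamma> s)) (at_right 0)"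
    proof -
      have "((\<lambda>x. \<pi> (\<gamma> (\<rho> x))) \<longlongrightarrow> \<pi> (\<gamma> (\<rho> 0))) (at 0 within {0..1})"
        using \<pi>c unfolding continuous_on_def by auto
      then show ?thesis using tendsto_mono[OF atr] unfolding \<rho>_def by simp
    qed
    have "\<pi> (\<gamma> s) \<notin> D" using s component_facts(5)[OF D(1)] unfolding E_def by blast
    have "continuous_on {0..1} (\<lambda>x. v (\<rho> x))" by (rule continuous_on_compose2[OF vc \<rho>cont])
    then have "((\<lambda>x. v (\<rho> x)) \<longlongrightarrow> v (\<rho> 0)) (at 0 within {0..1})" unfolding continuous_on_def by auto
    then have "((\<lambda>x. v (\<rho> x)) \<longlongrightarrow> v s) (at_right 0)" using tendsto_mono[OF atr] unfolding \<rho>_def by simp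
    then have "((\<lambda>x. v (\<rho> x) - u t) \<longlongrightarrow> v s - u t) (at_right 0)" by (intro tendsto_intros)
    moreover have "\<forall>\<^sub>F x in at_right 0. v (\<rho> x) - u t = H D (\<gamma> (\<rho> x))"
      using evI
    proof eventually_elim
      case (elim x)
      have "\<pi> (\<gamma> (\<rho> x)) \<in> D" using img elim by blast
      then have "u (\<rho> x) = v (\<rho> x) - H D (\<gamma> (\<rho> x))" unfolding u_def using \<eta>D[OF D(1)] by simp
      then show ?case using const[OF elim] \<open>\<rho> 1 = t\<close> by simp
    qed
    ultimately have limH: "((\<lambda>x. H D (\<gamma> (\<rho> x))) \<longlongrightarrow> v s - u t) (at_right 0)" by (rule Lim_transform_eventually)
    have evD: "\<forall>\<^sub>F x in at_right 0. \<pi> (\<gamma> (\<rho> x)) \<in> D \<and> \<gamma> (\<rho> x) \<notin> simple_poles B \<omega>"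
      using evI by eventually_elim (use img np \<rho>off in blast)
    have "v s - u t = 0"
      by (rule conjunct2[OF H[OF D(1)], rule_format, where f = "\<lambda>x. \<gamma> (\<rho> x)" and F = "at_right 0"])
         (fact trivial_limit_at_right_real evD lim\<pi> \<open>\<pi> (\<gamma> s) \<notin> D\<close> limH)+
    then show ?thesis by simp
  qed
  \<comment> \<open>Each value of \<open>u\<close> is a value of \<open>v\<close> at some point of
    \<open>E\<close> no farther from \<open>t\<close>. Continuity of \<open>u\<close> at points of
    \<open>E\<close> is thus reduced to that of \<open>v\<close>, even where infinitely many gaps
    accumulate.\<close>
  have near: "\<exists>s\<in>E. u r = v s \<and> \<bar>s - t\<bar> \<le> \<bar>r - t\<bar>" if t: "t \<in> E" and r: "r \<in> {0..1}" for t r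
  proof -
    have t01: "t \<in> {0..1}" using t unfolding E_def by blast
    define X where "X = {x \<in> {0..1}. t + x * (r - t) \<in> E}"
    have "closed ({0..1} \<inter> (\<lambda>x. t + x * (r - t)) -` E)"
      using \<open>closed E\<close> by (intro continuous_closed_preimage continuous_intros) auto
    moreover have "X = {0..1} \<inter> (\<lambda>x. t + x * (r - t)) -` E" unfolding X_def by blast
    ultimately have "compact X" unfolding X_def by (metis (no_types, lifting) bounded_closed_interval bounded_subset compact_eq_bounded_closed inf_le1)
    moreover have "0 \<in> X" unfolding X_def using t by simp
    \<comment> \<open>The last point of \<open>E\<close> on the way from \<open>t\<close> to
      \<open>r\<close>; the rest of the segment is free of \<open>E\<close>, so \<open>uv\<close>
      applies to it.\<close>
    ultimately obtain x where x: "x \<in> X" "\<And>z. z \<in> X \<Longrightarrow> z \<le> x" using compact_attains_sup[of X] by blast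
    define s where "s = t + x * (r - t)"
    have sE: "s \<in> E" and x01: "0 \<le> x" "x \<le> 1" using x(1) unfolding X_def s_def by auto
    have "u r = v s"
    proof (cases "x = 1")
      case True
      then have "s = r" unfolding s_def by simp
      then show ?thesis using uE sE by simp
    next
      case False
      then have x1: "x < 1" using x01 by simp
      show ?thesis
      proof (rule uv[OF sE r])
        fix z :: real assume z: "0 < z" "z \<le> 1"
        show "s + z * (r - s) \<notin> E"
        proof
          assume "s + z * (r - s) \<in> E"
          moreover have "s + z * (r - s) = t + (x + z * (1 - x)) * (r - t)" unfolding s_def by (simp add: algebra_simps)
          moreover have "z * (1 - x) \<le> 1 * (1 - x)" using z x1 by (intro mult_right_mono) auto
          moreover have "0 < z * (1 - x)" using z x1 by simp
          ultimately have "x + z * (1 - x) \<in> X" unfolding X_def using x01 by auto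
          then show False using x(2) \<open>0 < z * (1 - x)\<close> by fastforce
        qed
      qed
    qed
    moreover have "\<bar>s - t\<bar> \<le> \<bar>r - t\<bar>"
    proof -
      have "\<bar>s - t\<bar> = x * \<bar>r - t\<bar>" unfolding s_def using x01(1) by (simp add: abs_mult)
      then show ?thesis using x01(2) mult_right_mono[of x 1 "\<bar>r - t\<bar>"] by simp
    qed
    ultimately show ?thesis using sE by blast
  qed
  have uc: "continuous_on {0..1} u"
    unfolding continuous_on_iff
  proof (intro ballI allI impI)
    fix t e :: real assume t: "t \<in> {0..1}" and e: "0 < e"
    show "\<exists>d>0. \<forall>r\<in>{0..1}. dist r t < d \<longrightarrow> dist (u r) (u t) < e"
    proof (cases "t \<in> E")
      case True
      obtain d where d: "0 < d" "\<And>s. s \<in> {0..1} \<Longrightarrow> dist s t < d \<Longrightarrow> dist (v s) (v t) < e"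
        using vc t e unfolding continuous_on_iff by meson
      have "dist (u r) (u t) < e" if r: "r \<in> {0..1}" "dist r t < d" for r
      proof -
        obtain s where s: "s \<in> E" "u r = v s" "\<bar>s - t\<bar> \<le> \<bar>r - t\<bar>" using near[OF True r(1)] by blast
        have "s \<in> {0..1}" using s(1) unfolding E_def by blast
        then show ?thesis using d(2)[of s] s r(2) uE[OF True] by (simp add: dist_real_def)
      qed
      then show ?thesis using d(1) by blast
    next
      case False
      then obtain d where d: "0 < d" "\<forall>s\<in>{0..1}. \<bar>s - t\<bar> < d \<longrightarrow> u s = u t" using uloc t by blast
      then show ?thesis using e by (intro exI[of _ d]) (auto simp: dist_real_def)
    qed
  qed
  \<comment> \<open>Near each parameter \<open>v\<close> differs from the imaginary part of a local
    primitive by a constant, so \<open>countable_graph_values\<close> applies; finitely many such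
    neighbourhoods cover the interval.\<close>
  have cv: "countable (v ` E)"
  proof -
    have "\<exists>e>0. countable (v ` (E \<inter> ball t e))" if t: "t \<in> {0..1}" for t
    proof -
      obtain W where W: "\<forall>\<^sub>F y' in nhds (\<gamma> t). primitive_at W y'" using prim[OF t] by blast
      obtain e1 where e1: "0 < e1" "\<forall>s\<in>{0..1}. \<bar>s - t\<bar> < e1 \<longrightarrow> V s - V t = W (\<gamma> s) - W (\<gamma> t)"
        using V(3)[OF t W] by blast
      obtain N where N: "open N" "\<gamma> t \<in> N" "countable ((\<lambda>y. Im (W y)) ` (N \<inter> \<pi> -` G))"
        by (rule countable_graph_values[OF W])
      have "\<forall>\<^sub>F y' in nhds (\<gamma> t). y' \<in> N" using N(1,2) by (rule eventually_nhds_in_open)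
      then obtain e2 where e2: "0 < e2" "\<forall>s\<in>{0..1}. \<bar>s - t\<bar> < e2 \<longrightarrow> \<gamma> s \<in> N" using evt[OF t] by blast
      have "v ` (E \<inter> ball t (min e1 e2)) \<subseteq> (\<lambda>x. x + (v t - Im (W (\<gamma> t)))) ` ((\<lambda>y. Im (W y)) ` (N \<inter> \<pi> -` G))"
      proof
        fix x assume "x \<in> v ` (E \<inter> ball t (min e1 e2))"
        then obtain s where s: "s \<in> E" "\<bar>s - t\<bar> < e1" "\<bar>s - t\<bar> < e2" "x = v s"
          by (auto simp: dist_real_def abs_minus_commute)
        have s01: "s \<in> {0..1}" "\<pi> (\<gamma> s) \<in> G" using s(1) unfolding E_def by auto
        have "V s - V t = W (\<gamma> s) - W (\<gamma> t)" using e1(2) s01 s(2) by blast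
        then have "v s - v t = Im (W (\<gamma> s)) - Im (W (\<gamma> t))" unfolding v_def by (metis minus_complex.simps(2))
        then have "x = Im (W (\<gamma> s)) + (v t - Im (W (\<gamma> t)))" using s(4) by simp
        moreover have "\<gamma> s \<in> N \<inter> \<pi> -` G" using e2(2) s01 s(3) by simp
        ultimately show "x \<in> (\<lambda>x. x + (v t - Im (W (\<gamma> t)))) ` ((\<lambda>y. Im (W y)) ` (N \<inter> \<pi> -` G))" by blast
      qed
      then have "countable (v ` (E \<inter> ball t (min e1 e2)))"
        by (rule countable_subset) (intro countable_image N(3))
      then show ?thesis using e1(1) e2(1) by (intro exI[of _ "min e1 e2"]) auto
    qed
    then obtain e where e: "\<And>t. t \<in> {0..1} \<Longrightarrow> 0 < e t" "\<And>t. t \<in> {0..1} \<Longrightarrow> countable (v ` (E \<inter> ball t (e t)))"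
      by metis
    have "{0..1} \<subseteq> (\<Union>t\<in>{0..1}. ball t (e t))" using e(1) by force
    then obtain C where C: "C \<subseteq> {0..1}" "finite C" "{0..1} \<subseteq> (\<Union>t\<in>C. ball t (e t))"
      using compactE_image[of "{0..1::real}" "{0..1}" "\<lambda>t. ball t (e t)"] by auto
    have "v ` E \<subseteq> (\<Union>t\<in>C. v ` (E \<inter> ball t (e t)))"
    proof
      fix x assume "x \<in> v ` E"
      then obtain s where s: "s \<in> E" "x = v s" by blast
      then have "s \<in> {0..1}" unfolding E_def by blast
      then obtain t where "t \<in> C" "s \<in> ball t (e t)" using C(3) by blast
      then show "x \<in> (\<Union>t\<in>C. v ` (E \<inter> ball t (e t)))" using s by blast
    qed
    moreover have "countable (\<Union>t\<in>C. v ` (E \<inter> ball t (e t)))"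
      using C(1) e(2) by (intro countable_UN countable_finite[OF C(2)]) blast
    ultimately show ?thesis by (rule countable_subset)
  qed
  have cu: "countable (u ` ({0..1} - E))"
  proof (rule countable_locally_constant)
    fix t assume "t \<in> {0..1} - E"
    then obtain e where e: "0 < e" "\<forall>s\<in>{0..1}. \<bar>s - t\<bar> < e \<longrightarrow> u s = u t" using uloc by blast
    then have "\<forall>s\<in>ball t e \<inter> ({0..1} - E). u s = u t" by (auto simp: dist_real_def abs_minus_commute)
    then show "\<exists>U. open U \<and> t \<in> U \<and> (\<forall>s\<in>U \<inter> ({0..1} - E). u s = u t)"
      using e(1) by (intro exI[of _ "ball t e"]) auto
  qed
  have "u ` {0..1} \<subseteq> v ` E \<union> u ` ({0..1} - E)" using uE by force
  then have "countable (u ` {0..1})" by (rule countable_subset) (use cv cu in auto)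
  moreover have "connected (u ` {0..1})" using uc by (intro connected_continuous_image) auto
  ultimately have "u 0 = u 1"
    using connected_uncountable[of "u ` {0..1}" "u 0" "u 1"] by auto
  moreover have "\<gamma> 0 = \<gamma> 1" using loop unfolding pathfinish_def pathstart_def by simp
  ultimately have "v 1 - v 0 = 0" unfolding u_def by simp
  then have "V 1 - V 0 = of_real (Re (V 1 - V 0))" unfolding v_def by (simp add: complex_eq_iff)
  then show ?thesis using V(2) by metis
qed

end

theorem lemma3p1:
  fixes A :: "'a::t2_space chart set" and q :: "'a differential"
    and B :: "'b::t2_space chart set" and \<omega> :: "'b differential"
    and \<pi> :: "'b \<Rightarrow> 'a" and \<gamma> :: "real \<Rightarrow> 'b"
  assumes "riemann_surface A" and "compact (UNIV :: 'a set)" and "connected (UNIV :: 'a set)"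
    and "strebel_differential A q"
    and "spectral_cover A q B \<pi> \<omega>"
    and "piecewise_smooth_path B \<gamma>" and "pathfinish \<gamma> = pathstart \<gamma>"
    and "path_image \<gamma> \<inter> simple_poles B \<omega> = {}"
  shows "\<exists>r::real. form_has_integral B \<omega> \<gamma> (of_real r)"
proof -
  interpret spectral A q B \<pi> \<omega>
    using assms(1-5) by unfold_locales
  show ?thesis using assms(6-8) by (rule real_period)
qed

end
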